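(* Let $\pi:Q\to M=Q/G$ be a right principal $G$-bundle equipped with a horizontal distribution $\mathrm{H}Q\subset \mathrm{T}Q$ (not necessarily $G$-invariant) and a smooth Lagrangian $L:\mathrm{T}Q\to\mathbb{R}$ (not necessarily $G$-invariant), and let $\widetilde X(t)\in\mathrm H_{q(t)}Q$ be a horizontal admissible path. Consider the following conditions. (N) $\int_I\langle \mathrm{H}L(\widetilde X(t)),b(t)\rangle\,\mathrm{d}t=\int_I\langle \mathrm{F}L(\widetilde X(t)),\mathcal{R}(q(t))(X(t),Y(t))\rangle\,\mathrm{d}t$ for each pair of curves $\widetilde Y(t)\in \mathrm{H}_{q(t)}Q$ and $b(t)\in\mathfrak{g}$ vanishing at the end-points and related by $\dot b(t)+\mathcal{B}(q(t))(X(t),b(t))+\mathcal{R}(q(t))(X(t),Y(t))=0$. (V) for a curve $\lambda:I\to\mathfrak g^*$: $\langle\lambda(t),\mathcal{R}(q(t))(X(t),Y)\rangle=0$ for every $t\in[t_0,t_1]$ and every $Y\in \mathrm{T}_{\pi(q(t))}M$. (M) for a curve $\lambda:I\to\mathfrak g^*$: $\big\langle\mathrm HL(\widetilde X(t))-\frac{\mathrm d}{\mathrm dt}\big(\mathrm FL(\widetilde X(t))-\lambda(t)\big),b\big\rangle+\big\langle\mathrm FL(\widetilde X(t))-\lambda(t),\mathcal B(q(t))(X(t),b)\big\rangle=0$ for every $t\in I$ and $b\in\mathfrak g$. Then conditions (N) and (V) are equivalent in the following sense: if (V) holds for some multiplier $\lambda(t)$ satisfying (M), then (N) holds; conversely,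 if (N) holds, then there exists a multiplier $\lambda(t)$ satisfying (M) such that (V) holds.
   Context: Everything is $C^\infty$; $I=[t_0,t_1]$ is a fixed interval. $\mathrm{V}Q=\ker\pi_*$; a horizontal distribution is a smooth distribution with $\mathrm{T}_qQ=\mathrm{H}_qQ\oplus\mathrm{V}_qQ$ for all $q$. A horizontal admissible path is a curve $\widetilde X(t)\in\mathrm{H}_{q(t)}Q$ which is the tangent lift of a curve $q(t)$ in $Q$. $\mathfrak g=\mathrm{T}_eG$ carries the left Lie algebra structure. For $a\in\mathfrak g$, $\widetilde a$ is the fundamental vector field on $Q$, with flow $q\mapsto q\cdot\exp(ta)$; this identifies $\mathrm{V}Q\approx Q\times\mathfrak g$. $\omega:\mathrm{T}Q\to\mathfrak g$ is the projection onto the $\mathfrak g$-part in $\mathrm{T}Q=\mathrm{H}Q\oplus_Q(Q\times\mathfrak g)$. For $X\in\mathrm{T}_xM$ and $q\in\pi^{-1}(x)$, $\widetilde X_q\in\mathrm{H}_qQ$ is the horizontal lift. For a path $\widetilde X(t)$, $X(t)=\pi_*\widetilde X(t)$, and similarly $Y(t)=\pi_*\widetilde Y(t)$. Maps (tensorial, so defined by extending $X,Y$ to vector fields on $M$): curvature $\mathcal R(q)(X,Y)=\omega([\widetilde X,\widetilde Y]-\widetilde{[X,Y]})(q)\in\mathfrak g$, and $\mathcal B(q)(X,a)=\omega([\widetilde X,\widetilde a])(q)\in\mathfrak g$. Derivatives of $L$: $\mathrm{F}L,\mathrm{H}L:\mathrm{H}Q\to\mathfrak g^*$, $\langle\mathrm{F}L(\widetilde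 X_q),b\rangle=\frac{\mathrm d}{\mathrm dt}\big|_0L(\widetilde X_q+t\,\widetilde b_q)$ and $\langle\mathrm{H}L(\widetilde X_q),b\rangle=\frac{\mathrm d}{\mathrm dt}\big|_0L(\widetilde X_{q\cdot\exp(tb)})$, where $\widetilde X_{q\cdot \exp(tb)}$ is the horizontal lift of the same $X$ to the point $q\cdot\exp(tb)$. *)

theory Defs
  imports "HOL-Analysis.Analysis"
begin

section \<open>Model spaces\<close>

text \<open>
  This is the class \<^class>\<open>euclidean_space\<close> without the requirement that the dimension be
  positive. Zero-dimensional manifolds (discrete structure groups, zero-dimensional bases)
  are thus not excluded.
\<close>

class finite_euclidean = real_inner +
  assumes ex_orthonormal_basis:
    "\<exists>B. finite B \<and> (\<forall>u\<in>B. \<forall>v\<in>B. inner u v = (if u = v then 1 else 0)) \<and>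
      (\<forall>x. (\<forall>u\<in>B. inner x u = 0) \<longrightarrow> x = 0)"

instance euclidean_space \<subseteq> finite_euclidean
proof
  show "\<exists>B::'a set. finite B \<and> (\<forall>u\<in>B. \<forall>v\<in>B. inner u v = (if u = v then 1 else 0)) \<and>
      (\<forall>x. (\<forall>u\<in>B. inner x u = 0) \<longrightarrow> x = 0)"
    by (rule exI[of _ Basis]) (auto simp: inner_Basis euclidean_all_zero_iff)
qed


section \<open>Smooth functions between vector spaces\<close>

text \<open>
  The set \<open>S\<close> is meant to be open, or relatively open in a nondegenerate interval of the real line
  (with one-sided derivatives at the end-points). On such sets the derivative is unique. In finite
  dimension it suffices to ask for continuity of each directional derivative.
\<close>

primrec k_smooth_on ::
  "nat \<Rightarrow> 'a::real_normed_vector set \<Rightarrow> ('a \<Rightarrow> 'b::real_normed_vector) \<Rightarrow> bool" where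
  "k_smooth_on 0 S f \<longleftrightarrow> continuous_on S f"
| "k_smooth_on (Suc k) S f \<longleftrightarrow>
    (\<exists>f'. (\<forall>x\<in>S. (f has_derivative f' x) (at x within S)) \<and> (\<forall>v. k_smooth_on k S (\<lambda>x. f' x v)))"

definition smooth_on ::
  "'a::real_normed_vector set \<Rightarrow> ('a \<Rightarrow> 'b::real_normed_vector) \<Rightarrow> bool" where
  "smooth_on S f \<longleftrightarrow> (\<forall>k. k_smooth_on k S f)"


section \<open>Smooth manifolds\<close>

type_synonym ('p, 'e) chart = "'p set \<times> ('p \<Rightarrow> 'e)"

definition chart_inv :: "('p, 'e) chart \<Rightarrow> 'e \<Rightarrow> 'p" where
  "chart_inv c = inv_into (fst c) (snd c)"

text \<open>
  A smooth structure is given by a (not necessarily maximal) atlas on a type that is a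
  second countable Hausdorff space.
\<close>

definition smooth_atlas ::
  "('p::{t2_space,second_countable_topology}, 'e::finite_euclidean) chart set \<Rightarrow> bool" where
  "smooth_atlas A \<longleftrightarrow>
    (\<Union>c\<in>A. fst c) = UNIV \<and>
    (\<forall>c\<in>A. open (fst c) \<and> open (snd c ` fst c) \<and>
       homeomorphism (fst c) (snd c ` fst c) (snd c) (chart_inv c)) \<and>
    (\<forall>c\<in>A. \<forall>d\<in>A. smooth_on (snd c ` (fst c \<inter> fst d)) (snd d \<circ> chart_inv c))"

definition smooth_map_on ::
  "('p::topological_space, 'e::real_normed_vector) chart set \<Rightarrow>
   ('q::topological_space, 'f::real_normed_vector) chart set \<Rightarrow> 'p set \<Rightarrow> ('p \<Rightarrow> 'q) \<Rightarrow> bool" where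
  "smooth_map_on A B S f \<longleftrightarrow> continuous_on S f \<and>
    (\<forall>c\<in>A. \<forall>d\<in>B. smooth_on (snd c ` (S \<inter> fst c \<inter> f -` fst d)) (snd d \<circ> f \<circ> chart_inv c))"

definition line_atlas :: "(real, real) chart set" where
  "line_atlas = {(UNIV, id)}"

definition prod_atlas ::
  "('p, 'e) chart set \<Rightarrow> ('q, 'f) chart set \<Rightarrow> ('p \<times> 'q, 'e \<times> 'f) chart set" where
  "prod_atlas A B = {(fst c \<times> fst d, map_prod (snd c) (snd d)) | c d. c \<in> A \<and> d \<in> B}"


section \<open>Tangent vectors\<close>

text \<open>
  Each point \<open>p\<close> has a preferred chart, and the tangent space at \<open>p\<close> is the model space, a
  tangent vector being represented by its coordinates in the preferred chart at its base point.
  Smoothness of objects with values in the tangent bundle therefore always refers to their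
  coordinates in a fixed chart \<open>c\<close>, obtained with \<open>coords_in\<close>; its inverse is
  \<open>from_coords\<close>.
\<close>

definition chart_at :: "('p, 'e) chart set \<Rightarrow> 'p \<Rightarrow> ('p, 'e) chart" where
  "chart_at A p = (SOME c. c \<in> A \<and> p \<in> fst c)"

definition coords_in ::
  "('p, 'e::real_normed_vector) chart set \<Rightarrow> ('p, 'e) chart \<Rightarrow> 'p \<Rightarrow> 'e \<Rightarrow> 'e" where
  "coords_in A c p =
    frechet_derivative (snd c \<circ> chart_inv (chart_at A p)) (at (snd (chart_at A p) p))"

definition from_coords ::
  "('p, 'e::real_normed_vector) chart set \<Rightarrow> ('p, 'e) chart \<Rightarrow> 'p \<Rightarrow> 'e \<Rightarrow> 'e" where
  "from_coords A c p =
    frechet_derivative (snd (chart_at A p) \<circ> chart_inv c) (at (snd c p))"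

definition tangent_map ::
  "('p, 'e::real_normed_vector) chart set \<Rightarrow> ('q, 'f::real_normed_vector) chart set \<Rightarrow>
   ('p \<Rightarrow> 'q) \<Rightarrow> 'p \<Rightarrow> 'e \<Rightarrow> 'f" where
  "tangent_map A B f p =
    frechet_derivative (snd (chart_at B (f p)) \<circ> f \<circ> chart_inv (chart_at A p))
      (at (snd (chart_at A p) p))"

definition velocity ::
  "('p, 'e::real_normed_vector) chart set \<Rightarrow> real set \<Rightarrow> (real \<Rightarrow> 'p) \<Rightarrow> real \<Rightarrow> 'e" where
  "velocity A I \<gamma> t = vector_derivative (snd (chart_at A (\<gamma> t)) \<circ> \<gamma>) (at t within I)"

text \<open>Smooth curves \<open>t \<mapsto> (\<gamma> t, v t)\<close> in the tangent bundle:\<close>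

definition smooth_tangent_curve ::
  "('p::topological_space, 'e::real_normed_vector) chart set \<Rightarrow> real set \<Rightarrow>
   (real \<Rightarrow> 'p) \<Rightarrow> (real \<Rightarrow> 'e) \<Rightarrow> bool" where
  "smooth_tangent_curve A I \<gamma> v \<longleftrightarrow> smooth_map_on line_atlas A I \<gamma> \<and>
    (\<forall>c\<in>A. smooth_on (I \<inter> \<gamma> -` fst c) (\<lambda>t. coords_in A c (\<gamma> t) (v t)))"

text \<open>Smooth real-valued functions on the tangent bundle:\<close>

definition smooth_on_tangent_bundle ::
  "('p, 'e::real_normed_vector) chart set \<Rightarrow> ('p \<times> 'e \<Rightarrow> real) \<Rightarrow> bool" where
  "smooth_on_tangent_bundle A L \<longleftrightarrow>
    (\<forall>c\<in>A. smooth_on (snd c ` fst c \<times> UNIV)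
       (\<lambda>(x, w). L (chart_inv c x, from_coords A c (chart_inv c x) w)))"

definition local_rep ::
  "('p, 'e::real_normed_vector) chart set \<Rightarrow> ('p, 'e) chart \<Rightarrow> ('p \<Rightarrow> 'e) \<Rightarrow> 'e \<Rightarrow> 'e" where
  "local_rep A c X x = coords_in A c (chart_inv c x) (X (chart_inv c x))"

definition smooth_vector_field_on ::
  "('p, 'e::real_normed_vector) chart set \<Rightarrow> 'p set \<Rightarrow> ('p \<Rightarrow> 'e) \<Rightarrow> bool" where
  "smooth_vector_field_on A W X \<longleftrightarrow> (\<forall>c\<in>A. smooth_on (snd c ` (W \<inter> fst c)) (local_rep A c X))"

definition lie_bracket ::
  "('p, 'e::real_normed_vector) chart set \<Rightarrow> ('p \<Rightarrow> 'e) \<Rightarrow> ('p \<Rightarrow> 'e) \<Rightarrow> 'p \<Rightarrow> 'e" where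
  "lie_bracket A X Y p =
    (let c = chart_at A p; x = snd c p; X' = local_rep A c X; Y' = local_rep A c Y
     in frechet_derivative Y' (at x) (X' x) - frechet_derivative X' (at x) (Y' x))"


section \<open>Principal bundles\<close>

record ('q, 'eq, 'm, 'em, 'g, 'eg) bundle_data =
  tot :: "('q, 'eq) chart set"
  base :: "('m, 'em) chart set"
  grp :: "('g, 'eg) chart set"
  mul :: "'g \<Rightarrow> 'g \<Rightarrow> 'g"
  unit :: "'g"
  ginv :: "'g \<Rightarrow> 'g"
  act :: "'q \<Rightarrow> 'g \<Rightarrow> 'q"
  proj :: "'q \<Rightarrow> 'm"

definition lie_group ::
  "('g::{t2_space,second_countable_topology}, 'e::finite_euclidean) chart set \<Rightarrow>
   ('g \<Rightarrow> 'g \<Rightarrow> 'g) \<Rightarrow> 'g \<Rightarrow> ('g \<Rightarrow> 'g) \<Rightarrow> bool" where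
  "lie_group A m e i \<longleftrightarrow> smooth_atlas A \<and> group m e i \<and>
    smooth_map_on (prod_atlas A A) A UNIV (\<lambda>(g, h). m g h) \<and> smooth_map_on A A UNIV i"

text \<open>
  In a local trivialization \<open>q \<mapsto> (proj q, \<tau> q)\<close>, \<open>\<kappa>\<close> is the inverse diffeomorphism.
  Local triviality makes the action free, its orbits being exactly the fibres of the projection.
\<close>

definition principal_bundle ::
  "('q::{t2_space,second_countable_topology}, 'eq::finite_euclidean,
    'm::{t2_space,second_countable_topology}, 'em::finite_euclidean,
    'g::{t2_space,second_countable_topology}, 'eg::finite_euclidean) bundle_data \<Rightarrow> bool" where
  "principal_bundle P \<longleftrightarrow>
    smooth_atlas (tot P) \<and> smooth_atlas (base P) \<and>
    lie_group (grp P) (mul P) (unit P) (ginv P) \<and>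
    smooth_map_on (tot P) (base P) UNIV (proj P) \<and>
    smooth_map_on (prod_atlas (tot P) (grp P)) (tot P) UNIV (\<lambda>(q, g). act P q g) \<and>
    (\<forall>q. act P q (unit P) = q) \<and>
    (\<forall>q g h. act P (act P q g) h = act P q (mul P g h)) \<and>
    (\<forall>q g. proj P (act P q g) = proj P q) \<and>
    (\<forall>x. \<exists>V \<tau> \<kappa>. open V \<and> x \<in> V \<and>
       smooth_map_on (tot P) (grp P) (proj P -` V) \<tau> \<and>
       smooth_map_on (prod_atlas (base P) (grp P)) (tot P) (V \<times> UNIV) \<kappa> \<and>
       (\<forall>q. proj P q \<in> V \<longrightarrow> \<kappa> (proj P q, \<tau> q) = q) \<and>
       (\<forall>y\<in>V. \<forall>g. proj P (\<kappa> (y, g)) = y \<and> \<tau> (\<kappa> (y, g)) = g) \<and>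
       (\<forall>q g. proj P q \<in> V \<longrightarrow> \<tau> (act P q g) = mul P (\<tau> q) g))"

text \<open>
  The Lie algebra is the tangent space of the group at the unit, that is, the model space
  of the group; \<open>lie_exp P a\<close> is the value at time 1 of the one-parameter subgroup with initial
  velocity \<open>a\<close>.
\<close>

definition one_parameter_subgroup ::
  "('q, 'eq, 'm, 'em, 'g::topological_space, 'eg::real_normed_vector) bundle_data \<Rightarrow>
   (real \<Rightarrow> 'g) \<Rightarrow> bool" where
  "one_parameter_subgroup P \<gamma> \<longleftrightarrow> smooth_map_on line_atlas (grp P) UNIV \<gamma> \<and>
    \<gamma> 0 = unit P \<and> (\<forall>s t. \<gamma> (s + t) = mul P (\<gamma> s) (\<gamma> t))"

definition lie_exp ::
  "('q, 'eq, 'm, 'em, 'g::topological_space, 'eg::real_normed_vector) bundle_data \<Rightarrow> 'eg \<Rightarrow> 'g" where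
  "lie_exp P a =
    (THE \<gamma>. one_parameter_subgroup P \<gamma> \<and> velocity (grp P) UNIV \<gamma> 0 = a) 1"

definition fundamental_field ::
  "('q, 'eq::real_normed_vector, 'm, 'em, 'g::topological_space, 'eg::real_normed_vector) bundle_data \<Rightarrow>
   'eg \<Rightarrow> 'q \<Rightarrow> 'eq" where
  "fundamental_field P a q = velocity (tot P) UNIV (\<lambda>t. act P q (lie_exp P (t *\<^sub>R a))) 0"


section \<open>Horizontal distributions\<close>

definition vertical ::
  "('q, 'eq::real_normed_vector, 'm, 'em::real_normed_vector, 'g, 'eg) bundle_data \<Rightarrow> 'q \<Rightarrow> 'eq set" where
  "vertical P q = {v. tangent_map (tot P) (base P) (proj P) q v = 0}"

definition smooth_distribution ::
  "('p::topological_space, 'e::real_normed_vector) chart set \<Rightarrow> ('p \<Rightarrow> 'e set) \<Rightarrow> bool" where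
  "smooth_distribution A D \<longleftrightarrow>
    (\<forall>p. \<exists>W (k::nat) X. open W \<and> p \<in> W \<and> (\<forall>i<k. smooth_vector_field_on A W (X i)) \<and>
       (\<forall>r\<in>W. inj_on (\<lambda>i. X i r) {..<k} \<and> independent ((\<lambda>i. X i r) ` {..<k}) \<and>
          D r = span ((\<lambda>i. X i r) ` {..<k})))"

definition horizontal_distribution ::
  "('q::topological_space, 'eq::real_normed_vector, 'm, 'em::real_normed_vector, 'g, 'eg) bundle_data \<Rightarrow>
   ('q \<Rightarrow> 'eq set) \<Rightarrow> bool" where
  "horizontal_distribution P H \<longleftrightarrow> smooth_distribution (tot P) H \<and>
    (\<forall>q. H q \<inter> vertical P q = {0} \<and> {h + v | h v. h \<in> H q \<and> v \<in> vertical P q} = UNIV)"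

definition vert_part ::
  "('q, 'eq::real_normed_vector, 'm, 'em, 'g::topological_space, 'eg::real_normed_vector) bundle_data \<Rightarrow>
   ('q \<Rightarrow> 'eq set) \<Rightarrow> 'q \<Rightarrow> 'eq \<Rightarrow> 'eg" where
  "vert_part P H q v = (THE a. v - fundamental_field P a q \<in> H q)"

definition horizontal_lift ::
  "('q, 'eq::real_normed_vector, 'm, 'em::real_normed_vector, 'g, 'eg) bundle_data \<Rightarrow>
   ('q \<Rightarrow> 'eq set) \<Rightarrow> 'q \<Rightarrow> 'em \<Rightarrow> 'eq" where
  "horizontal_lift P H q X =
    (THE v. v \<in> H q \<and> tangent_map (tot P) (base P) (proj P) q v = X)"

definition lift_field ::
  "('q, 'eq::real_normed_vector, 'm, 'em::real_normed_vector, 'g, 'eg) bundle_data \<Rightarrow>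
   ('q \<Rightarrow> 'eq set) \<Rightarrow> ('m \<Rightarrow> 'em) \<Rightarrow> 'q \<Rightarrow> 'eq" where
  "lift_field P H X q = horizontal_lift P H q (X (proj P q))"

text \<open>
  The next two maps are tensorial: the value is the common one for all extensions of the tangent
  vectors to vector fields on the base.
\<close>

definition curvature ::
  "('q, 'eq::real_normed_vector, 'm, 'em::real_normed_vector, 'g::topological_space,
    'eg::real_normed_vector) bundle_data \<Rightarrow> ('q \<Rightarrow> 'eq set) \<Rightarrow> 'q \<Rightarrow> 'em \<Rightarrow> 'em \<Rightarrow> 'eg" where
  "curvature P H q X Y = (THE c. \<forall>X' Y'.
     smooth_vector_field_on (base P) UNIV X' \<and> X' (proj P q) = X \<and>
     smooth_vector_field_on (base P) UNIV Y' \<and> Y' (proj P q) = Y \<longrightarrow>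
     c = vert_part P H q
           (lie_bracket (tot P) (lift_field P H X') (lift_field P H Y') q
            - lift_field P H (lie_bracket (base P) X' Y') q))"

definition vert_bracket ::
  "('q, 'eq::real_normed_vector, 'm, 'em::real_normed_vector, 'g::topological_space,
    'eg::real_normed_vector) bundle_data \<Rightarrow> ('q \<Rightarrow> 'eq set) \<Rightarrow> 'q \<Rightarrow> 'em \<Rightarrow> 'eg \<Rightarrow> 'eg" where
  "vert_bracket P H q X a = (THE c. \<forall>X'.
     smooth_vector_field_on (base P) UNIV X' \<and> X' (proj P q) = X \<longrightarrow>
     c = vert_part P H q (lie_bracket (tot P) (lift_field P H X') (fundamental_field P a) q))"


section \<open>Derivatives of the Lagrangian\<close>

text \<open>Both have values in the dual of the Lie algebra; \<open>v\<close> is a horizontal vector at \<open>q\<close>.\<close>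

definition FL ::
  "('q, 'eq::real_normed_vector, 'm, 'em, 'g::topological_space, 'eg::real_normed_vector) bundle_data \<Rightarrow>
   ('q \<times> 'eq \<Rightarrow> real) \<Rightarrow> 'q \<Rightarrow> 'eq \<Rightarrow> 'eg \<Rightarrow>\<^sub>L real" where
  "FL P L q v = Blinfun (\<lambda>b. deriv (\<lambda>t. L (q, v + t *\<^sub>R fundamental_field P b q)) 0)"

definition HL ::
  "('q, 'eq::real_normed_vector, 'm, 'em::real_normed_vector, 'g::topological_space,
    'eg::real_normed_vector) bundle_data \<Rightarrow> ('q \<Rightarrow> 'eq set) \<Rightarrow> ('q \<times> 'eq \<Rightarrow> real) \<Rightarrow>
   'q \<Rightarrow> 'eq \<Rightarrow> 'eg \<Rightarrow>\<^sub>L real" where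
  "HL P H L q v = Blinfun (\<lambda>b. deriv (\<lambda>t.
     let q' = act P q (lie_exp P (t *\<^sub>R b))
     in L (q', horizontal_lift P H q' (tangent_map (tot P) (base P) (proj P) q v))) 0)"


section \<open>Horizontal paths and the three conditions\<close>

definition horizontal_admissible_path ::
  "('q::topological_space, 'eq::real_normed_vector, 'm, 'em, 'g, 'eg) bundle_data \<Rightarrow>
   ('q \<Rightarrow> 'eq set) \<Rightarrow> real set \<Rightarrow> (real \<Rightarrow> 'q) \<Rightarrow> (real \<Rightarrow> 'eq) \<Rightarrow> bool" where
  "horizontal_admissible_path P H I q Xt \<longleftrightarrow> smooth_map_on line_atlas (tot P) I q \<and>
    (\<forall>t\<in>I. Xt t = velocity (tot P) I q t \<and> Xt t \<in> H (q t))"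

abbreviation pushdown ::
  "('q, 'eq::real_normed_vector, 'm, 'em::real_normed_vector, 'g, 'eg) bundle_data \<Rightarrow>
   (real \<Rightarrow> 'q) \<Rightarrow> (real \<Rightarrow> 'eq) \<Rightarrow> real \<Rightarrow> 'em" where
  "pushdown P q Xt t \<equiv> tangent_map (tot P) (base P) (proj P) (q t) (Xt t)"

definition condition_N ::
  "('q::topological_space, 'eq::real_normed_vector, 'm, 'em::real_normed_vector,
    'g::topological_space, 'eg::real_normed_vector) bundle_data \<Rightarrow> ('q \<Rightarrow> 'eq set) \<Rightarrow>
   ('q \<times> 'eq \<Rightarrow> real) \<Rightarrow> real \<Rightarrow> real \<Rightarrow> (real \<Rightarrow> 'q) \<Rightarrow> (real \<Rightarrow> 'eq) \<Rightarrow> bool" where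
  "condition_N P H L t0 t1 q Xt \<longleftrightarrow> (\<forall>Yt b.
     smooth_tangent_curve (tot P) {t0..t1} q Yt \<and> (\<forall>t\<in>{t0..t1}. Yt t \<in> H (q t)) \<and>
     smooth_on {t0..t1} b \<and>
     Yt t0 = 0 \<and> Yt t1 = 0 \<and> b t0 = 0 \<and> b t1 = 0 \<and>
     (\<forall>t\<in>{t0..t1}. vector_derivative b (at t within {t0..t1})
        + vert_bracket P H (q t) (pushdown P q Xt t) (b t)
        + curvature P H (q t) (pushdown P q Xt t) (pushdown P q Yt t) = 0) \<longrightarrow>
     integral {t0..t1} (\<lambda>t. blinfun_apply (HL P H L (q t) (Xt t)) (b t)) =
     integral {t0..t1} (\<lambda>t. blinfun_apply (FL P L (q t) (Xt t))
       (curvature P H (q t) (pushdown P q Xt t) (pushdown P q Yt t))))"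

definition condition_V ::
  "('q, 'eq::real_normed_vector, 'm, 'em::real_normed_vector, 'g::topological_space,
    'eg::real_normed_vector) bundle_data \<Rightarrow> ('q \<Rightarrow> 'eq set) \<Rightarrow>
   real \<Rightarrow> real \<Rightarrow> (real \<Rightarrow> 'q) \<Rightarrow> (real \<Rightarrow> 'eq) \<Rightarrow> (real \<Rightarrow> 'eg \<Rightarrow>\<^sub>L real) \<Rightarrow> bool" where
  "condition_V P H t0 t1 q Xt lam \<longleftrightarrow> (\<forall>t\<in>{t0..t1}. \<forall>Y.
     blinfun_apply (lam t) (curvature P H (q t) (pushdown P q Xt t) Y) = 0)"

definition condition_M ::
  "('q, 'eq::real_normed_vector, 'm, 'em::real_normed_vector, 'g::topological_space,
    'eg::real_normed_vector) bundle_data \<Rightarrow> ('q \<Rightarrow> 'eq set) \<Rightarrow> ('q \<times> 'eq \<Rightarrow> real) \<Rightarrow>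
   real \<Rightarrow> real \<Rightarrow> (real \<Rightarrow> 'q) \<Rightarrow> (real \<Rightarrow> 'eq) \<Rightarrow> (real \<Rightarrow> 'eg \<Rightarrow>\<^sub>L real) \<Rightarrow> bool" where
  "condition_M P H L t0 t1 q Xt lam \<longleftrightarrow> (\<forall>t\<in>{t0..t1}. \<forall>b.
     blinfun_apply (HL P H L (q t) (Xt t)
       - vector_derivative (\<lambda>s. FL P L (q s) (Xt s) - lam s) (at t within {t0..t1})) b
     + blinfun_apply (FL P L (q t) (Xt t) - lam t)
         (vert_bracket P H (q t) (pushdown P q Xt t) b) = 0)"

end

theory Submission
  imports Defs
begin

text \<open>
  Put \<open>p = FL - \<lambda>\<close> and write the constraint as \<open>b' = - B b - R Y\<close>. Condition (M) says
  \<open>p' = HL + p B\<close>, so that \<open>(p b)' = HL b - p (R Y)\<close>; integrating, (M) and (V) give (N).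
  Conversely, let \<open>b\<close> solve the constraint with \<open>b t0 = 0\<close> for an arbitrary variation \<open>Y\<close>
  vanishing at the end-points. By (N), the number \<open>\<integral> HL b - \<integral> FL (R Y)\<close> depends only on \<open>b t1\<close>, so it
  equals \<open>c (b t1)\<close> for some \<open>c\<close> in the dual of the Lie algebra. If \<open>p\<close> is the solution of
  \<open>p' = HL + p B\<close> with \<open>p t1 = c\<close>, then \<open>\<integral> (FL - p) (R Y) = 0\<close> for all variations, and (V) follows
  with bump functions.

  What remains is that \<open>R\<close>, \<open>B\<close>, \<open>FL\<close> and \<open>HL\<close> are linear in their arguments and smooth along the path. In
  charts, let \<open>h x\<close> be the horizontal lift, \<open>w x\<close> the projection onto the Lie algebra and
  \<open>\<alpha> x\<close> the fundamental vector fields at \<open>x\<close>. Then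
  \<open>R u v = w (Dh[h u] v - Dh[h v] u)\<close> and \<open>B u a = w (D\<alpha>[h u] a - Dh[\<alpha> a] u)\<close>, which also shows that
  the values do not depend on the extensions to vector fields. The fields \<open>\<alpha>\<close> are linear
  and smooth because \<open>t \<mapsto> exp (t a)\<close> is the solution of an ordinary differential equation.
\<close>

section \<open>Linear algebra and compactness in the model spaces\<close>

section \<open>Finite-dimensional inner product spaces\<close>

text \<open>The end condition \<open>b t1 = 0\<close> is the obstacle: without it every variation
  would come with an admissible \<open>b\<close>. Condition (N) tests only those variations whose
  solution returns to zero, and the multiplier accounts for the others. The end values that can be
  reached may form a proper subspace of the Lie algebra; on it \<open>c\<close> is forced, off it
  \<open>c\<close> is an arbitrary linear extension, so \<lambda> need not be unique.

  On the geometric side, \<open>H\<close> is given by local frames only. Smoothness of the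
  projection onto the Lie algebra is therefore a statement about coefficients in a smooth frame,
  obtained here from an implicit equation for these coefficients instead of inverse matrices. Lifts,
  curvature and the vertical bracket are definite descriptions, so each coordinate formula must also
  establish that the described object exists and is unique, which for the last two requires global
  extensions of tangent vectors. Bump functions do not reach the end-points of the interval; there
  (V) comes from continuity.\<close>

definition obasis :: "'a::finite_euclidean set" where
  "obasis = (SOME B. finite B \<and> (\<forall>u\<in>B. \<forall>v\<in>B. inner u v = (if u = v then 1 else 0)) \<and>
      (\<forall>x. (\<forall>u\<in>B. inner x u = 0) \<longrightarrow> x = 0))"

lemma
  shows finite_obasis [simp, intro]: "finite (obasis :: 'a::finite_euclidean set)"
    and inner_obasis: "\<And>u v::'a. u \<in> obasis \<Longrightarrow> v \<in> obasis \<Longrightarrow> inner u v = (if u = v then 1 else 0)"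
    and obasis_eq_zeroI: "\<And>x::'a. (\<And>u. u \<in> obasis \<Longrightarrow> inner x u = 0) \<Longrightarrow> x = 0"
  using someI_ex[OF ex_orthonormal_basis[where 'a='a]] unfolding obasis_def[symmetric] by blast+

lemma inner_sum_obasis:
  fixes c :: "'a::finite_euclidean \<Rightarrow> real"
  assumes "u \<in> obasis"
  shows "inner (\<Sum>b\<in>obasis. c b *\<^sub>R b) u = c u"
proof -
  have "inner (\<Sum>b\<in>obasis. c b *\<^sub>R b) u = (\<Sum>b\<in>obasis. c b * inner b u)"
    by (simp add: inner_sum_left)
  also have "\<dots> = (\<Sum>b\<in>obasis. if b = u then c b else 0)"
    using assms by (intro sum.cong) (auto simp: inner_obasis)
  finally show ?thesis using assms by simp
qed

lemma obasis_expansion: "(\<Sum>b\<in>obasis. inner x b *\<^sub>R b) = (x::'a::finite_euclidean)"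
proof -
  have "(\<Sum>b\<in>obasis. inner x b *\<^sub>R b) - x = 0"
    by (rule obasis_eq_zeroI) (simp add: inner_diff_left inner_sum_obasis)
  then show ?thesis by simp
qed

lemma norm_obasis: "b \<in> obasis \<Longrightarrow> norm (b::'a::finite_euclidean) = 1"
  by (simp add: norm_eq_sqrt_inner inner_obasis)

lemma zero_notin_obasis: "0 \<notin> (obasis :: 'a::finite_euclidean set)"
  using norm_obasis by fastforce

lemma abs_inner_obasis_le: "b \<in> obasis \<Longrightarrow> \<bar>inner x b\<bar> \<le> norm (x::'a::finite_euclidean)"
  using Cauchy_Schwarz_ineq2[of x b] by (simp add: norm_obasis)

lemma linear_obasis_expansion:
  fixes f :: "'a::finite_euclidean \<Rightarrow> 'b::real_vector"
  assumes "linear f"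
  shows "f x = (\<Sum>b\<in>obasis. inner x b *\<^sub>R f b)"
  using assms by (subst obasis_expansion[of x, symmetric]) (simp add: linear_sum linear_scale)

lemma linear_imp_bounded_linear:
  fixes f :: "'a::finite_euclidean \<Rightarrow> 'b::real_normed_vector"
  assumes "linear f"
  shows "bounded_linear f"
proof -
  have "norm (f x) \<le> norm x * (\<Sum>b\<in>obasis. norm (f b))" for x
  proof -
    have "norm (f x) \<le> (\<Sum>b\<in>obasis. norm (inner x b *\<^sub>R f b))"
      by (subst linear_obasis_expansion[OF assms]) (rule norm_sum)
    also have "\<dots> \<le> (\<Sum>b\<in>obasis. norm x * norm (f b))"
      by (intro sum_mono) (auto intro!: mult_right_mono abs_inner_obasis_le)
    finally show ?thesis by (simp add: sum_distrib_left)
  qed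
  then show ?thesis
    using assms by (auto simp: bounded_linear_def bounded_linear_axioms_def)
qed

text \<open>A bounded sequence has a subsequence along which each of the finitely many coordinates
  converges. Compactness of closed balls and, through completeness, the \<open>banach\<close>
  instance that Picard iteration relies on both come from here.\<close>

instance finite_euclidean \<subseteq> heine_borel
proof
  fix f :: "nat \<Rightarrow> 'a"
  assume f: "bounded (range f)"
  have bp: "bounded ((\<lambda>x. inner x k) ` range f)" for k
    using bounded_linear_image[OF f bounded_linear_inner_left] .
  obtain l and r :: "nat \<Rightarrow> nat" where r: "strict_mono r"
    and l: "\<forall>\<epsilon>>0. eventually (\<lambda>n. \<forall>i\<in>obasis. dist (inner (f (r n)) i) (inner l i) < \<epsilon>) sequentially"
    using compact_lemma_general[of obasis inner f "\<lambda>c. \<Sum>b\<in>obasis. c b *\<^sub>R b", OF finite_obasis bp]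
    by (auto simp: inner_sum_obasis obasis_expansion)
  have lim: "((\<lambda>n. inner (f (r n)) i) \<longlongrightarrow> inner l i) sequentially" if i: "i \<in> obasis" for i
  proof (rule tendstoI)
    fix \<epsilon> :: real assume "\<epsilon> > 0"
    then have "eventually (\<lambda>n. \<forall>i\<in>obasis. dist (inner (f (r n)) i) (inner l i) < \<epsilon>) sequentially"
      using l by blast
    then show "eventually (\<lambda>n. dist (inner (f (r n)) i) (inner l i) < \<epsilon>) sequentially"
      by eventually_elim (use i in blast)
  qed
  have "((\<lambda>n. \<Sum>i\<in>obasis. inner (f (r n)) i *\<^sub>R i) \<longlongrightarrow> (\<Sum>i\<in>obasis. inner l i *\<^sub>R i)) sequentially"
    by (intro tendsto_sum tendsto_scaleR lim tendsto_const)
  then show "\<exists>l r. strict_mono r \<and> ((f \<circ> r) \<longlongrightarrow> l) sequentially"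
    using r by (auto simp: obasis_expansion o_def)
qed

instance finite_euclidean \<subseteq> banach ..

text \<open>Maps of two variables, such as the multiplication and the action, are smooth with
  respect to product charts; their model space is the product, which must belong to the class as
  well.\<close>

instance prod :: (finite_euclidean, finite_euclidean) finite_euclidean
proof
  let ?B = "(\<lambda>u. (u, 0)) ` (obasis::'a set) \<union> (\<lambda>v. (0, v)) ` (obasis::'b set)"
  have "x = 0" if x: "\<forall>u\<in>?B. inner x u = 0" for x
  proof -
    have "inner (fst x) u = 0" if "u \<in> obasis" for u
      using bspec[OF x, of "(u, 0)"] that by (simp add: inner_prod_def)
    moreover have "inner (snd x) u = 0" if "u \<in> obasis" for u
      using bspec[OF x, of "(0, u)"] that by (simp add: inner_prod_def)
    ultimately have "fst x = 0" "snd x = 0" by (rule_tac [!] obasis_eq_zeroI) auto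
    then show ?thesis by (simp add: prod_eq_iff)
  qed
  \<comment> \<open>The two halves of \<open>?B\<close> have no common element: it would be zero,
    which no unit vector is.\<close>
  moreover have "\<forall>u\<in>?B. \<forall>v\<in>?B. inner u v = (if u = v then 1 else 0)"
    by (auto simp: inner_obasis inner_prod_def zero_notin_obasis split: if_splits)
  ultimately show "\<exists>B::('a \<times> 'b) set. finite B \<and>
      (\<forall>u\<in>B. \<forall>v\<in>B. inner u v = (if u = v then 1 else 0)) \<and>
      (\<forall>x. (\<forall>u\<in>B. inner x u = 0) \<longrightarrow> x = 0)"
    by (intro exI[of _ ?B] conjI) auto
qed

section \<open>Differential calculus on open sets and intervals\<close>

section \<open>Calculus of smooth functions\<close>

text \<open>On thick sets derivatives are unique and smoothness is a local property.\<close>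

definition thick :: "'a::real_normed_vector set \<Rightarrow> bool" where
  "thick S \<longleftrightarrow> (\<forall>x\<in>S. \<forall>v. \<forall>\<delta>>0. \<exists>s. s \<noteq> 0 \<and> \<bar>s\<bar> < \<delta> \<and> x + s *\<^sub>R v \<in> S)"

lemma thick_Int_open:
  assumes "thick S" "open W"
  shows "thick (S \<inter> W)"
  unfolding thick_def
proof (intro ballI allI impI)
  fix x v and \<delta> :: real
  assume x: "x \<in> S \<inter> W" and \<delta>: "\<delta> > 0"
  have "((\<lambda>s::real. x + s *\<^sub>R v) \<longlongrightarrow> x + 0 *\<^sub>R v) (at 0)"
    by (intro tendsto_intros)
  then have "eventually (\<lambda>s::real. x + s *\<^sub>R v \<in> W) (at 0)"
    by (rule topological_tendstoD) (use x assms in auto)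
  then obtain e where e: "e > 0" "\<And>s::real. s \<noteq> 0 \<Longrightarrow> \<bar>s\<bar> < e \<Longrightarrow> x + s *\<^sub>R v \<in> W"
    by (auto simp: eventually_at)
  have "min \<delta> e > 0" using \<delta> e by simp
  then obtain s where "s \<noteq> 0" "\<bar>s\<bar> < min \<delta> e" "x + s *\<^sub>R v \<in> S"
    using assms(1) x unfolding thick_def by blast
  then show "\<exists>s. s \<noteq> 0 \<and> \<bar>s\<bar> < \<delta> \<and> x + s *\<^sub>R v \<in> S \<inter> W"
    using e(2)[of s] by auto
qed

lemma thick_UNIV [simp]: "thick UNIV"
  unfolding thick_def by (intro ballI allI impI, rule_tac x="\<delta> / 2" in exI) auto

lemma thick_open: "open S \<Longrightarrow> thick S"
  using thick_Int_open[OF thick_UNIV] by simp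

lemma thick_interval:
  fixes a b :: real
  assumes "a < b"
  shows "thick {a..b}"
  unfolding thick_def
proof (intro ballI allI impI)
  fix x v \<delta> :: real
  assume x: "x \<in> {a..b}" and \<delta>: "\<delta> > 0"
  \<comment> \<open>The step \<open>e * \<bar>v\<bar>\<close> is at most half the length of the
    interval, so from any of its points one of the two directions stays inside; the summand 1 covers
    \<open>v = 0\<close>.\<close>
  define e where "e = min (\<delta>/2) ((b - a) / (2 * (\<bar>v\<bar> + 1)))"
  have e: "e > 0" "e < \<delta>" using assms \<delta> by (auto simp: e_def)
  have "e \<le> (b - a) / (2 * (\<bar>v\<bar> + 1))" by (simp add: e_def)
  then have "e * (2 * (\<bar>v\<bar> + 1)) \<le> b - a"
    by (simp add: field_simps)
  then have ev: "2 * (e * \<bar>v\<bar>) \<le> b - a" using e by (simp add: algebra_simps)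
  define w where "w = (if v \<ge> 0 then e else - e)"
  have w: "w * v = e * \<bar>v\<bar>" "w = e \<or> w = - e" by (auto simp: w_def)
  have "0 \<le> e * \<bar>v\<bar>" using e by simp
  with ev x have "x + e * \<bar>v\<bar> \<in> {a..b} \<or> x - e * \<bar>v\<bar> \<in> {a..b}"
    unfolding atLeastAtMost_iff by linarith
  then have "x + w * v \<in> {a..b} \<or> x + (- w) * v \<in> {a..b}"
    by (simp add: w(1))
  then have "\<exists>s. (s = e \<or> s = - e) \<and> x + s * v \<in> {a..b}"
    using w(2) by auto
  then obtain s where "s = e \<or> s = - e" "x + s * v \<in> {a..b}" by blast
  then show "\<exists>s. s \<noteq> 0 \<and> \<bar>s\<bar> < \<delta> \<and> x + s *\<^sub>R v \<in> {a..b}"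
    using e by (intro exI[of _ s]) auto
qed

text \<open>The difference of the two derivatives is a derivative of the zero function. On
  arbitrarily short multiples \<open>s *\<^sub>R v\<close> that lead to points of \<open>S\<close>
  it is bounded by a small multiple of the length, and homogeneity removes \<open>s\<close>.\<close>

lemma thick_derivative_unique:
  assumes "thick S" "x \<in> S" "(f has_derivative f') (at x within S)" "(f has_derivative f'') (at x within S)"
  shows "f' = f''"
proof
  fix v
  define d where "d = (\<lambda>v. f' v - f'' v)"
  have "((\<lambda>x. f x - f x) has_derivative d) (at x within S)"
    unfolding d_def by (intro has_derivative_diff assms)
  then have d: "((\<lambda>x. 0) has_derivative d) (at x within S)" by simp
  have "norm (d v) \<le> e" if e: "e > 0" for e
  proof (cases "v = 0")
    case True
    interpret bounded_linear d using d by (rule has_derivative_bounded_linear)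
    show ?thesis using True e zero by simp
  next
    case False
    define e' where "e' = e / norm v"
    have e': "e' > 0" using e False by (simp add: e'_def)
    obtain \<delta> where \<delta>: "\<delta> > 0" "\<And>y. y \<in> S \<Longrightarrow> norm (y - x) < \<delta> \<Longrightarrow> norm (0 - 0 - d (y - x)) \<le> e' * norm (y - x)"
      using d e' unfolding has_derivative_within_alt by blast
    have "\<delta> / norm v > 0" using \<delta> False by simp
    then obtain s where s: "s \<noteq> 0" "\<bar>s\<bar> < \<delta> / norm v" "x + s *\<^sub>R v \<in> S"
      using assms(1,2) unfolding thick_def by blast
    interpret bounded_linear d using d by (rule has_derivative_bounded_linear)
    have "norm (d (s *\<^sub>R v)) \<le> e' * norm (s *\<^sub>R v)"
      using \<delta>(2)[OF s(3)] s(2) False by (simp add: field_simps)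
    then have "\<bar>s\<bar> * norm (d v) \<le> \<bar>s\<bar> * e"
      using False by (simp add: scaleR e'_def mult.commute)
    then show ?thesis using s(1) by (simp add: mult.commute)
  qed
  then have "norm (d v) \<le> 0" by (rule field_le_epsilon[of _ 0, simplified])
  then show "f' v = f'' v" by (simp add: d_def)
qed

lemma k_smooth_on_imp_continuous_on:
  "k_smooth_on k S f \<Longrightarrow> continuous_on S f"
  by (cases k) (auto simp: continuous_on_eq_continuous_within intro: has_derivative_continuous)

lemma k_smooth_on_SucD: "k_smooth_on (Suc k) S f \<Longrightarrow> k_smooth_on k S f"
proof (induction k arbitrary: f)
  case 0
  then show ?case using k_smooth_on_imp_continuous_on k_smooth_on.simps(1) by blast
next
  case (Suc k)
  obtain f' where "\<forall>x\<in>S. (f has_derivative f' x) (at x within S)"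
    and "\<forall>v. k_smooth_on (Suc k) S (\<lambda>x. f' x v)"
    using Suc.prems unfolding k_smooth_on.simps(2)[of "Suc k"] by blast
  then show ?case using Suc.IH unfolding k_smooth_on.simps(2)[of k] by blast
qed

lemma k_smooth_on_subset: "k_smooth_on k S f \<Longrightarrow> T \<subseteq> S \<Longrightarrow> k_smooth_on k T f"
proof (induction k arbitrary: f)
  case 0
  then show ?case by (auto intro: continuous_on_subset)
next
  case (Suc k)
  then obtain f' where "\<forall>x\<in>S. (f has_derivative f' x) (at x within S)"
    and "\<forall>v. k_smooth_on k S (\<lambda>x. f' x v)" by auto
  then show ?case using Suc.IH Suc.prems(2)
    by (auto intro!: exI[of _ f'] intro: has_derivative_subset)
qed

lemma k_smooth_on_cong:
  assumes "\<And>x. x \<in> S \<Longrightarrow> f x = g x"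
  shows "k_smooth_on k S f \<longleftrightarrow> k_smooth_on k S g"
proof -
  have *: "k_smooth_on k S g" 
    if f: "k_smooth_on k S f" and fg: "\<And>x. x \<in> S \<Longrightarrow> f x = g x" for f g :: "'a \<Rightarrow> 'b"
  proof (cases k)
    case 0
    then show ?thesis using f fg by (simp cong: continuous_on_cong)
  next
    case (Suc n)
    then obtain f' where "\<forall>x\<in>S. (f has_derivative f' x) (at x within S)" "\<forall>v. k_smooth_on n S (\<lambda>x. f' x v)"
      using f by auto
    then show ?thesis
      using fg unfolding Suc k_smooth_on.simps(2)
      by (metis has_derivative_transform)
  qed
  show ?thesis using *[of f g] *[of g f] assms by metis
qed

lemma k_smooth_on_eqI:
  "k_smooth_on k S f \<Longrightarrow> (\<And>x. x \<in> S \<Longrightarrow> f x = g x) \<Longrightarrow> k_smooth_on k S g"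
  using k_smooth_on_cong[of S f g k] by simp

lemma k_smooth_on_const: "k_smooth_on k S (\<lambda>x. c)"
  by (induction k arbitrary: c) (auto intro!: exI[of _ "\<lambda>x v. 0"])

lemma k_smooth_on_bounded_linear_comp:
  assumes "bounded_linear h" "k_smooth_on k S f"
  shows "k_smooth_on k S (\<lambda>x. h (f x))"
  using assms(2)
proof (induction k arbitrary: f)
  case 0
  then show ?case using bounded_linear.continuous_on[OF assms(1)] by simp
next
  case (Suc k)
  then obtain f' where f: "\<forall>x\<in>S. (f has_derivative f' x) (at x within S)"
    and f': "\<forall>v. k_smooth_on k S (\<lambda>x. f' x v)" by auto
  then show ?case using Suc.IH
    by (auto intro!: exI[of _ "\<lambda>x v. h (f' x v)"] bounded_linear.has_derivative[OF assms(1)])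
qed

lemma k_smooth_on_bounded_linear:
  assumes "bounded_linear h"
  shows "k_smooth_on k S h"
proof (cases k)
  case 0
  then show ?thesis using linear_continuous_on[OF assms] by simp
next
  case (Suc n)
  then show ?thesis
    using assms by (auto intro!: exI[of _ "\<lambda>x. h"] bounded_linear_imp_has_derivative k_smooth_on_const)
qed

lemma k_smooth_on_add:
  "k_smooth_on k S f \<Longrightarrow> k_smooth_on k S g \<Longrightarrow> k_smooth_on k S (\<lambda>x. f x + g x)"
proof (induction k arbitrary: f g)
  case 0
  then show ?case by (auto intro: continuous_on_add)
next
  case (Suc k)
  then obtain f' g' where "\<forall>x\<in>S. (f has_derivative f' x) (at x within S)" "\<forall>v. k_smooth_on k S (\<lambda>x. f' x v)"
    "\<forall>x\<in>S. (g has_derivative g' x) (at x within S)" "\<forall>v. k_smooth_on k S (\<lambda>x. g' x v)" by auto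
  then show ?case using Suc.IH
    by (auto intro!: exI[of _ "\<lambda>x v. f' x v + g' x v"] has_derivative_add)
qed

lemma k_smooth_on_sum:
  assumes "\<And>i. i \<in> J \<Longrightarrow> k_smooth_on k S (f i)"
  shows "k_smooth_on k S (\<lambda>x. \<Sum>i\<in>J. f i x)"
  using assms
  by (induction J rule: infinite_finite_induct) (auto simp: k_smooth_on_const intro: k_smooth_on_add)

lemma k_smooth_on_bilinear:
  assumes "bounded_bilinear bl"
  shows "k_smooth_on k S f \<Longrightarrow> k_smooth_on k S g \<Longrightarrow> k_smooth_on k S (\<lambda>x. bl (f x) (g x))"
proof (induction k arbitrary: f g)
  case 0
  then show ?case using bounded_bilinear.continuous_on[OF assms] by auto
next
  case (Suc k)
  then obtain f' g' where f: "\<forall>x\<in>S. (f has_derivative f' x) (at x within S)" "\<forall>v. k_smooth_on k S (\<lambda>x. f' x v)"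
    and g: "\<forall>x\<in>S. (g has_derivative g' x) (at x within S)" "\<forall>v. k_smooth_on k S (\<lambda>x. g' x v)" by auto
  have "k_smooth_on k S f" "k_smooth_on k S g" using Suc.prems k_smooth_on_SucD by blast+
  then show ?case using f g Suc.IH
    by (auto intro!: exI[of _ "\<lambda>x v. bl (f x) (g' x v) + bl (f' x v) (g x)"]
        bounded_bilinear.FDERIV[OF assms] k_smooth_on_add)
qed

text \<open>The derivative of a composition is a sum, over a basis of the intermediate space, of products
  of compositions of lower order.\<close>

lemma k_smooth_on_compose:
  fixes f :: "'a::real_normed_vector \<Rightarrow> 'b::finite_euclidean" and g :: "'b \<Rightarrow> 'c::real_normed_vector"
  shows "k_smooth_on k S f \<Longrightarrow> k_smooth_on k T g \<Longrightarrow> f ` S \<subseteq> T \<Longrightarrow> k_smooth_on k S (\<lambda>x. g (f x))"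
proof (induction k arbitrary: f g)
  case 0
  then show ?case by (auto intro: continuous_on_compose2)
next
  case (Suc k)
  then obtain f' g' where f: "\<forall>x\<in>S. (f has_derivative f' x) (at x within S)" "\<forall>v. k_smooth_on k S (\<lambda>x. f' x v)"
    and g: "\<forall>x\<in>T. (g has_derivative g' x) (at x within T)" "\<forall>v. k_smooth_on k T (\<lambda>x. g' x v)" by auto
  have fk: "k_smooth_on k S f" using Suc.prems k_smooth_on_SucD by blast
  have "((\<lambda>x. g (f x)) has_derivative (\<lambda>v. g' (f x) (f' x v))) (at x within S)" if "x \<in> S" for x
  proof -
    have fx: "f x \<in> T" using that Suc.prems(3) by auto
    show ?thesis
      by (rule has_derivative_in_compose2[OF _ Suc.prems(3) that])
        (use f g that in auto)
  qed
  moreover have "k_smooth_on k S (\<lambda>x. g' (f x) (f' x v))" for v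
  proof -
    have "k_smooth_on k S (\<lambda>x. \<Sum>b\<in>obasis. inner (f' x v) b *\<^sub>R g' (f x) b)"
      using f(2) g(2) Suc.IH[OF fk _ Suc.prems(3)]
      by (intro k_smooth_on_sum k_smooth_on_bilinear[OF bounded_bilinear_scaleR]
          k_smooth_on_bounded_linear_comp[OF bounded_linear_inner_left]) auto
    moreover have "(\<Sum>b\<in>obasis. inner (f' x v) b *\<^sub>R g' (f x) b) = g' (f x) (f' x v)" if "x \<in> S" for x
    proof -
      have "linear (g' (f x))"
        using g(1) that Suc.prems(3) by (blast intro: has_derivative_linear)
      from linear_obasis_expansion[OF this, symmetric] show ?thesis .
    qed
    ultimately show ?thesis by (rule k_smooth_on_eqI)
  qed
  ultimately show ?case unfolding k_smooth_on.simps(2)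
    by (intro exI[of _ "\<lambda>x v. g' (f x) (f' x v)"]) simp
qed

text \<open>Each neighbourhood comes with its own derivative family. Thickness makes all of them
  agree with the one chosen on \<open>S\<close>, so its directional derivatives are again locally of
  order \<open>k\<close> and the induction closes.\<close>

lemma k_smooth_on_local:
  fixes f :: "'a::real_normed_vector \<Rightarrow> 'b::real_normed_vector"
  assumes "thick S" and "\<And>x. x \<in> S \<Longrightarrow> \<exists>W. open W \<and> x \<in> W \<and> k_smooth_on k (S \<inter> W) f"
  shows "k_smooth_on k S f"
  using assms(2)
proof (induction k arbitrary: f)
  case 0
  show ?case unfolding k_smooth_on.simps continuous_on_eq_continuous_within
  proof
    fix x assume x: "x \<in> S"
    then obtain W where W: "open W" "x \<in> W" "continuous_on (S \<inter> W) f"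
      using 0 unfolding k_smooth_on.simps(1) by blast
    then have "continuous (at x within (S \<inter> W)) f"
      using x by (simp add: continuous_on_eq_continuous_within)
    then show "continuous (at x within S) f"
      using at_within_nhd[of x W S "S \<inter> W"] W by simp
  qed
next
  case (Suc k)
  have at: "at x within S = at x within (S \<inter> W)" if "open W" "x \<in> W" for x W
    using that by (intro at_within_nhd[of x W]) auto
  have "\<exists>f'. (f has_derivative f') (at x within S)" if "x \<in> S" for x
  proof -
    from Suc.prems[OF that] obtain W f' where W: "open W" "x \<in> W"
      "\<forall>x\<in>S \<inter> W. (f has_derivative f' x) (at x within (S \<inter> W))" by auto
    then have "(f has_derivative f' x) (at x within S)" using at[OF W(1,2)] that by auto
    then show ?thesis by blast
  qed
  then obtain f' where f': "\<forall>x\<in>S. (f has_derivative f' x) (at x within S)" by metis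
  have "k_smooth_on k S (\<lambda>x. f' x v)" for v
  proof (rule Suc.IH)
    fix x assume x: "x \<in> S"
    from Suc.prems[OF x] obtain W g where W: "open W" "x \<in> W"
      "\<forall>x\<in>S \<inter> W. (f has_derivative g x) (at x within (S \<inter> W))"
      "\<forall>v. k_smooth_on k (S \<inter> W) (\<lambda>x. g x v)" by auto
    have "f' y = g y" if "y \<in> S \<inter> W" for y
      using f' W(3) at[of W y] W(1) that by (intro thick_derivative_unique[OF assms(1), of y f]) auto
    then have "k_smooth_on k (S \<inter> W) (\<lambda>x. f' x v)"
      using W(4) by (subst k_smooth_on_cong[of _ _ "\<lambda>x. g x v"]) auto
    then show "\<exists>W. open W \<and> x \<in> W \<and> k_smooth_on k (S \<inter> W) (\<lambda>x. f' x v)" using W by blast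
  qed
  then show ?case using f' by auto
qed

lemma smooth_on_imp_continuous_on: "smooth_on S f \<Longrightarrow> continuous_on S f"
  unfolding smooth_on_def using k_smooth_on_imp_continuous_on by blast

lemma smooth_on_subset: "smooth_on S f \<Longrightarrow> T \<subseteq> S \<Longrightarrow> smooth_on T f"
  unfolding smooth_on_def using k_smooth_on_subset by blast

lemma smooth_on_eqI: "smooth_on S f \<Longrightarrow> (\<And>x. x \<in> S \<Longrightarrow> f x = g x) \<Longrightarrow> smooth_on S g"
  unfolding smooth_on_def by (blast intro: k_smooth_on_eqI)

lemma smooth_on_const [simp]: "smooth_on S (\<lambda>x. c)"
  unfolding smooth_on_def using k_smooth_on_const by blast

lemma smooth_on_bounded_linear: "bounded_linear h \<Longrightarrow> smooth_on S h"
  unfolding smooth_on_def using k_smooth_on_bounded_linear by blast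

lemma smooth_on_ident [simp]: "smooth_on S (\<lambda>x. x)"
  by (rule smooth_on_bounded_linear[OF bounded_linear_ident])

lemma smooth_on_bounded_linear_comp:
  "bounded_linear h \<Longrightarrow> smooth_on S f \<Longrightarrow> smooth_on S (\<lambda>x. h (f x))"
  unfolding smooth_on_def by (blast intro: k_smooth_on_bounded_linear_comp)

lemma smooth_on_add: "smooth_on S f \<Longrightarrow> smooth_on S g \<Longrightarrow> smooth_on S (\<lambda>x. f x + g x)"
  unfolding smooth_on_def by (blast intro: k_smooth_on_add)

lemma smooth_on_minus: "smooth_on S f \<Longrightarrow> smooth_on S (\<lambda>x. - f x)"
  by (rule smooth_on_bounded_linear_comp[OF bounded_linear_minus[OF bounded_linear_ident]])

lemma smooth_on_diff: "smooth_on S f \<Longrightarrow> smooth_on S g \<Longrightarrow> smooth_on S (\<lambda>x. f x - g x)"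
  using smooth_on_add[OF _ smooth_on_minus, of S f g] by simp

lemma smooth_on_sum: "(\<And>i. i \<in> J \<Longrightarrow> smooth_on S (f i)) \<Longrightarrow> smooth_on S (\<lambda>x. \<Sum>i\<in>J. f i x)"
  unfolding smooth_on_def by (blast intro: k_smooth_on_sum)

lemma smooth_on_bilinear:
  "bounded_bilinear bl \<Longrightarrow> smooth_on S f \<Longrightarrow> smooth_on S g \<Longrightarrow> smooth_on S (\<lambda>x. bl (f x) (g x))"
  unfolding smooth_on_def by (blast intro: k_smooth_on_bilinear)

lemmas smooth_on_scaleR = smooth_on_bilinear[OF bounded_bilinear_scaleR]
lemmas smooth_on_inner = smooth_on_bilinear[OF bounded_bilinear_inner]
lemmas smooth_on_blinfun_apply = smooth_on_bilinear[OF bounded_bilinear_blinfun_apply]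

lemma smooth_on_compose:
  fixes f :: "'a::real_normed_vector \<Rightarrow> 'b::finite_euclidean"
  shows "smooth_on S f \<Longrightarrow> smooth_on T g \<Longrightarrow> f ` S \<subseteq> T \<Longrightarrow> smooth_on S (\<lambda>x. g (f x))"
  unfolding smooth_on_def by (blast intro: k_smooth_on_compose)

lemma smooth_on_local:
  assumes "thick S" and "\<And>x. x \<in> S \<Longrightarrow> \<exists>W. open W \<and> x \<in> W \<and> smooth_on (S \<inter> W) f"
  shows "smooth_on S f"
  unfolding smooth_on_def
proof
  fix k show "k_smooth_on k S f"
    by (rule k_smooth_on_local[OF assms(1)]) (use assms(2) in \<open>unfold smooth_on_def, blast\<close>)
qed

lemma smooth_on_Pair:
  "smooth_on S f \<Longrightarrow> smooth_on S g \<Longrightarrow> smooth_on S (\<lambda>x. (f x, g x))"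
  using smooth_on_add[OF smooth_on_bounded_linear_comp[OF bounded_linear_Pair[OF bounded_linear_ident bounded_linear_zero], of S f]
      smooth_on_bounded_linear_comp[OF bounded_linear_Pair[OF bounded_linear_zero bounded_linear_ident], of S g]]
  by simp

text \<open>Linear families arising from derivatives and frames are known to be smooth only on fixed
  arguments. Expanding the moving argument in an orthonormal basis reduces to finitely many of
  these.\<close>

lemma smooth_on_apply:
  fixes v :: "'a::real_normed_vector \<Rightarrow> 'b::finite_euclidean"
  assumes "\<And>x. x \<in> S \<Longrightarrow> linear (A x)" "\<And>e. smooth_on S (\<lambda>x. A x e)" "smooth_on S v"
  shows "smooth_on S (\<lambda>x. A x (v x))"
proof (rule smooth_on_eqI)
  show "smooth_on S (\<lambda>x. \<Sum>b\<in>obasis. inner (v x) b *\<^sub>R A x b)"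
    by (intro smooth_on_sum smooth_on_scaleR smooth_on_bounded_linear_comp[OF bounded_linear_inner_left] assms)
  show "(\<Sum>b\<in>obasis. inner (v x) b *\<^sub>R A x b) = A x (v x)" if "x \<in> S" for x
    using linear_obasis_expansion[OF assms(1)[OF that], symmetric] .
qed

lemma smooth_on_blinfun:
  fixes F :: "'a::real_normed_vector \<Rightarrow> 'b::finite_euclidean \<Rightarrow>\<^sub>L 'c::real_normed_vector"
  assumes "\<And>b. smooth_on S (\<lambda>x. blinfun_apply (F x) b)"
  shows "smooth_on S F"
proof (rule smooth_on_eqI)
  \<comment> \<open>\<open>J b c\<close> is the rank-one operator
    \<open>v \<mapsto> inner v b *\<^sub>R c\<close>. An operator is the sum of these over a basis,
    so its smoothness is that of its values on basis vectors.\<close>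
  define J :: "'b \<Rightarrow> 'c \<Rightarrow> ('b \<Rightarrow>\<^sub>L 'c)" where "J = (\<lambda>b c. blinfun_scaleR_left c o\<^sub>L blinfun_inner_left b)"
  have J: "bounded_linear (J b)" for b
    unfolding J_def
    by (rule bounded_linear_compose[OF bounded_bilinear.bounded_linear_left[OF bounded_bilinear_blinfun_compose]])
      (rule bounded_linear_intro[of _ 1], auto intro!: blinfun_eqI norm_blinfun_bound
        simp: algebra_simps blinfun.add_left blinfun.scaleR_left)
  show "smooth_on S (\<lambda>x. \<Sum>b\<in>obasis. J b (blinfun_apply (F x) b))"
    by (intro smooth_on_sum smooth_on_bounded_linear_comp[OF J] assms)
  show "(\<Sum>b\<in>obasis. J b (blinfun_apply (F x) b)) = F x" for x
  proof (rule blinfun_eqI)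
    fix v
    have "blinfun_apply (F x) v = (\<Sum>b\<in>obasis. inner v b *\<^sub>R blinfun_apply (F x) b)"
      by (rule linear_obasis_expansion) (rule bounded_linear.linear[OF blinfun.bounded_linear_right])
    then show "blinfun_apply (\<Sum>b\<in>obasis. J b (blinfun_apply (F x) b)) v = blinfun_apply (F x) v"
      by (simp add: blinfun.sum_left J_def inner_commute)
  qed
qed

section \<open>Regularity of derivatives\<close>

text \<open>The definition only provides some derivative with regular directional parts; uniqueness
  on thick sets transfers this to the derivative at hand.\<close>

lemma k_smooth_on_Suc_derivative:
  assumes "thick S" "k_smooth_on (Suc k) S f" "\<And>x. x \<in> S \<Longrightarrow> (f has_derivative f' x) (at x within S)"
  shows "k_smooth_on k S (\<lambda>x. f' x v)"
proof -
  obtain g where g: "\<forall>x\<in>S. (f has_derivative g x) (at x within S)" "\<forall>v. k_smooth_on k S (\<lambda>x. g x v)"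
    using assms(2) unfolding k_smooth_on.simps(2) by blast
  have "g x = f' x" if "x \<in> S" for x
    using thick_derivative_unique[OF assms(1) that] g(1) assms(3)[OF that] that by blast
  then show ?thesis
    using k_smooth_on_eqI[OF spec[OF g(2)], of v "\<lambda>x. f' x v"] by simp
qed

lemma smooth_on_derivative:
  assumes "thick S" "smooth_on S f" "\<And>x. x \<in> S \<Longrightarrow> (f has_derivative f' x) (at x within S)"
  shows "smooth_on S (\<lambda>x. f' x v)"
  unfolding smooth_on_def
proof
  fix k show "k_smooth_on k S (\<lambda>x. f' x v)"
    by (rule k_smooth_on_Suc_derivative[OF assms(1) _ assms(3)]) (use assms(2) in \<open>auto simp: smooth_on_def\<close>)
qed

lemma smooth_on_imp_differentiable:
  assumes "smooth_on S f" "x \<in> S"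
  shows "f differentiable (at x within S)"
proof -
  have "k_smooth_on (Suc 0) S f" using assms(1) unfolding smooth_on_def by blast
  then show ?thesis using assms(2) unfolding k_smooth_on.simps(2) differentiable_def by blast
qed

lemma smooth_on_has_derivative:
  assumes "open S" "smooth_on S f" "x \<in> S"
  shows "(f has_derivative frechet_derivative f (at x)) (at x)"
  using smooth_on_imp_differentiable[OF assms(2,3)]
  unfolding at_within_open[OF assms(3,1)] frechet_derivative_works .

lemma smooth_on_frechet_derivative:
  assumes "open S" "smooth_on S f"
  shows "smooth_on S (\<lambda>x. frechet_derivative f (at x) v)"
  by (rule smooth_on_derivative[OF thick_open[OF assms(1)] assms(2)])
    (subst at_within_open[OF _ assms(1)], assumption, rule smooth_on_has_derivative[OF assms])

lemma smooth_on_has_vector_derivative: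
  fixes f :: "real \<Rightarrow> 'b::real_normed_vector"
  assumes "smooth_on S f" "x \<in> S"
  shows "(f has_vector_derivative vector_derivative f (at x within S)) (at x within S)"
  using smooth_on_imp_differentiable[OF assms] vector_derivative_works by blast

lemma smooth_on_vector_derivative:
  fixes f :: "real \<Rightarrow> 'b::real_normed_vector"
  assumes "thick S" "smooth_on S f"
  shows "smooth_on S (\<lambda>x. vector_derivative f (at x within S))"
  using smooth_on_derivative[OF assms, of "\<lambda>x h. h *\<^sub>R vector_derivative f (at x within S)" 1]
    smooth_on_has_vector_derivative[OF assms(2)] by (simp add: has_vector_derivative_def)

text \<open>The bootstrapping step for differential equations: a right-hand side of order
  \<open>k\<close> raises the order of the solution by one.\<close>

lemma k_smooth_on_SucI_vector_derivative:
  fixes f :: "real \<Rightarrow> 'b::real_normed_vector"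
  assumes "\<And>x. x \<in> S \<Longrightarrow> (f has_vector_derivative g x) (at x within S)" "k_smooth_on k S g"
  shows "k_smooth_on (Suc k) S f"
  unfolding k_smooth_on.simps(2)
  using assms k_smooth_on_bounded_linear_comp[OF bounded_linear_scaleR_right assms(2)]
  by (intro exI[of _ "\<lambda>x h. h *\<^sub>R g x"]) (auto simp: has_vector_derivative_def)

text \<open>Expanding \<open>v y\<close> in an orthonormal basis turns the expression into a finite
  sum of products, to which the ordinary product rule applies.\<close>

lemma has_derivative_apply:
  fixes v :: "'a::real_normed_vector \<Rightarrow> 'b::finite_euclidean"
  assumes lin: "\<And>y. y \<in> S \<Longrightarrow> linear (A y)" and S: "open S" "x \<in> S"
    and A: "\<And>e. ((\<lambda>y. A y e) has_derivative A' e) (at x)"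
    and v: "(v has_derivative v') (at x)"
  shows "((\<lambda>y. A y (v y)) has_derivative (\<lambda>h. A' (v x) h + A x (v' h))) (at x)"
proof -
  have expand: "A y w = (\<Sum>b\<in>obasis. inner w b *\<^sub>R A y b)" if "y \<in> S" for y w
    by (rule linear_obasis_expansion[OF lin[OF that]])
  have D: "((\<lambda>y. \<Sum>b\<in>obasis. inner (v y) b *\<^sub>R A y b) has_derivative
      (\<lambda>h. \<Sum>b\<in>obasis. inner (v x) b *\<^sub>R A' b h + inner (v' h) b *\<^sub>R A x b)) (at x)"
    by (intro has_derivative_sum has_derivative_scaleR has_derivative_inner_left v A)
  \<comment> \<open>That \<open>A'\<close> is linear in its first argument is not among the
    assumptions; it follows from uniqueness of the derivative of the expanded sum.\<close>
  have "((\<lambda>y. \<Sum>b\<in>obasis. inner (v x) b *\<^sub>R A y b) has_derivative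
      (\<lambda>h. \<Sum>b\<in>obasis. inner (v x) b *\<^sub>R A' b h)) (at x)"
    by (intro has_derivative_sum has_derivative_scaleR_right A)
  then have "((\<lambda>y. A y (v x)) has_derivative (\<lambda>h. \<Sum>b\<in>obasis. inner (v x) b *\<^sub>R A' b h)) (at x)"
    by (rule has_derivative_transform_within_open[OF _ S]) (rule expand[symmetric])
  then have A': "A' (v x) = (\<lambda>h. \<Sum>b\<in>obasis. inner (v x) b *\<^sub>R A' b h)"
    by (rule has_derivative_unique[OF A])
  have "(\<lambda>h. \<Sum>b\<in>obasis. inner (v x) b *\<^sub>R A' b h + inner (v' h) b *\<^sub>R A x b) = (\<lambda>h. A' (v x) h + A x (v' h))"
    by (subst A', subst expand[OF S(2)]) (simp add: sum.distrib)
  with D have "((\<lambda>y. \<Sum>b\<in>obasis. inner (v y) b *\<^sub>R A y b) has_derivative (\<lambda>h. A' (v x) h + A x (v' h))) (at x)"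
    by simp
  then show ?thesis
    by (rule has_derivative_transform_within_open[OF _ S]) (rule expand[symmetric])
qed

section \<open>Bump functions\<close>

text \<open>The factor \<open>inverse x ^ n\<close> makes the family closed under differentiation up
  to linear combinations, so that one induction on the order proves all members smooth. For
  \<open>n = 0\<close> this is the usual flat function \<open>exp (- 1 / x)\<close>.\<close>

definition flat_exp :: "nat \<Rightarrow> real \<Rightarrow> real" where
  "flat_exp n x = (if x > 0 then exp (- inverse x) * inverse x ^ n else 0)"

lemma flat_exp_tendsto_0: "(flat_exp n \<longlongrightarrow> 0) (at 0)"
proof -
  have "((\<lambda>x::real. inverse x ^ n / exp (inverse x)) \<longlongrightarrow> 0) (at_right 0)"
    by (rule filterlim_compose[OF tendsto_power_div_exp_0 filterlim_inverse_at_top_right])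
  moreover have "eventually (\<lambda>x. inverse x ^ n / exp (inverse x) = flat_exp n x) (at_right 0)"
    using eventually_at_right_less[of "0::real"]
    by eventually_elim (simp add: flat_exp_def exp_minus field_simps)
  ultimately have "(flat_exp n \<longlongrightarrow> 0) (at_right 0)"
    by (rule Lim_transform_eventually)
  moreover have "eventually (\<lambda>x. 0 = flat_exp n x) (at_left 0)"
    by (simp add: eventually_at_filter flat_exp_def)
  then have "(flat_exp n \<longlongrightarrow> 0) (at_left 0)"
    by (rule Lim_transform_eventually[OF tendsto_const])
  ultimately show ?thesis by (simp add: filterlim_split_at)
qed

lemma flat_exp_has_real_derivative:
  "(flat_exp n has_real_derivative flat_exp (n + 2) x - real n * flat_exp (n + 1) x) (at x)"
proof -
  consider "x > 0" | "x < 0" | "x = 0" by linarith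
  then show ?thesis
  proof cases
    case 1
    have "((\<lambda>x. exp (- inverse x) * inverse x ^ n) has_real_derivative
        flat_exp (n + 2) x - real n * flat_exp (n + 1) x) (at x)"
    proof (rule DERIV_cong)
      show "((\<lambda>x. exp (- inverse x) * inverse x ^ n) has_real_derivative
          exp (- inverse x) * (inverse x)\<^sup>2 * inverse x ^ n +
          exp (- inverse x) * (real n * (- (inverse x)\<^sup>2 * inverse x ^ (n - 1)))) (at x)"
        using 1 by (auto intro!: derivative_eq_intros simp: power2_eq_square)
      show "exp (- inverse x) * (inverse x)\<^sup>2 * inverse x ^ n +
          exp (- inverse x) * (real n * (- (inverse x)\<^sup>2 * inverse x ^ (n - 1))) =
          flat_exp (n + 2) x - real n * flat_exp (n + 1) x"
        unfolding flat_exp_def using 1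
        by (cases n) (simp_all add: power2_eq_square algebra_simps del: inverse_eq_divide)
    qed
    then show ?thesis
      by (rule has_field_derivative_transform_within_open[of _ _ _ "{0<..}"])
        (use 1 in \<open>auto simp: flat_exp_def\<close>)
  next
    case 2
    have "((\<lambda>x. 0) has_real_derivative 0) (at x)" by simp
    then have "(flat_exp n has_real_derivative 0) (at x)"
      by (rule has_field_derivative_transform_within_open[of _ _ _ "{..<0}"])
        (use 2 in \<open>auto simp: flat_exp_def\<close>)
    with 2 show ?thesis by (simp add: flat_exp_def)
  next
    case 3
    \<comment> \<open>At 0 the difference quotient of one member is exactly the next member, so
      differentiability there is the limit \<open>flat_exp_tendsto_0\<close>.\<close>
    have eq: "(flat_exp n y - flat_exp n 0) / (y - 0) = flat_exp (n + 1) y" for y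
      by (simp add: flat_exp_def divide_inverse)
    have "(flat_exp n has_real_derivative 0) (at 0)"
      unfolding has_field_derivative_iff eq by (rule flat_exp_tendsto_0)
    with 3 show ?thesis by (simp add: flat_exp_def)
  qed
qed

lemma smooth_on_flat_exp: "smooth_on S (flat_exp n)"
proof -
  have "k_smooth_on k UNIV (flat_exp n)" for k
  proof (induction k arbitrary: n)
    case 0
    show ?case
      using flat_exp_has_real_derivative DERIV_continuous
      unfolding k_smooth_on.simps(1) continuous_on_eq_continuous_within by blast
  next
    case (Suc k)
    show ?case
    proof (rule k_smooth_on_SucI_vector_derivative)
      show "(flat_exp n has_vector_derivative flat_exp (n + 2) x + (- real n) *\<^sub>R flat_exp (n + 1) x) (at x)" for x
        using flat_exp_has_real_derivative[of n x]
        by (simp add: has_real_derivative_iff_has_vector_derivative)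
      show "k_smooth_on k UNIV (\<lambda>x. flat_exp (n + 2) x + (- real n) *\<^sub>R flat_exp (n + 1) x)"
        by (intro k_smooth_on_add k_smooth_on_bounded_linear_comp[OF bounded_linear_scaleR_right] Suc.IH)
    qed
  qed
  then show ?thesis
    unfolding smooth_on_def using k_smooth_on_subset by blast
qed

text \<open>The squared distance keeps the argument smooth at the centre, and the denominator
  normalises the value there to 1. For \<open>r > 0\<close> the support lies in the closed ball of
  radius \<open>r\<close>.\<close>

definition bump :: "'a::finite_euclidean \<Rightarrow> real \<Rightarrow> 'a \<Rightarrow> real" where
  "bump a r x = flat_exp 0 (r\<^sup>2 - inner (x - a) (x - a)) / flat_exp 0 (r\<^sup>2)"

lemma smooth_on_bump: "smooth_on S (bump a r)"
proof -
  have "smooth_on S (\<lambda>x. flat_exp 0 (r\<^sup>2 - inner (x - a) (x - a)))"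
    by (intro smooth_on_compose[of S _ UNIV "flat_exp 0"] smooth_on_diff smooth_on_inner
        smooth_on_flat_exp smooth_on_const smooth_on_ident) auto
  then show ?thesis
    unfolding bump_def divide_inverse by (rule smooth_on_bounded_linear_comp[OF bounded_linear_mult_left])
qed

lemma bump_center: "r > 0 \<Longrightarrow> bump a r a = 1"
  by (simp add: bump_def flat_exp_def)

lemma bump_nonneg: "bump a r x \<ge> 0"
  by (simp add: bump_def flat_exp_def)

lemma bump_eq_0: "r > 0 \<Longrightarrow> norm (x - a) \<ge> r \<Longrightarrow> bump a r x = 0"
  using power_mono[of r "norm (x - a)" 2] by (simp add: bump_def flat_exp_def power2_norm_eq_inner)

section \<open>Smoothness of the coefficients in a smooth frame\<close>

text \<open>Since \<open>v\<close> vanishes at \<open>x\<close>, the term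
  \<open>(u y - u x) *\<^sub>R v y\<close> is the product of something small and something of order
  \<open>y - x\<close>, and continuity of \<open>u\<close> suffices. This allows frame coefficients
  to be differentiated when they are only known to be continuous.\<close>

lemma has_derivative_scaleR_vanishing:
  fixes u :: "'a::real_normed_vector \<Rightarrow> real"
  assumes u: "isCont u x" and v: "(v has_derivative v') (at x)" "v x = 0"
  shows "((\<lambda>y. u y *\<^sub>R v y) has_derivative (\<lambda>h. u x *\<^sub>R v' h)) (at x)"
proof -
  interpret v': bounded_linear v' using v(1) by (rule has_derivative_bounded_linear)
  have "((\<lambda>y. (u y - u x) *\<^sub>R v y) has_derivative (\<lambda>h. 0)) (at x)"
  proof -
    obtain B where B: "\<And>h. norm (v' h) \<le> norm h * B" "B \<ge> 0"
      using v'.nonneg_bounded by blast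
    show ?thesis
      unfolding has_derivative_at_alt
    proof (intro conjI allI impI)
      fix e :: real assume e: "e > 0"
      obtain d1 where d1: "d1 > 0" "\<And>y. norm (y - x) < d1 \<Longrightarrow> norm (v y - v x - v' (y - x)) \<le> 1 * norm (y - x)"
        using v(1) zero_less_one unfolding has_derivative_at_alt by blast
      \<comment> \<open>Near \<open>x\<close> the vector \<open>v y\<close> is bounded by
        \<open>(B + 1) * norm (y - x)\<close>, with \<open>B\<close> from the derivative and 1 from
        the remainder.\<close>
      have "e / (B + 1) > 0" using e B by simp
      then obtain d2 where d2: "d2 > 0" "\<And>y. norm (y - x) < d2 \<Longrightarrow> norm (u y - u x) < e / (B + 1)"
        using u unfolding continuous_at_eps_delta dist_norm by metis
      have "norm ((u y - u x) *\<^sub>R v y - (u x - u x) *\<^sub>R v x - 0) \<le> e * norm (y - x)"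
        if y: "norm (y - x) < min d1 d2" for y
      proof -
        have "norm (v y) \<le> norm (v y - v x - v' (y - x)) + norm (v' (y - x))"
          using v(2) norm_triangle_ineq[of "v y - v' (y - x)" "v' (y - x)"] by simp
        also have "\<dots> \<le> (B + 1) * norm (y - x)"
          using d1(2)[of y] B(1)[of "y - x"] y by (simp add: algebra_simps)
        finally have "norm (u y - u x) * norm (v y) \<le> e / (B + 1) * ((B + 1) * norm (y - x))"
          using d2(2)[of y] y e B by (intro mult_mono) auto
        also have "\<dots> = e * norm (y - x)" using B by simp
        finally show ?thesis by simp
      qed
      then show "\<exists>d>0. \<forall>y. norm (y - x) < d \<longrightarrow>
          norm ((u y - u x) *\<^sub>R v y - (u x - u x) *\<^sub>R v x - 0) \<le> e * norm (y - x)"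
        using d1(1) d2(1) by (intro exI[of _ "min d1 d2"]) auto
    qed simp
  qed
  moreover have "((\<lambda>y. u x *\<^sub>R v y) has_derivative (\<lambda>h. u x *\<^sub>R v' h)) (at x)"
    by (rule has_derivative_scaleR_right[OF v(1)])
  ultimately have "((\<lambda>y. (u y - u x) *\<^sub>R v y + u x *\<^sub>R v y) has_derivative (\<lambda>h. 0 + u x *\<^sub>R v' h)) (at x)"
    by (rule has_derivative_add)
  then show ?thesis by (simp add: algebra_simps)
qed

text \<open>Independence and spanning are phrased through coefficients on the index set, so that
  coincidences of frame vectors never have to be discussed. The instance of interest joins a frame
  of the horizontal distribution with the fundamental fields of a basis of the Lie algebra.\<close>

locale smooth_frame =
  fixes S :: "'a::real_normed_vector set" and J :: "'j set"
    and f :: "'j \<Rightarrow> 'a \<Rightarrow> 'b::finite_euclidean"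
  assumes open_S: "open S" and finite_J: "finite J"
    and smooth_f: "\<And>j. j \<in> J \<Longrightarrow> smooth_on S (f j)"
    and indep: "\<And>x c. x \<in> S \<Longrightarrow> (\<Sum>j\<in>J. c j *\<^sub>R f j x) = 0 \<Longrightarrow> \<forall>j\<in>J. c j = 0"
    and spanning: "\<And>x v. x \<in> S \<Longrightarrow> \<exists>c. v = (\<Sum>j\<in>J. c j *\<^sub>R f j x)"
begin

lemma coeff_unique:
  assumes "x \<in> S" "(\<Sum>j\<in>J. c j *\<^sub>R f j x) = (\<Sum>j\<in>J. d j *\<^sub>R f j x)" "j \<in> J"
  shows "c j = d j"
  using indep[OF assms(1), of "\<lambda>j. c j - d j"] assms(2,3)
  by (simp add: scaleR_diff_left sum_subtractf)

definition coeff :: "'a \<Rightarrow> 'b \<Rightarrow> 'j \<Rightarrow> real" where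
  "coeff x v = (SOME c. v = (\<Sum>j\<in>J. c j *\<^sub>R f j x))"

lemma sum_coeff: "x \<in> S \<Longrightarrow> (\<Sum>j\<in>J. coeff x v j *\<^sub>R f j x) = v"
  unfolding coeff_def by (rule sym, rule someI_ex[OF spanning])

lemma coeff_eqI: "x \<in> S \<Longrightarrow> v = (\<Sum>j\<in>J. c j *\<^sub>R f j x) \<Longrightarrow> j \<in> J \<Longrightarrow> coeff x v j = c j"
  by (rule coeff_unique[of x]) (auto simp: sum_coeff)

lemma linear_coeff: "x \<in> S \<Longrightarrow> j \<in> J \<Longrightarrow> linear (\<lambda>v. coeff x v j)"
  by (rule linearI; rule coeff_eqI)
    (auto simp: scaleR_add_left sum.distrib sum_coeff simp flip: scaleR_scaleR scaleR_sum_right)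

lemma coeff_diff: "x \<in> S \<Longrightarrow> j \<in> J \<Longrightarrow> coeff x (u - v) j = coeff x u j - coeff x v j"
  using linear_diff[OF linear_coeff] .

lemma coeff_lincomb:
  "x \<in> S \<Longrightarrow> j \<in> J \<Longrightarrow> coeff x (\<Sum>i\<in>I. a i *\<^sub>R v i) j = (\<Sum>i\<in>I. a i *\<^sub>R coeff x (v i) j)"
  using linear_sum[OF linear_coeff, of x j "\<lambda>i. a i *\<^sub>R v i" I] linear_scale[OF linear_coeff]
  by simp

lemma bounded_linear_coeff: "x \<in> S \<Longrightarrow> j \<in> J \<Longrightarrow> bounded_linear (\<lambda>v. coeff x v j)"
  by (rule linear_imp_bounded_linear) (rule linear_coeff)

text \<open>Rewriting \<open>v\<close> in the frame at \<open>y\<close> by means of the frame at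
  \<open>x\<close> gives an implicit equation: the unknown coefficients at \<open>y\<close> recur on
  the right, but paired with \<open>f i y - f i x\<close>, which is small. It takes the place of
  inverting the matrix of the frame.\<close>

lemma coeff_perturb:
  assumes x: "x \<in> S" and y: "y \<in> S" and j: "j \<in> J"
  shows "coeff y v j = coeff x v j - (\<Sum>i\<in>J. coeff y v i *\<^sub>R coeff x (f i y - f i x) j)"
proof -
  have "(\<Sum>i\<in>J. coeff y v i *\<^sub>R f i x) = v - (\<Sum>i\<in>J. coeff y v i *\<^sub>R (f i y - f i x))"
    by (simp add: scaleR_diff_right sum_subtractf sum_coeff[OF y])
  then have "coeff y v j = coeff x (v - (\<Sum>i\<in>J. coeff y v i *\<^sub>R (f i y - f i x))) j"
    by (intro coeff_eqI[OF x _ j, symmetric]) (rule sym)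
  then show ?thesis
    unfolding coeff_diff[OF x j] coeff_lincomb[OF x j] .
qed

text \<open>For the total deviation \<open>g\<close> the perturbation identity gives
  \<open>g \<le> E + (g + A) * D\<close> with \<open>D\<close> and \<open>E\<close> tending to zero.
  As soon as \<open>D < 1/2\<close> the term \<open>g * D\<close> is absorbed on the left, and
  \<open>g\<close> tends to zero.\<close>

lemma isCont_coeff:
  assumes x: "x \<in> S" and w: "isCont w x" and j: "j \<in> J"
  shows "isCont (\<lambda>y. coeff y (w y) j) x"
proof -
  define g where "g y = (\<Sum>j\<in>J. \<bar>coeff y (w y) j - coeff x (w x) j\<bar>)" for y
  define D where "D y = (\<Sum>j\<in>J. \<Sum>i\<in>J. \<bar>coeff x (f i y - f i x) j\<bar>)" for y
  define A where "A = (\<Sum>i\<in>J. \<bar>coeff x (w x) i\<bar>)"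
  define E where "E y = (\<Sum>j\<in>J. \<bar>coeff x (w y - w x) j\<bar>)" for y
  have contf: "isCont (f i) x" if "i \<in> J" for i
    using smooth_on_imp_continuous_on[OF smooth_f[OF that]] open_S x continuous_on_eq_continuous_at by blast
  have lim0: "((\<lambda>y. coeff x (u y - u x) j) \<longlongrightarrow> 0) (at x)" if "isCont u x" "j \<in> J" for u j
  proof -
    have "((\<lambda>y. coeff x (u y - u x) j) \<longlongrightarrow> coeff x (u x - u x) j) (at x)"
      by (rule bounded_linear.tendsto[OF bounded_linear_coeff[OF x that(2)]])
        (intro tendsto_diff tendsto_const that(1)[unfolded isCont_def])
    then show ?thesis using linear_0[OF linear_coeff[OF x that(2)]] by simp
  qed
  have "(D \<longlongrightarrow> (\<Sum>j\<in>J. \<Sum>i\<in>J. 0)) (at x)"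
    unfolding D_def by (intro tendsto_sum tendsto_rabs_zero lim0 contf)
  then have D0: "(D \<longlongrightarrow> 0) (at x)" by simp
  have "(E \<longlongrightarrow> (\<Sum>j\<in>J. 0)) (at x)"
    unfolding E_def by (intro tendsto_sum tendsto_rabs_zero lim0 w)
  then have E0: "(E \<longlongrightarrow> 0) (at x)" by simp
  have D_nonneg: "D y \<ge> 0" for y by (simp add: D_def sum_nonneg)
  have g_nonneg: "g y \<ge> 0" for y by (simp add: g_def sum_nonneg)
  have main: "g y \<le> E y + (g y + A) * D y" if y: "y \<in> S" for y
  proof -
    have *: "\<bar>coeff y (w y) i\<bar> \<le> g y + A" if i: "i \<in> J" for i
    proof -
      have "\<bar>coeff y (w y) i - coeff x (w x) i\<bar> \<le> g y"
        unfolding g_def by (rule member_le_sum[OF i]) (use finite_J in auto)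
      moreover have "\<bar>coeff x (w x) i\<bar> \<le> A"
        unfolding A_def by (rule member_le_sum[OF i]) (use finite_J in auto)
      ultimately show ?thesis by linarith
    qed
    have "\<bar>coeff y (w y) j - coeff x (w x) j\<bar> \<le>
        \<bar>coeff x (w y - w x) j\<bar> + (\<Sum>i\<in>J. (g y + A) * \<bar>coeff x (f i y - f i x) j\<bar>)" if j: "j \<in> J" for j
    proof -
      have "coeff y (w y) j - coeff x (w x) j =
          coeff x (w y - w x) j - (\<Sum>i\<in>J. coeff y (w y) i *\<^sub>R coeff x (f i y - f i x) j)"
        using coeff_perturb[OF x y j, of "w y"] unfolding coeff_diff[OF x j] by linarith
      also have "\<bar>\<dots>\<bar> \<le> \<bar>coeff x (w y - w x) j\<bar> + \<bar>\<Sum>i\<in>J. coeff y (w y) i *\<^sub>R coeff x (f i y - f i x) j\<bar>"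
        by linarith
      also have "\<bar>\<Sum>i\<in>J. coeff y (w y) i *\<^sub>R coeff x (f i y - f i x) j\<bar> \<le>
          (\<Sum>i\<in>J. \<bar>coeff y (w y) i *\<^sub>R coeff x (f i y - f i x) j\<bar>)"
        by (rule sum_abs)
      also have "\<dots> \<le> (\<Sum>i\<in>J. (g y + A) * \<bar>coeff x (f i y - f i x) j\<bar>)"
        using * by (intro sum_mono) (auto simp: abs_mult intro!: mult_right_mono)
      finally show ?thesis by simp
    qed
    then have "g y \<le> (\<Sum>j\<in>J. \<bar>coeff x (w y - w x) j\<bar> + (\<Sum>i\<in>J. (g y + A) * \<bar>coeff x (f i y - f i x) j\<bar>))"
      unfolding g_def by (rule sum_mono)
    also have "\<dots> = E y + (g y + A) * D y"
      by (simp add: sum.distrib E_def D_def sum_distrib_left)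
    finally show ?thesis .
  qed
  have "eventually (\<lambda>y. y \<in> S) (at x)"
    using open_S x by (simp add: eventually_at_in_open')
  moreover have "eventually (\<lambda>y. D y < 1/2) (at x)"
    using D0 by (rule order_tendstoD) simp
  ultimately have "eventually (\<lambda>y. norm (g y) \<le> 2 * (E y + A * D y)) (at x)"
  proof eventually_elim
    case (elim y)
    have "g y * D y \<le> g y * (1/2)" using elim g_nonneg by (intro mult_left_mono) auto
    then show ?case using main[OF elim(1)] g_nonneg[of y] by (simp add: algebra_simps)
  qed
  moreover have "((\<lambda>y. 2 * (E y + A * D y)) \<longlongrightarrow> 2 * (0 + A * 0)) (at x)"
    by (intro tendsto_intros D0 E0)
  then have "((\<lambda>y. 2 * (E y + A * D y)) \<longlongrightarrow> 0) (at x)" by simp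
  ultimately have g0: "(g \<longlongrightarrow> 0) (at x)"
    by (rule Lim_null_comparison)
  have "((\<lambda>y. coeff y (w y) j - coeff x (w x) j) \<longlongrightarrow> 0) (at x)"
    by (rule Lim_null_comparison[OF _ g0])
      (auto simp: g_def intro!: always_eventually member_le_sum[OF j] finite_J)
  then show ?thesis
    unfolding isCont_def by (simp add: LIM_zero_iff)
qed

text \<open>In the perturbation identity the factors \<open>coeff x (f i y - f i x) j\<close> vanish
  at \<open>y = x\<close>, so continuity of the remaining factors is enough to differentiate the
  products.\<close>

lemma has_derivative_coeff:
  assumes x: "x \<in> S" and w: "(w has_derivative w') (at x)" and j: "j \<in> J"
  shows "((\<lambda>y. coeff y (w y) j) has_derivative
    (\<lambda>h. coeff x (w' h - (\<Sum>i\<in>J. coeff x (w x) i *\<^sub>R frechet_derivative (f i) (at x) h)) j)) (at x)"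
proof -
  have D: "((\<lambda>y. coeff y (w y) i *\<^sub>R coeff x (f i y - f i x) j) has_derivative
      (\<lambda>h. coeff x (w x) i *\<^sub>R coeff x (frechet_derivative (f i) (at x) h) j)) (at x)" if "i \<in> J" for i
  proof (rule has_derivative_scaleR_vanishing)
    show "isCont (\<lambda>y. coeff y (w y) i) x"
      using isCont_coeff[OF x has_derivative_continuous[OF w] that] .
    have "((\<lambda>y. f i y - f i x) has_derivative (\<lambda>h. frechet_derivative (f i) (at x) h - 0)) (at x)"
      by (intro has_derivative_diff has_derivative_const smooth_on_has_derivative[OF open_S smooth_f[OF that] x])
    from bounded_linear.has_derivative[OF bounded_linear_coeff[OF x j] this]
    show "((\<lambda>y. coeff x (f i y - f i x) j) has_derivative
        (\<lambda>h. coeff x (frechet_derivative (f i) (at x) h) j)) (at x)" by simp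
    show "coeff x (f i x - f i x) j = 0"
      using linear_0[OF linear_coeff[OF x j]] by simp
  qed
  have "((\<lambda>y. coeff x (w y) j - (\<Sum>i\<in>J. coeff y (w y) i *\<^sub>R coeff x (f i y - f i x) j)) has_derivative
      (\<lambda>h. coeff x (w' h) j - (\<Sum>i\<in>J. coeff x (w x) i *\<^sub>R coeff x (frechet_derivative (f i) (at x) h) j))) (at x)"
    by (intro has_derivative_diff has_derivative_sum D bounded_linear.has_derivative[OF bounded_linear_coeff[OF x j] w])
  then have "((\<lambda>y. coeff y (w y) j) has_derivative
      (\<lambda>h. coeff x (w' h) j - (\<Sum>i\<in>J. coeff x (w x) i *\<^sub>R coeff x (frechet_derivative (f i) (at x) h) j))) (at x)"
    by (rule has_derivative_transform_within_open[OF _ open_S x]) (rule coeff_perturb[OF x _ j, symmetric])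
  then show ?thesis
    unfolding coeff_diff[OF x j] coeff_lincomb[OF x j] .
qed

text \<open>The derivative of a coefficient is again a coefficient, now of the field
  \<open>z\<close> built from \<open>w'\<close>, the coefficients of \<open>w\<close> and the
  derivatives of the frame. This field is of order \<open>k\<close> because by induction the
  coefficients of \<open>w\<close> are.\<close>

lemma k_smooth_on_coeff:
  "k_smooth_on k S w \<Longrightarrow> j \<in> J \<Longrightarrow> k_smooth_on k S (\<lambda>y. coeff y (w y) j)"
proof (induction k arbitrary: w j)
  case 0
  then have "isCont w x" if "x \<in> S" for x
    using that open_S by (simp add: continuous_on_eq_continuous_at)
  then show ?case
    using isCont_coeff 0(2) open_S by (simp add: continuous_on_eq_continuous_at)
next
  case (Suc k)
  obtain w' where w': "\<forall>x\<in>S. (w has_derivative w' x) (at x within S)" "\<forall>v. k_smooth_on k S (\<lambda>x. w' x v)"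
    using Suc.prems(1) unfolding k_smooth_on.simps(2) by blast
  have wk: "k_smooth_on k S w" by (rule k_smooth_on_SucD[OF Suc.prems(1)])
  define z where "z v x = w' x v - (\<Sum>i\<in>J. coeff x (w x) i *\<^sub>R frechet_derivative (f i) (at x) v)" for v x
  have "k_smooth_on k S (\<lambda>x. w' x v + (\<Sum>i\<in>J. - (coeff x (w x) i *\<^sub>R frechet_derivative (f i) (at x) v)))" for v
    using w'(2) smooth_on_frechet_derivative[OF open_S smooth_f] unfolding smooth_on_def
    by (intro k_smooth_on_add k_smooth_on_sum k_smooth_on_bilinear[OF bounded_bilinear_scaleR]
        k_smooth_on_bounded_linear_comp[OF bounded_linear_minus[OF bounded_linear_ident]] Suc.IH[OF wk]) auto
  then have "k_smooth_on k S (z v)" for v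
    unfolding z_def by (simp add: sum_negf)
  then have 1: "k_smooth_on k S (\<lambda>x. coeff x (z v x) j)" for v
    by (rule Suc.IH[OF _ Suc.prems(2)])
  have "((\<lambda>y. coeff y (w y) j) has_derivative (\<lambda>h. coeff x (z h x) j)) (at x within S)" if "x \<in> S" for x
    unfolding z_def at_within_open[OF that open_S]
    by (rule has_derivative_coeff[OF that bspec[OF w'(1) that, unfolded at_within_open[OF that open_S]] Suc.prems(2)])
  with 1 show ?case unfolding k_smooth_on.simps(2)
    by (intro exI[of _ "\<lambda>x h. coeff x (z h x) j"]) simp
qed

lemma smooth_on_coeff:
  "smooth_on S w \<Longrightarrow> j \<in> J \<Longrightarrow> smooth_on S (\<lambda>y. coeff y (w y) j)"
  unfolding smooth_on_def using k_smooth_on_coeff by blast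

end

section \<open>Symmetry of second derivatives\<close>

lemma has_derivative_along_line:
  assumes "(f has_derivative f') (at (a + s *\<^sub>R u))"
  shows "((\<lambda>s. f (a + s *\<^sub>R u)) has_derivative (\<lambda>h. h *\<^sub>R f' u)) (at s)"
proof -
  have "((\<lambda>s. a + s *\<^sub>R u) has_derivative (\<lambda>h. h *\<^sub>R u)) (at s)"
    by (auto intro!: derivative_eq_intros)
  from diff_chain_at[OF this assms]
  have "((\<lambda>s. f (a + s *\<^sub>R u)) has_derivative (\<lambda>h. f' (h *\<^sub>R u))) (at s)" by (simp add: o_def)
  then show ?thesis
    using linear_scale[OF has_derivative_linear[OF assms]] by simp
qed

text \<open>The mean value theorem is used twice: in direction \<open>u\<close> for the difference
  of \<open>f\<close> along two parallel segments, then in direction \<open>v\<close> for the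
  partial derivative along \<open>u\<close>.\<close>

lemma second_difference_mean_value:
  fixes f :: "'a::real_normed_vector \<Rightarrow> real"
  assumes "h > 0" and box: "\<And>s t. s \<in> {0..h} \<Longrightarrow> t \<in> {0..h} \<Longrightarrow> x + s *\<^sub>R u + t *\<^sub>R v \<in> S"
    and f: "\<And>y. y \<in> S \<Longrightarrow> (f has_derivative f' y) (at y)"
    and f': "\<And>y. y \<in> S \<Longrightarrow> ((\<lambda>y. f' y u) has_derivative f'' y) (at y)"
  shows "\<exists>s\<in>{0..h}. \<exists>t\<in>{0..h}. f (x + h *\<^sub>R u + h *\<^sub>R v) - f (x + h *\<^sub>R u) - f (x + h *\<^sub>R v) + f x =
    h * (h * f'' (x + s *\<^sub>R u + t *\<^sub>R v) v)"
proof -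
  define g where "g s = f (x + h *\<^sub>R v + s *\<^sub>R u) - f (x + s *\<^sub>R u)" for s
  have g: "(g has_real_derivative f' (x + h *\<^sub>R v + s *\<^sub>R u) u - f' (x + s *\<^sub>R u) u) (at s)" if "0 \<le> s" "s \<le> h" for s
  proof -
    have "x + h *\<^sub>R v + s *\<^sub>R u \<in> S" "x + s *\<^sub>R u \<in> S"
      using box[of s h] box[of s 0] that assms(1) by (auto simp: algebra_simps)
    then have "(g has_derivative (\<lambda>h'. h' *\<^sub>R f' (x + h *\<^sub>R v + s *\<^sub>R u) u - h' *\<^sub>R f' (x + s *\<^sub>R u) u)) (at s)"
      unfolding g_def by (intro has_derivative_diff has_derivative_along_line f)
    then show ?thesis
      unfolding has_field_derivative_def
      by (rule has_derivative_eq_rhs) (auto simp: algebra_simps)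
  qed
  obtain s where s: "0 < s" "s < h" "g h - g 0 = (h - 0) * (f' (x + h *\<^sub>R v + s *\<^sub>R u) u - f' (x + s *\<^sub>R u) u)"
    using MVT2[OF assms(1) g] by blast
  define k where "k t = f' (x + s *\<^sub>R u + t *\<^sub>R v) u" for t
  have k: "(k has_real_derivative f'' (x + s *\<^sub>R u + t *\<^sub>R v) v) (at t)" if "0 \<le> t" "t \<le> h" for t
  proof -
    have "x + s *\<^sub>R u + t *\<^sub>R v \<in> S" using box[of s t] that s by auto
    from has_derivative_along_line[OF f'[OF this]]
    show ?thesis unfolding k_def has_field_derivative_def
      by (rule has_derivative_eq_rhs) (auto simp: algebra_simps)
  qed
  obtain t where t: "0 < t" "t < h" "k h - k 0 = (h - 0) * f'' (x + s *\<^sub>R u + t *\<^sub>R v) v"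
    using MVT2[OF assms(1) k] by blast
  have "f (x + h *\<^sub>R u + h *\<^sub>R v) - f (x + h *\<^sub>R u) - f (x + h *\<^sub>R v) + f x = g h - g 0"
    by (simp add: g_def algebra_simps)
  also have "\<dots> = h * (k h - k 0)"
    unfolding s(3) by (simp add: k_def algebra_simps)
  finally show ?thesis using s t by (intro bexI[of _ s] bexI[of _ t]) auto
qed

text \<open>The second difference over a small parallelogram is symmetric in \<open>u\<close> and
  \<open>v\<close>. In either order it is \<open>h * h\<close> times a mixed derivative at a point
  near \<open>x\<close>, so by continuity the two mixed derivatives at \<open>x\<close> cannot
  differ.\<close>

lemma second_derivative_symmetric_real:
  fixes f :: "'a::real_normed_vector \<Rightarrow> real"
  assumes S: "open S" "x \<in> S" and f: "\<And>y. y \<in> S \<Longrightarrow> (f has_derivative f' y) (at y)"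
    and u: "\<And>y. y \<in> S \<Longrightarrow> ((\<lambda>y. f' y u) has_derivative fu y) (at y)" "isCont (\<lambda>y. fu y v) x"
    and v: "\<And>y. y \<in> S \<Longrightarrow> ((\<lambda>y. f' y v) has_derivative fv y) (at y)" "isCont (\<lambda>y. fv y u) x"
  shows "fu x v = fv x u"
proof (rule ccontr)
  assume ne: "fu x v \<noteq> fv x u"
  define e where "e = \<bar>fu x v - fv x u\<bar> / 2"
  have e: "e > 0" using ne by (simp add: e_def)
  obtain d1 where d1: "d1 > 0" "\<And>y. norm (y - x) < d1 \<Longrightarrow> \<bar>fu y v - fu x v\<bar> < e"
    using u(2) e unfolding continuous_at_eps_delta dist_norm real_norm_def by metis
  obtain d2 where d2: "d2 > 0" "\<And>y. norm (y - x) < d2 \<Longrightarrow> \<bar>fv y u - fv x u\<bar> < e"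
    using v(2) e unfolding continuous_at_eps_delta dist_norm real_norm_def by metis
  obtain d3 where d3: "d3 > 0" "ball x d3 \<subseteq> S"
    using S openE by blast
  define d where "d = min d1 (min d2 d3)"
  have d: "d > 0" using d1 d2 d3 by (simp add: d_def)
  \<comment> \<open>Every point of the parallelogram spanned by \<open>h *\<^sub>R u\<close> and
    \<open>h *\<^sub>R v\<close> at \<open>x\<close> is then at distance less than \<open>d\<close>
    from \<open>x\<close>; the summand 1 covers \<open>u = v = 0\<close>.\<close>
  define h where "h = d / (2 * (norm u + norm v + 1))"
  have h: "h > 0" using d by (simp add: h_def add_nonneg_pos)
  have small: "norm (x + s *\<^sub>R u + t *\<^sub>R v - x) < d" if "s \<in> {0..h}" "t \<in> {0..h}" for s t
  proof -
    have "norm (x + s *\<^sub>R u + t *\<^sub>R v - x) \<le> norm (s *\<^sub>R u) + norm (t *\<^sub>R v)"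
      using norm_triangle_ineq[of "s *\<^sub>R u" "t *\<^sub>R v"] by simp
    also have "\<dots> \<le> h * norm u + h * norm v"
      using that by (auto intro!: add_mono mult_right_mono)
    also have "\<dots> < h * (2 * (norm u + norm v + 1))"
    proof -
      have "0 \<le> h * norm u" "0 \<le> h * norm v" using h by auto
      then have "0 < h * norm u + (h * norm v + h * 2)" using h by linarith
      then show ?thesis by (simp add: algebra_simps)
    qed
    also have "\<dots> = d"
      using norm_ge_zero[of u] norm_ge_zero[of v] unfolding h_def by (simp add: add_nonneg_eq_0_iff)
    finally show ?thesis .
  qed
  have box: "x + s *\<^sub>R u + t *\<^sub>R v \<in> S" "x + t *\<^sub>R v + s *\<^sub>R u \<in> S" if "s \<in> {0..h}" "t \<in> {0..h}" for s t
  proof -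
    have "x + s *\<^sub>R u + t *\<^sub>R v \<in> ball x d3"
    proof -
      have "norm (x + s *\<^sub>R u + t *\<^sub>R v - x) < d3"
        using small[OF that] unfolding d_def by linarith
      then show ?thesis unfolding mem_ball by (subst dist_commute) (simp only: dist_norm)
    qed
    then show "x + s *\<^sub>R u + t *\<^sub>R v \<in> S" using d3 by blast
    then show "x + t *\<^sub>R v + s *\<^sub>R u \<in> S" by (metis add.assoc add.commute)
  qed
  obtain s t where st: "s \<in> {0..h}" "t \<in> {0..h}"
    "f (x + h *\<^sub>R u + h *\<^sub>R v) - f (x + h *\<^sub>R u) - f (x + h *\<^sub>R v) + f x = h * (h * fu (x + s *\<^sub>R u + t *\<^sub>R v) v)"
    using second_difference_mean_value[OF h box(1) f u(1)] by blast
  obtain s' t' where st': "s' \<in> {0..h}" "t' \<in> {0..h}"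
    "f (x + h *\<^sub>R v + h *\<^sub>R u) - f (x + h *\<^sub>R v) - f (x + h *\<^sub>R u) + f x = h * (h * fv (x + s' *\<^sub>R v + t' *\<^sub>R u) u)"
    using second_difference_mean_value[OF h box(2) f v(1)] by blast
  have "h * (h * fu (x + s *\<^sub>R u + t *\<^sub>R v) v) = h * (h * fv (x + s' *\<^sub>R v + t' *\<^sub>R u) u)"
    using st(3) st'(3) by (simp add: algebra_simps)
  then have eq: "fu (x + s *\<^sub>R u + t *\<^sub>R v) v = fv (x + s' *\<^sub>R v + t' *\<^sub>R u) u"
    using h by simp
  have "\<bar>fu (x + s *\<^sub>R u + t *\<^sub>R v) v - fu x v\<bar> < e"
    using small[OF st(1,2)] by (intro d1(2)) (simp add: d_def)
  moreover have "\<bar>fv (x + s' *\<^sub>R v + t' *\<^sub>R u) u - fv x u\<bar> < e"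
    using small[OF st'(2,1)]
    by (intro d2(2)) (simp add: d_def add.commute[of "s' *\<^sub>R v" "t' *\<^sub>R u"])
  ultimately show False using eq unfolding e_def by argo
qed

lemma second_derivative_symmetric:
  fixes f :: "'a::real_normed_vector \<Rightarrow> 'b::finite_euclidean"
  assumes S: "open S" "x \<in> S" and f: "smooth_on S f"
  shows "frechet_derivative (\<lambda>y. frechet_derivative f (at y) u) (at x) v =
    frechet_derivative (\<lambda>y. frechet_derivative f (at y) v) (at x) u"
proof -
  define D where "D u y = frechet_derivative f (at y) u" for u y
  have D: "smooth_on S (D u)" for u
    unfolding D_def by (rule smooth_on_frechet_derivative[OF S(1) f])
  define DD where "DD u v y = frechet_derivative (D u) (at y) v" for u v y
  have DD: "smooth_on S (DD u v)" for u v
    unfolding DD_def by (rule smooth_on_frechet_derivative[OF S(1) D])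
  have "inner (DD u v x - DD v u x) b = 0" for b
  proof -
    have f': "((\<lambda>y. inner (f y) b) has_derivative (\<lambda>h. inner (D h y) b)) (at y)" if "y \<in> S" for y
      unfolding D_def by (intro has_derivative_inner_left smooth_on_has_derivative[OF S(1) f that])
    have D': "((\<lambda>y. inner (D w y) b) has_derivative (\<lambda>h. inner (DD w h y) b)) (at y)" if "y \<in> S" for y w
      unfolding DD_def by (intro has_derivative_inner_left smooth_on_has_derivative[OF S(1) D that])
    have c: "isCont (\<lambda>y. inner (DD w z y) b) x" for w z
      using smooth_on_imp_continuous_on[OF DD, of w z] S
      by (intro continuous_intros) (simp add: continuous_on_eq_continuous_at)
    have "inner (DD u v x) b = inner (DD v u x) b"
      by (rule second_derivative_symmetric_real[OF S f' D' c D' c])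
    then show ?thesis by (simp add: inner_diff_left)
  qed
  then have "DD u v x - DD v u x = 0" using inner_eq_zero_iff by blast
  then show ?thesis unfolding DD_def D_def by simp
qed

section \<open>Existence, uniqueness and regularity of solutions of differential equations\<close>

section \<open>Ordinary differential equations\<close>

text \<open>The weight \<open>exp (- 2 * K * (t - a))\<close> makes the Picard operator a contraction
  on an interval of any length.\<close>

lemma picard_existence:
  fixes F :: "real \<Rightarrow> 'a::banach \<Rightarrow> 'a"
  assumes ab: "a \<le> b" and K: "K > 0"
    and lip: "\<And>t x y. t \<in> {a..b} \<Longrightarrow> norm (F t x - F t y) \<le> K * norm (x - y)"
    and cont: "\<And>x. continuous_on {a..b} x \<Longrightarrow> continuous_on {a..b} (\<lambda>t. F t (x t))"
  shows "\<exists>x. x a = x0 \<and> (\<forall>t\<in>{a..b}. (x has_vector_derivative F t (x t)) (at t within {a..b}))"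
proof -
  \<comment> \<open>Clamping the time to the interval turns a continuous function on it into a
    bounded continuous function on the whole line, so the fixed point theorem can be applied on the
    type of such functions.\<close>
  define c where "c t = max a (min b t)" for t
  have c: "c t \<in> {a..b}" "t \<in> {a..b} \<Longrightarrow> c t = t" for t using ab by (auto simp: c_def)
  define X where "X \<phi> r = exp (2 * K * (r - a)) *\<^sub>R apply_bcontfun \<phi> r" for \<phi> :: "real \<Rightarrow>\<^sub>C 'a" and r
  have contF: "continuous_on {a..b} (\<lambda>r. F r (X \<phi> r))" for \<phi>
    unfolding X_def by (intro cont continuous_intros continuous_on_apply_bcontfun)
  have intF: "(\<lambda>r. F r (X \<phi> r)) integrable_on {a..s}" if "s \<in> {a..b}" for \<phi> s
    by (rule integrable_continuous_real, rule continuous_on_subset[OF contF]) (use that in auto)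
  define g where "g \<phi> s = exp (- (2 * K * (s - a))) *\<^sub>R (x0 + integral {a..s} (\<lambda>r. F r (X \<phi> r)))" for \<phi> s
  have contg: "continuous_on {a..b} (g \<phi>)" for \<phi>
    unfolding g_def
    by (intro continuous_intros indefinite_integral_continuous_1 intF) (use ab in auto)
  define G where "G \<phi> = Bcontfun (\<lambda>t. g \<phi> (c t))" for \<phi>
  have "(\<lambda>t. g \<phi> (c t)) \<in> bcontfun" for \<phi>
  proof -
    have "continuous_on UNIV (\<lambda>t. g \<phi> (c t))"
      by (rule continuous_on_compose2[OF contg]) (use c in \<open>auto simp: c_def intro!: continuous_intros\<close>)
    moreover have "bounded (g \<phi> ` {a..b})"
      by (rule compact_imp_bounded[OF compact_continuous_image[OF contg]]) simp
    then have "bounded (range (\<lambda>t. g \<phi> (c t)))"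
      by (rule bounded_subset) (use c in auto)
    ultimately show ?thesis by (simp add: bcontfun_def)
  qed
  then have G: "apply_bcontfun (G \<phi>) t = g \<phi> (c t)" for \<phi> t
    unfolding G_def by (simp add: Bcontfun_inverse)
  have "dist (G \<phi>) (G \<psi>) \<le> 1/2 * dist \<phi> \<psi>" for \<phi> \<psi>
  proof (rule dist_bound)
    fix t
    define s where "s = c t"
    have s: "s \<in> {a..b}" using c by (simp add: s_def)
    \<comment> \<open>Integrating \<open>K * exp (2 * K * (r - a))\<close> produces the factor 1/2,
      which becomes the contraction constant after division by the weight.\<close>
    have E: "((\<lambda>r. (K * dist \<phi> \<psi>) * exp (2 * K * (r - a))) has_integral
        dist \<phi> \<psi> / 2 * exp (2 * K * (s - a)) - dist \<phi> \<psi> / 2 * exp (2 * K * (a - a))) {a..s}"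
      using s K
      by (intro fundamental_theorem_of_calculus)
        (auto intro!: derivative_eq_intros simp flip: has_real_derivative_iff_has_vector_derivative)
    have "norm (integral {a..s} (\<lambda>r. F r (X \<phi> r) - F r (X \<psi> r))) \<le>
        integral {a..s} (\<lambda>r. (K * dist \<phi> \<psi>) * exp (2 * K * (r - a)))"
    proof (rule Henstock_Kurzweil_Integration.integral_norm_bound_integral)
      show "(\<lambda>r. F r (X \<phi> r) - F r (X \<psi> r)) integrable_on {a..s}"
        by (intro integrable_diff intF s)
      show "(\<lambda>r. (K * dist \<phi> \<psi>) * exp (2 * K * (r - a))) integrable_on {a..s}"
        using E by blast
      fix r assume r: "r \<in> {a..s}"
      have "norm (F r (X \<phi> r) - F r (X \<psi> r)) \<le> K * norm (X \<phi> r - X \<psi> r)"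
        using r s by (intro lip) auto
      also have "norm (X \<phi> r - X \<psi> r) = exp (2 * K * (r - a)) * dist (apply_bcontfun \<phi> r) (apply_bcontfun \<psi> r)"
        unfolding X_def dist_norm by (simp flip: scaleR_diff_right)
      also have "\<dots> \<le> exp (2 * K * (r - a)) * dist \<phi> \<psi>"
        by (intro mult_left_mono dist_bounded) simp
      finally show "norm (F r (X \<phi> r) - F r (X \<psi> r)) \<le> (K * dist \<phi> \<psi>) * exp (2 * K * (r - a))"
        using K by (simp add: mult_ac)
    qed
    also have "\<dots> = dist \<phi> \<psi> / 2 * exp (2 * K * (s - a)) - dist \<phi> \<psi> / 2"
      using integral_unique[OF E] by simp
    also have "\<dots> \<le> dist \<phi> \<psi> / 2 * exp (2 * K * (s - a))" by simp
    finally have I: "norm (integral {a..s} (\<lambda>r. F r (X \<phi> r) - F r (X \<psi> r))) \<le> dist \<phi> \<psi> / 2 * exp (2 * K * (s - a))" .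
    have "g \<phi> s - g \<psi> s = exp (- (2 * K * (s - a))) *\<^sub>R integral {a..s} (\<lambda>r. F r (X \<phi> r) - F r (X \<psi> r))"
      unfolding g_def by (simp add: integral_diff intF[OF s] flip: scaleR_diff_right)
    then have "dist (g \<phi> s) (g \<psi> s) = exp (- (2 * K * (s - a))) * norm (integral {a..s} (\<lambda>r. F r (X \<phi> r) - F r (X \<psi> r)))"
      by (simp add: dist_norm)
    also have "\<dots> \<le> exp (- (2 * K * (s - a))) * (dist \<phi> \<psi> / 2 * exp (2 * K * (s - a)))"
      by (intro mult_left_mono I) simp
    also have "\<dots> = 1/2 * dist \<phi> \<psi>"
      by (simp only: exp_minus) (simp add: divide_simps)
    finally show "dist (apply_bcontfun (G \<phi>) t) (apply_bcontfun (G \<psi>) t) \<le> 1/2 * dist \<phi> \<psi>"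
      unfolding G s_def .
  qed
  then obtain \<phi> where \<phi>: "G \<phi> = \<phi>"
    using banach_fix_type[of "1/2" G] by auto
  have X: "X \<phi> t = x0 + integral {a..t} (\<lambda>r. F r (X \<phi> r))" if "t \<in> {a..b}" for t
  proof -
    have "apply_bcontfun \<phi> t = g \<phi> t" using G[of \<phi> t] \<phi> c(2)[OF that] by simp
    then show ?thesis unfolding X_def[of \<phi> t] g_def by (simp add: exp_minus)
  qed
  have "(X \<phi> has_vector_derivative F t (X \<phi> t)) (at t within {a..b})" if t: "t \<in> {a..b}" for t
  proof (rule has_vector_derivative_transform[OF t])
    show "X \<phi> t = x0 + integral {a..t} (\<lambda>r. F r (X \<phi> r))" if "t \<in> {a..b}" for t
      using X[OF that] .
    show "((\<lambda>t. x0 + integral {a..t} (\<lambda>r. F r (X \<phi> r))) has_vector_derivative F t (X \<phi> t)) (at t within {a..b})"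
      using integral_has_vector_derivative[OF contF t, of \<phi>]
      by (auto intro!: derivative_eq_intros)
  qed
  moreover have "X \<phi> a = x0" using X[of a] ab by simp
  ultimately show ?thesis by blast
qed

text \<open>The weighted square \<open>exp (- (2 * K * (t - a))) * inner (z t) (z t)\<close> of the
  difference \<open>z\<close> has nonpositive derivative by the Cauchy-Schwarz inequality and starts
  at zero. The Lipschitz bound refers to the two curves only, which suits fields that are Lipschitz
  on a ball.\<close>

lemma ode_unique:
  fixes x y :: "real \<Rightarrow> 'a::real_inner"
  assumes x: "\<And>t. t \<in> {a..b} \<Longrightarrow> (x has_vector_derivative x' t) (at t within {a..b})"
    and y: "\<And>t. t \<in> {a..b} \<Longrightarrow> (y has_vector_derivative y' t) (at t within {a..b})"
    and lip: "\<And>t. t \<in> {a..b} \<Longrightarrow> norm (x' t - y' t) \<le> K * norm (x t - y t)"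
    and eq: "x a = y a" and t: "t \<in> {a..b}"
  shows "x t = y t"
proof -
  define z where "z t = x t - y t" for t
  define g where "g t = exp (- (2 * K * (t - a))) * inner (z t) (z t)" for t
  define g' where "g' t = exp (- (2 * K * (t - a))) * (2 * inner (z t) (x' t - y' t) - 2 * K * inner (z t) (z t))" for t
  have g: "(g has_derivative (\<lambda>h. h * g' s)) (at s within {a..t})" if s: "s \<in> {a..t}" for s
  proof -
    have z: "(z has_derivative (\<lambda>h. h *\<^sub>R (x' s - y' s))) (at s within {a..t})"
    proof -
      have "((\<lambda>t. x t - y t) has_vector_derivative (x' s - y' s)) (at s within {a..b})"
        using s t by (intro has_vector_derivative_diff x y) auto
      then show ?thesis unfolding z_def has_vector_derivative_def
        by (rule has_derivative_subset) (use t in auto)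
    qed
    show ?thesis unfolding g_def
      by (rule has_derivative_eq_rhs, rule has_derivative_mult, (rule derivative_eq_intros z refl)+)
        (auto simp: fun_eq_iff g'_def algebra_simps inner_commute)
  qed
  have "a \<le> t" using t by simp
  then obtain s where s: "s \<in> {a..t}" "g t - g a = (t - a) * g' s"
    using mvt_very_simple[of a t g "\<lambda>s h. h * g' s"] g by auto
  have "inner (z s) (x' s - y' s) \<le> K * inner (z s) (z s)"
  proof -
    have "inner (z s) (x' s - y' s) \<le> norm (z s) * norm (x' s - y' s)" by (rule norm_cauchy_schwarz)
    also have "\<dots> \<le> norm (z s) * (K * norm (z s))"
      using s t lip[of s] by (intro mult_left_mono) (auto simp: z_def)
    finally show ?thesis by (simp add: dot_square_norm power2_eq_square mult_ac)
  qed
  then have "g' s \<le> 0" unfolding g'_def by (intro mult_nonneg_nonpos) auto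
  then have "(t - a) * g' s \<le> 0" using t by (intro mult_nonneg_nonpos) auto
  then have "g t \<le> g a" using s(2) by linarith
  moreover have "g a = 0" using eq by (simp add: g_def z_def)
  ultimately have "exp (- (2 * K * (t - a))) * inner (z t) (z t) \<le> 0" by (simp add: g_def)
  then have "inner (z t) (z t) \<le> 0"
    by (metis exp_gt_zero mult_le_0_iff not_le)
  then have "z t = 0" using inner_ge_zero[of "z t"] inner_eq_zero_iff[of "z t"] by linarith
  then show ?thesis by (simp add: z_def)
qed

text \<open>Boundedness of \<open>A\<close> on the compact interval makes the right-hand side
  globally Lipschitz, so the solution lives on the whole interval; smoothness is bootstrapped
  through the equation. A general \<open>bl\<close> covers both operators acting on vectors and
  functionals composed with operators.\<close>

lemma linear_ode_smooth_solution:
  fixes bl :: "'a::banach \<Rightarrow> 'b::real_normed_vector \<Rightarrow> 'a"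
  assumes bl: "bounded_bilinear bl" and ab: "a < b"
    and A: "smooth_on {a..b} A" and f: "smooth_on {a..b} f"
  shows "\<exists>x. smooth_on {a..b} x \<and> x a = x0 \<and>
    (\<forall>t\<in>{a..b}. (x has_vector_derivative bl (x t) (A t) + f t) (at t within {a..b}))"
proof -
  interpret bounded_bilinear bl by (rule bl)
  obtain C where C: "C > 0" "\<And>x y. norm (bl x y) \<le> norm x * norm y * C"
    using pos_bounded by auto
  have "bounded (A ` {a..b})"
    by (rule compact_imp_bounded[OF compact_continuous_image[OF smooth_on_imp_continuous_on[OF A]]]) simp
  then obtain M where M: "M > 0" "\<And>t. t \<in> {a..b} \<Longrightarrow> norm (A t) \<le> M"
    unfolding bounded_pos by auto
  have "\<exists>x. x a = x0 \<and> (\<forall>t\<in>{a..b}. (x has_vector_derivative bl (x t) (A t) + f t) (at t within {a..b}))"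
  proof (rule picard_existence)
    show "M * C > 0" using M C by simp
    show "norm (bl x (A t) + f t - (bl y (A t) + f t)) \<le> M * C * norm (x - y)" if t: "t \<in> {a..b}" for t x y
    proof -
      have "norm (bl (x - y) (A t)) \<le> norm (x - y) * norm (A t) * C" by (rule C)
      also have "\<dots> \<le> norm (x - y) * M * C"
        using M(2)[OF t] C by (intro mult_right_mono mult_left_mono) auto
      finally show ?thesis by (simp add: diff_left mult_ac)
    qed
    show "continuous_on {a..b} (\<lambda>t. bl (x t) (A t) + f t)" if "continuous_on {a..b} x" for x
      by (intro continuous_on_add continuous_on that smooth_on_imp_continuous_on A f)
  qed (use ab in simp)
  then obtain x where x: "x a = x0"
    "\<And>t. t \<in> {a..b} \<Longrightarrow> (x has_vector_derivative bl (x t) (A t) + f t) (at t within {a..b})" by blast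
  have "k_smooth_on k {a..b} x" for k
  proof (induction k)
    case 0
    then show ?case
      using x(2) has_vector_derivative_continuous
      unfolding k_smooth_on.simps(1) continuous_on_eq_continuous_within by blast
  next
    case (Suc k)
    have "k_smooth_on k {a..b} (\<lambda>t. bl (x t) (A t) + f t)"
      using A f unfolding smooth_on_def by (intro k_smooth_on_add k_smooth_on_bilinear[OF bl] Suc) auto
    then show ?case
      by (rule k_smooth_on_SucI_vector_derivative[where g = "\<lambda>t. bl (x t) (A t) + f t", rotated]) (rule x(2))
  qed
  then show ?thesis using x unfolding smooth_on_def by blast
qed

text \<open>The reflection \<open>t \<mapsto> a + b - t\<close> exchanges the end-points and
  reverses the sign of the right-hand side.\<close>

lemma linear_ode_smooth_solution_terminal:
  fixes bl :: "'a::banach \<Rightarrow> 'b::real_normed_vector \<Rightarrow> 'a"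
  assumes bl: "bounded_bilinear bl" and ab: "a < b"
    and A: "smooth_on {a..b} A" and f: "smooth_on {a..b} f"
  shows "\<exists>x. smooth_on {a..b} x \<and> x b = x1 \<and>
    (\<forall>t\<in>{a..b}. (x has_vector_derivative bl (x t) (A t) + f t) (at t within {a..b}))"
proof -
  interpret bounded_bilinear bl by (rule bl)
  define \<rho> where "\<rho> = (\<lambda>t. a + b - t)"
  have \<rho>: "\<rho> ` {a..b} \<subseteq> {a..b}" "\<And>t. \<rho> (\<rho> t) = t" "\<rho> a = b" by (auto simp: \<rho>_def)
  have smooth_rev: "smooth_on {a..b} (\<lambda>t. g (\<rho> t))" if "smooth_on {a..b} g" for g :: "real \<Rightarrow> 'c::real_normed_vector"
    by (rule smooth_on_compose[OF _ that \<rho>(1)])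
      (unfold \<rho>_def, intro smooth_on_diff smooth_on_const smooth_on_ident)
  obtain y where y: "smooth_on {a..b} y" "y a = x1"
    "\<And>t. t \<in> {a..b} \<Longrightarrow> (y has_vector_derivative bl (y t) (- A (\<rho> t)) + - f (\<rho> t)) (at t within {a..b})"
    using linear_ode_smooth_solution[OF bl ab smooth_on_minus[OF smooth_rev[OF A]] smooth_on_minus[OF smooth_rev[OF f]]]
    by blast
  have "((\<lambda>t. y (\<rho> t)) has_vector_derivative bl (y (\<rho> t)) (A t) + f t) (at t within {a..b})" if t: "t \<in> {a..b}" for t
  proof -
    have r: "(\<rho> has_vector_derivative -1) (at t within {a..b})"
      unfolding \<rho>_def by (auto intro!: derivative_eq_intros)
    have "\<rho> t \<in> {a..b}" using t by (simp add: \<rho>_def)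
    from has_vector_derivative_within_subset[OF y(3)[OF this] \<rho>(1)]
    have "(y \<circ> \<rho> has_vector_derivative (-1) *\<^sub>R (bl (y (\<rho> t)) (- A (\<rho> (\<rho> t))) + - f (\<rho> (\<rho> t)))) (at t within {a..b})"
      by (rule vector_diff_chain_within[OF r])
    then show ?thesis by (simp add: \<rho>(2) minus_right o_def add.commute)
  qed
  moreover have "smooth_on {a..b} (\<lambda>t. y (\<rho> t))" by (rule smooth_rev[OF y(1)])
  moreover have "y (\<rho> b) = x1" using y(2) by (simp add: \<rho>_def)
  ultimately show ?thesis by blast
qed

text \<open>The derivatives along basis vectors are continuous, hence bounded on a compact ball
  inside \<open>S\<close>; convexity of the ball turns this into a Lipschitz bound.\<close>

lemma smooth_on_locally_lipschitz:
  fixes V :: "'a::finite_euclidean \<Rightarrow> 'b::real_normed_vector"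
  assumes S: "open S" "x0 \<in> S" and V: "smooth_on S V"
  shows "\<exists>r>0. \<exists>K>0. cball x0 r \<subseteq> S \<and> (\<forall>x\<in>cball x0 r. \<forall>y\<in>cball x0 r. norm (V x - V y) \<le> K * norm (x - y))"
proof -
  obtain r where r: "r > 0" "cball x0 r \<subseteq> S" using S open_contains_cball by blast
  define N where "N x = (\<Sum>b\<in>obasis. norm (frechet_derivative V (at x) b))" for x
  have "continuous_on (cball x0 r) N"
    unfolding N_def
    by (intro continuous_intros continuous_on_subset[OF _ r(2)]
        smooth_on_imp_continuous_on smooth_on_frechet_derivative[OF S(1) V])
  then have "bounded (N ` cball x0 r)"
    by (intro compact_imp_bounded compact_continuous_image compact_cball)
  then obtain K where K: "K > 0" "\<And>x. x \<in> cball x0 r \<Longrightarrow> norm (N x) \<le> K"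
    unfolding bounded_pos by auto
  have "norm (V x - V y) \<le> K * norm (x - y)" if xy: "x \<in> cball x0 r" "y \<in> cball x0 r" for x y
  proof (rule differentiable_bound[OF convex_cball _ _ xy])
    fix z assume z: "z \<in> cball x0 r"
    have D: "(V has_derivative frechet_derivative V (at z)) (at z)"
      by (rule smooth_on_has_derivative[OF S(1) V]) (use z r in blast)
    then show "(V has_derivative frechet_derivative V (at z)) (at z within cball x0 r)"
      by (rule has_derivative_at_withinI)
    show "onorm (frechet_derivative V (at z)) \<le> K"
    proof (rule onorm_bound)
      fix h
      have "norm (frechet_derivative V (at z) h) = norm (\<Sum>b\<in>obasis. inner h b *\<^sub>R frechet_derivative V (at z) b)"
        using linear_obasis_expansion[OF has_derivative_linear[OF D], of h] by simp
      also have "\<dots> \<le> (\<Sum>b\<in>obasis. norm (inner h b *\<^sub>R frechet_derivative V (at z) b))" by (rule norm_sum)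
      also have "\<dots> \<le> (\<Sum>b\<in>obasis. norm h * norm (frechet_derivative V (at z) b))"
        by (intro sum_mono) (auto intro!: mult_right_mono abs_inner_obasis_le)
      also have "\<dots> = norm h * N z" by (simp add: N_def sum_distrib_left)
      also have "\<dots> \<le> norm h * K" using K(2)[OF z] by (intro mult_left_mono) auto
      finally show "norm (frechet_derivative V (at z) h) \<le> K * norm h" by (simp add: mult.commute)
    qed (use K in simp)
  qed
  then show ?thesis using r K by blast
qed

text \<open>Composed with the nearest-point projection onto a closed ball, \<open>V\<close> becomes
  globally Lipschitz, so a solution exists up to time 1. While in the ball it solves the original
  equation, and \<open>\<delta>\<close> is a time up to which it stays there.\<close>

lemma local_flow:
  fixes V :: "'a::finite_euclidean \<Rightarrow> 'a"
  assumes S: "open S" "x0 \<in> S" and V: "smooth_on S V"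
  shows "\<exists>\<delta>>0. \<exists>x. x 0 = x0 \<and>
    (\<forall>t\<in>{0..\<delta>}. x t \<in> S \<and> (x has_vector_derivative V (x t)) (at t within {0..\<delta>}))"
proof -
  obtain r K where r: "r > 0" "cball x0 r \<subseteq> S" and K: "K > 0"
    and lip: "\<And>x y. x \<in> cball x0 r \<Longrightarrow> y \<in> cball x0 r \<Longrightarrow> norm (V x - V y) \<le> K * norm (x - y)"
    using smooth_on_locally_lipschitz[OF assms] by blast
  define \<rho> where "\<rho> = closest_point (cball x0 r)"
  have ne: "cball x0 r \<noteq> {}" using r by auto
  have \<rho>: "\<rho> x \<in> cball x0 r" "x \<in> cball x0 r \<Longrightarrow> \<rho> x = x" for x
    unfolding \<rho>_def using closest_point_in_set[OF closed_cball ne] closest_point_self by blast+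
  have "dist (\<rho> x) (\<rho> y) \<le> dist x y" for x y
    unfolding \<rho>_def by (rule closest_point_lipschitz[OF convex_cball closed_cball ne])
  then have lip': "norm (V (\<rho> x) - V (\<rho> y)) \<le> K * norm (x - y)" for x y
    using lip[OF \<rho>(1) \<rho>(1), of x y] K unfolding dist_norm
    by (meson less_imp_le mult_left_mono order_trans)
  have cont: "continuous_on UNIV (\<lambda>x. V (\<rho> x))"
  proof (rule continuous_on_compose2[of "cball x0 r" V UNIV \<rho>])
    show "continuous_on (cball x0 r) V"
      by (rule continuous_on_subset[OF smooth_on_imp_continuous_on[OF V] r(2)])
    show "continuous_on UNIV \<rho>" unfolding \<rho>_def
      by (rule continuous_on_closest_point[OF convex_cball closed_cball ne])
  qed (use \<rho> in auto)
  have "\<exists>x. x 0 = x0 \<and> (\<forall>t\<in>{0..1}. (x has_vector_derivative V (\<rho> (x t))) (at t within {0..1}))"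
    by (rule picard_existence[OF zero_le_one K lip' continuous_on_compose2[OF cont _ subset_UNIV]])
  then obtain x where x: "x 0 = x0"
    "\<And>t. t \<in> {0..1} \<Longrightarrow> (x has_vector_derivative V (\<rho> (x t))) (at t within {0..1})" by blast
  have "continuous_on {0..1} x"
    using x(2) has_vector_derivative_continuous unfolding continuous_on_eq_continuous_within by blast
  then have "continuous (at 0 within {0..1}) x" unfolding continuous_on_eq_continuous_within by simp
  then obtain d where d: "d > 0" "\<And>t. t \<in> {0..1} \<Longrightarrow> dist t 0 < d \<Longrightarrow> dist (x t) (x 0) < r"
    unfolding continuous_within_eps_delta using r(1) by blast
  define \<delta> where "\<delta> = min 1 (d / 2)"
  have \<delta>: "\<delta> > 0" "\<delta> \<le> 1" "\<delta> < d" using d by (auto simp: \<delta>_def)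
  have "x t \<in> S \<and> (x has_vector_derivative V (x t)) (at t within {0..\<delta>})" if t: "t \<in> {0..\<delta>}" for t
  proof -
    have "dist (x t) x0 < r" using d(2)[of t] t \<delta> x(1) by simp
    then have xt: "x t \<in> cball x0 r" by (simp add: dist_commute)
    have "(x has_vector_derivative V (\<rho> (x t))) (at t within {0..1})" using x(2)[of t] t \<delta> by simp
    then have "(x has_vector_derivative V (\<rho> (x t))) (at t within {0..\<delta>})"
      by (rule has_vector_derivative_within_subset) (use \<delta> in auto)
    then show ?thesis using xt \<rho>(2) r by auto
  qed
  then show ?thesis using \<delta> x(1) by blast
qed

section \<open>Linear constraint, multiplier and localisation by bump functions\<close>

section \<open>The variational argument in the Lie algebra\<close>

text \<open>Such a subspace is the graph of a linear map over its first projection. That map is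
  prescribed on a basis of the projection and then extended arbitrarily to the whole space.\<close>

lemma linear_functional_with_graph:
  fixes \<Gamma> :: "('a::finite_euclidean \<times> real) set"
  assumes \<Gamma>: "subspace \<Gamma>" and single: "\<And>s. (0, s) \<in> \<Gamma> \<Longrightarrow> s = 0"
  shows "\<exists>c :: 'a \<Rightarrow>\<^sub>L real. \<forall>(x, s)\<in>\<Gamma>. blinfun_apply c x = s"
proof -
  obtain C where C: "C \<subseteq> fst ` \<Gamma>" "independent C" "fst ` \<Gamma> \<subseteq> span C"
    using basis_exists[of "fst ` \<Gamma>"] by metis
  have "\<forall>x\<in>C. \<exists>s. (x, s) \<in> \<Gamma>" using C(1) by force
  then obtain f where f: "\<And>x. x \<in> C \<Longrightarrow> (x, f x) \<in> \<Gamma>" by metis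
  obtain g where g: "linear g" "\<And>x. x \<in> C \<Longrightarrow> g x = f x"
    using linear_independent_extend[OF C(2)] by metis
  have graph: "(x, g x) \<in> \<Gamma>" if "x \<in> span C" for x
    using that
  proof (induction rule: span_induct_alt)
    case base
    show ?case using subspace_0[OF \<Gamma>] linear_0[OF g(1)] by (simp add: zero_prod_def)
  next
    case (step c x y)
    have "c *\<^sub>R (x, g x) + (y, g y) \<in> \<Gamma>"
      using step f[of x] g(2)[of x] by (intro subspace_add[OF \<Gamma>] subspace_scale[OF \<Gamma>]) auto
    then show ?case by (simp add: linear_add[OF g(1)] linear_scale[OF g(1)])
  qed
  have "g x = s" if xs: "(x, s) \<in> \<Gamma>" for x s
  proof -
    have "x \<in> span C" using xs C(3) by force
    then have "(x, s) - (x, g x) \<in> \<Gamma>" by (intro subspace_diff[OF \<Gamma>] xs graph)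
    then show ?thesis using single[of "s - g x"] by simp
  qed
  moreover have "bounded_linear g" by (rule linear_imp_bounded_linear[OF g(1)])
  ultimately show ?thesis by (intro exI[of _ "Blinfun g"]) (auto simp: bounded_linear_Blinfun_apply)
qed

lemma smooth_on_integrable:
  fixes f :: "real \<Rightarrow> 'a::banach"
  shows "smooth_on {a..b} f \<Longrightarrow> f integrable_on {a..b}"
  by (rule integrable_continuous_real) (rule smooth_on_imp_continuous_on)

text \<open>The geometry enters only through \<open>R\<close>, the set of curvature terms of
  variations, which is asked to be closed under linear combinations. In the application
  \<open>B\<close> is the vertical bracket, and \<open>h\<close> and \<open>F\<close> are the two
  derivatives of the Lagrangian.\<close>

lemma multiplier_exists:
  fixes B :: "real \<Rightarrow> 'g::finite_euclidean \<Rightarrow>\<^sub>L 'g" and h F :: "real \<Rightarrow> 'g \<Rightarrow>\<^sub>L real"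
    and R :: "(real \<Rightarrow> 'g) set"
  assumes ab: "a < b" and B: "smooth_on {a..b} B" and h: "smooth_on {a..b} h" and F: "smooth_on {a..b} F"
    and R: "\<And>r. r \<in> R \<Longrightarrow> smooth_on {a..b} r"
    and R_0: "\<exists>r\<in>R. \<forall>t\<in>{a..b}. r t = 0"
    and R_lin: "\<And>c r r'. r \<in> R \<Longrightarrow> r' \<in> R \<Longrightarrow> \<exists>s\<in>R. \<forall>t\<in>{a..b}. s t = c *\<^sub>R r t + r' t"
    and N: "\<And>r \<beta>. r \<in> R \<Longrightarrow> smooth_on {a..b} \<beta> \<Longrightarrow> \<beta> a = 0 \<Longrightarrow> \<beta> b = 0 \<Longrightarrow>
      (\<And>t. t \<in> {a..b} \<Longrightarrow> (\<beta> has_vector_derivative - blinfun_apply (B t) (\<beta> t) - r t) (at t within {a..b})) \<Longrightarrow>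
      integral {a..b} (\<lambda>t. blinfun_apply (h t) (\<beta> t)) = integral {a..b} (\<lambda>t. blinfun_apply (F t) (r t))"
  shows "\<exists>p. smooth_on {a..b} p \<and>
    (\<forall>t\<in>{a..b}. (p has_vector_derivative h t + (p t o\<^sub>L B t)) (at t within {a..b})) \<and>
    (\<forall>r\<in>R. integral {a..b} (\<lambda>t. blinfun_apply (F t - p t) (r t)) = 0)"
proof -
  define I where "I = {a..b}"
  define sol where "sol r \<beta> \<longleftrightarrow> smooth_on I \<beta> \<and> \<beta> a = 0 \<and>
    (\<forall>t\<in>I. (\<beta> has_vector_derivative - blinfun_apply (B t) (\<beta> t) - r t) (at t within I))" for r \<beta>
  define d where "d r \<beta> = integral I (\<lambda>t. blinfun_apply (h t) (\<beta> t)) - integral I (\<lambda>t. blinfun_apply (F t) (r t))" for r \<beta>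
  \<comment> \<open>Pairs of an end value and the corresponding defect in (N). That end value zero
    forces defect zero is precisely the hypothesis \<open>N\<close>.\<close>
  define \<Gamma> where "\<Gamma> = {(\<beta> b, d r \<beta>) | r \<beta>. r \<in> R \<and> sol r \<beta>}"
  have int_h: "(\<lambda>t. blinfun_apply (h t) (\<beta> t)) integrable_on I" if "smooth_on I \<beta>" for \<beta>
    unfolding I_def by (intro smooth_on_integrable smooth_on_blinfun_apply h that[unfolded I_def])
  have int_F: "(\<lambda>t. blinfun_apply (F t) (r t)) integrable_on I" if "r \<in> R" for r
    unfolding I_def by (intro smooth_on_integrable smooth_on_blinfun_apply F R that)
  have "subspace \<Gamma>"
  proof -
    obtain r0 where r0: "r0 \<in> R" "\<And>t. t \<in> I \<Longrightarrow> r0 t = 0" using R_0 unfolding I_def by blast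
    have "integral I (\<lambda>t. blinfun_apply (F t) (r0 t)) = integral I (\<lambda>t. 0)"
      by (rule integral_cong) (simp add: r0)
    then have "d r0 (\<lambda>t. 0) = 0" unfolding d_def by simp
    moreover have "sol r0 (\<lambda>t. 0)" unfolding sol_def by (auto simp: r0)
    ultimately have 0: "0 \<in> \<Gamma>" unfolding \<Gamma>_def using r0(1) by (force simp: zero_prod_def)
    have lin: "c *\<^sub>R x + y \<in> \<Gamma>" if xy: "x \<in> \<Gamma>" "y \<in> \<Gamma>" for c x y
    proof -
      obtain r \<beta> where r: "x = (\<beta> b, d r \<beta>)" "r \<in> R" "sol r \<beta>" using xy(1) unfolding \<Gamma>_def by blast
      obtain r' \<beta>' where r': "y = (\<beta>' b, d r' \<beta>')" "r' \<in> R" "sol r' \<beta>'" using xy(2) unfolding \<Gamma>_def by blast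
      obtain s where s: "s \<in> R" "\<And>t. t \<in> I \<Longrightarrow> s t = c *\<^sub>R r t + r' t" using R_lin[OF r(2) r'(2)] unfolding I_def by blast
      let ?\<beta> = "\<lambda>t. c *\<^sub>R \<beta> t + \<beta>' t"
      have sb: "smooth_on I \<beta>" "smooth_on I \<beta>'" using r(3) r'(3) by (auto simp: sol_def)
      have "sol s ?\<beta>" unfolding sol_def
      proof (intro conjI ballI)
        show "smooth_on I ?\<beta>"
          by (intro smooth_on_add smooth_on_bounded_linear_comp[OF bounded_linear_scaleR_right] sb)
        show "c *\<^sub>R \<beta> a + \<beta>' a = 0" using r(3) r'(3) by (simp add: sol_def)
        fix t assume t: "t \<in> I"
        have "(?\<beta> has_vector_derivative c *\<^sub>R (- blinfun_apply (B t) (\<beta> t) - r t) + (- blinfun_apply (B t) (\<beta>' t) - r' t)) (at t within I)"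
          using r(3) r'(3) t unfolding sol_def
          by (intro has_vector_derivative_add bounded_linear.has_vector_derivative[OF bounded_linear_scaleR_right]) auto
        then show "(?\<beta> has_vector_derivative - blinfun_apply (B t) (c *\<^sub>R \<beta> t + \<beta>' t) - s t) (at t within I)"
          by (simp add: s(2)[OF t] blinfun.add_right blinfun.scaleR_right algebra_simps)
      qed
      moreover have "d s ?\<beta> = c * d r \<beta> + d r' \<beta>'"
      proof -
        have "integral I (\<lambda>t. blinfun_apply (h t) (?\<beta> t)) =
            integral I (\<lambda>t. c *\<^sub>R blinfun_apply (h t) (\<beta> t) + blinfun_apply (h t) (\<beta>' t))"
          by (simp add: blinfun.add_right blinfun.scaleR_right)
        also have "\<dots> = c * integral I (\<lambda>t. blinfun_apply (h t) (\<beta> t)) + integral I (\<lambda>t. blinfun_apply (h t) (\<beta>' t))"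
          by (subst integral_add, rule integrable_cmul, rule int_h, rule sb, rule int_h, rule sb, simp)
        finally have 1: "integral I (\<lambda>t. blinfun_apply (h t) (?\<beta> t)) = \<dots>" .
        have "integral I (\<lambda>t. blinfun_apply (F t) (s t)) =
            integral I (\<lambda>t. c *\<^sub>R blinfun_apply (F t) (r t) + blinfun_apply (F t) (r' t))"
          by (rule integral_cong) (simp add: s blinfun.add_right blinfun.scaleR_right)
        also have "\<dots> = c * integral I (\<lambda>t. blinfun_apply (F t) (r t)) + integral I (\<lambda>t. blinfun_apply (F t) (r' t))"
          by (subst integral_add, rule integrable_cmul, rule int_F, rule r, rule int_F, rule r', simp)
        finally show ?thesis unfolding d_def 1 by (simp add: algebra_simps)
      qed
      moreover have "c *\<^sub>R x + y = (?\<beta> b, c * d r \<beta> + d r' \<beta>')" by (simp add: r r')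
      ultimately show ?thesis unfolding \<Gamma>_def using s(1) by force
    qed
    show ?thesis
    proof (rule subspaceI)
      show "x + y \<in> \<Gamma>" if "x \<in> \<Gamma>" "y \<in> \<Gamma>" for x y using lin[OF that, of 1] by simp
      show "c *\<^sub>R x \<in> \<Gamma>" if "x \<in> \<Gamma>" for c x using lin[OF that 0, of c] by simp
    qed (rule 0)
  qed
  moreover have "s = 0" if s: "(0, s) \<in> \<Gamma>" for s
  proof -
    obtain r \<beta> where r: "\<beta> b = 0" "s = d r \<beta>" "r \<in> R" "sol r \<beta>"
      using s unfolding \<Gamma>_def by auto
    show ?thesis using N[OF r(3), of \<beta>] r unfolding sol_def d_def I_def by auto
  qed
  ultimately have "\<exists>c :: 'g \<Rightarrow>\<^sub>L real. \<forall>(x, s)\<in>\<Gamma>. blinfun_apply c x = s"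
    by (rule linear_functional_with_graph)
  then obtain c :: "'g \<Rightarrow>\<^sub>L real" where c0: "\<forall>(x, s)\<in>\<Gamma>. blinfun_apply c x = s" by blast
  have c: "blinfun_apply c x = s" if "(x, s) \<in> \<Gamma>" for x s
    using bspec[OF c0 that] by simp
  obtain p where p: "smooth_on I p" "p b = c"
    "\<And>t. t \<in> I \<Longrightarrow> (p has_vector_derivative (p t o\<^sub>L B t) + h t) (at t within I)"
    using linear_ode_smooth_solution_terminal[OF bounded_bilinear_blinfun_compose ab B h] unfolding I_def by blast
  have "integral I (\<lambda>t. blinfun_apply (F t - p t) (r t)) = 0" if r: "r \<in> R" for r
  proof -
    \<comment> \<open>The existence lemma expects the unknown as the first argument of the bilinear
      map.\<close>
    have fl: "bounded_bilinear (\<lambda>x A. blinfun_apply (A :: 'g \<Rightarrow>\<^sub>L 'g) x)"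
      by (rule bounded_bilinear.flip[OF bounded_bilinear_blinfun_apply])
    obtain \<beta> where \<beta>: "smooth_on I \<beta>" "\<beta> a = 0"
      "\<And>t. t \<in> I \<Longrightarrow> (\<beta> has_vector_derivative blinfun_apply (- B t) (\<beta> t) + - r t) (at t within I)"
      using linear_ode_smooth_solution[OF fl ab smooth_on_minus[OF B] smooth_on_minus[OF R[OF r]]]
      unfolding I_def by blast
    have "sol r \<beta>" unfolding sol_def using \<beta> by (simp add: blinfun.minus_left)
    then have cb: "blinfun_apply c (\<beta> b) = d r \<beta>" using c r unfolding \<Gamma>_def by blast
    have "((\<lambda>t. blinfun_apply (p t) (\<beta> t)) has_vector_derivative
        blinfun_apply (h t) (\<beta> t) - blinfun_apply (p t) (r t)) (at t within I)" if t: "t \<in> I" for t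
    proof -
      have "((\<lambda>t. blinfun_apply (p t) (\<beta> t)) has_vector_derivative
          blinfun_apply (p t) (blinfun_apply (- B t) (\<beta> t) + - r t) +
          blinfun_apply ((p t o\<^sub>L B t) + h t) (\<beta> t)) (at t within I)"
        by (rule bounded_bilinear.has_vector_derivative[OF bounded_bilinear_blinfun_apply p(3)[OF t] \<beta>(3)[OF t]])
      then show ?thesis
        by (simp add: blinfun.add_left blinfun.add_right blinfun.minus_left blinfun.minus_right blinfun.diff_right)
    qed
    \<comment> \<open>At \<open>a\<close> the boundary term vanishes because of
      \<open>\<beta> a = 0\<close>; at \<open>b\<close> it is \<open>c\<close> applied to
      \<open>\<beta> b\<close>, which is the defect by the choice of \<open>c\<close>.\<close>
    then have "((\<lambda>t. blinfun_apply (h t) (\<beta> t) - blinfun_apply (p t) (r t)) has_integral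
        blinfun_apply (p b) (\<beta> b) - blinfun_apply (p a) (\<beta> a)) {a..b}"
      using ab unfolding I_def by (intro fundamental_theorem_of_calculus) auto
    then have *: "((\<lambda>t. blinfun_apply (h t) (\<beta> t) - blinfun_apply (p t) (r t)) has_integral d r \<beta>) I"
      using cb p(2) \<beta>(2) unfolding I_def by simp
    have int_p: "(\<lambda>t. blinfun_apply (p t) (r t)) integrable_on I"
      using p(1) R[OF r] unfolding I_def by (intro smooth_on_integrable smooth_on_blinfun_apply)
    have "d r \<beta> = integral I (\<lambda>t. blinfun_apply (h t) (\<beta> t)) - integral I (\<lambda>t. blinfun_apply (p t) (r t))"
      using integral_unique[OF *] integral_diff[OF int_h[OF \<beta>(1)] int_p] by simp
    then have "integral I (\<lambda>t. blinfun_apply (F t) (r t)) = integral I (\<lambda>t. blinfun_apply (p t) (r t))"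
      unfolding d_def by simp
    then show ?thesis
      unfolding blinfun.diff_left using integral_diff[OF int_F[OF r] int_p] by simp
  qed
  moreover have "(p has_vector_derivative h t + (p t o\<^sub>L B t)) (at t within I)" if "t \<in> I" for t
    using p(3)[OF that] by (simp add: add.commute)
  ultimately show ?thesis using p(1) unfolding I_def by blast
qed

text \<open>No integrability of \<open>h\<close> and \<open>g\<close> is needed, as their difference has integral zero
  and the integral of a non-integrable function is zero by convention.\<close>

lemma integral_eq_of_multiplier:
  fixes p :: "real \<Rightarrow> 'a::real_normed_vector \<Rightarrow>\<^sub>L real"
  assumes ab: "a \<le> b"
    and p: "\<And>t. t \<in> {a..b} \<Longrightarrow> (p has_vector_derivative p' t) (at t within {a..b})"
    and \<beta>: "\<And>t. t \<in> {a..b} \<Longrightarrow> (\<beta> has_vector_derivative \<beta>' t) (at t within {a..b})"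
    and ends: "\<beta> a = 0" "\<beta> b = 0"
    and h: "\<And>t. t \<in> {a..b} \<Longrightarrow> h t = blinfun_apply (p' t) (\<beta> t) + blinfun_apply (p t) (\<beta>' t) + g t"
  shows "integral {a..b} h = integral {a..b} g"
proof -
  define \<phi> where "\<phi> t = blinfun_apply (p' t) (\<beta> t) + blinfun_apply (p t) (\<beta>' t)" for t
  have "((\<lambda>t. blinfun_apply (p t) (\<beta> t)) has_vector_derivative \<phi> t) (at t within {a..b})" if "t \<in> {a..b}" for t
    using bounded_bilinear.has_vector_derivative[OF bounded_bilinear_blinfun_apply p[OF that] \<beta>[OF that]]
    by (simp add: \<phi>_def add.commute)
  from fundamental_theorem_of_calculus[OF ab this]
  have \<phi>: "(\<phi> has_integral 0) {a..b}" by (simp add: ends)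
  have "integral {a..b} h = integral {a..b} (\<lambda>t. \<phi> t + g t)"
    by (rule integral_cong) (simp add: h \<phi>_def)
  also have "\<dots> = integral {a..b} g"
  proof (cases "g integrable_on {a..b}")
    case True
    then show ?thesis
      using integral_add[OF has_integral_integrable[OF \<phi>] True] integral_unique[OF \<phi>] by simp
  next
    case False
    have "\<not> (\<lambda>t. \<phi> t + g t) integrable_on {a..b}"
    proof
      assume "(\<lambda>t. \<phi> t + g t) integrable_on {a..b}"
      from integrable_diff[OF this has_integral_integrable[OF \<phi>]] show False using False by simp
    qed
    then show ?thesis using False by (simp add: not_integrable_integral)
  qed
  finally show ?thesis .
qed

text \<open>If \<open>f\<close> were positive at \<open>s\<close>, then on a small closed ball the
  integrand would be nonnegative with integral zero, hence zero even at the centre, where the bump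
  equals 1. The conclusion is one-sided so that it can be applied to \<open>f\<close> and
  \<open>- f\<close>.\<close>

lemma zero_of_bump_integrals_interior:
  fixes f :: "real \<Rightarrow> real"
  assumes U: "open U" "U \<subseteq> {a..b}" and f: "continuous_on U f" and s: "s \<in> U"
    and zero: "\<And>s r. r > 0 \<Longrightarrow> cball s r \<subseteq> U \<Longrightarrow> integral {a..b} (\<lambda>t. bump s r t * f t) = 0"
  shows "f s \<le> 0"
proof (rule ccontr)
  assume "\<not> f s \<le> 0"
  then have fs: "f s > 0" by simp
  have "isCont f s" using f U(1) s by (simp add: continuous_on_eq_continuous_at)
  then obtain e1 where e1: "e1 > 0" "\<And>t. dist t s < e1 \<Longrightarrow> dist (f t) (f s) < f s"
    using fs unfolding continuous_at_eps_delta by blast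
  obtain e2 where e2: "e2 > 0" "ball s e2 \<subseteq> U" using U(1) s openE by blast
  define e where "e = min e1 e2"
  have e: "e > 0" "\<And>t. dist t s < e \<Longrightarrow> f t > 0 \<and> t \<in> U"
    using e1 e2 by (force simp: e_def dist_commute dist_real_def)+
  define r where "r = e / 2"
  have r: "r > 0" "\<And>t. t \<in> cball s r \<Longrightarrow> f t > 0 \<and> t \<in> U"
    using e by (auto simp: r_def dist_commute)
  have cb: "cball s r = {s - r..s + r}" "cball s r = cbox (s - r) (s + r)" by (simp_all add: cball_eq_atLeastAtMost)
  define g where "g t = bump s r t * f t" for t
  have cont: "continuous_on (cball s r) g"
    unfolding g_def
    by (intro continuous_intros smooth_on_imp_continuous_on[OF smooth_on_bump] continuous_on_subset[OF f]) (use r in auto)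
  have i: "(g has_integral integral (cball s r) g) (cball s r)"
    using cont unfolding cb(1) by (intro integrable_integral integrable_continuous_real)
  have "(g has_integral integral (cball s r) g) {a..b}"
  proof (rule has_integral_on_superset[OF i])
    show "g t = 0" if "t \<notin> cball s r" for t
      using that r(1) by (simp add: g_def bump_eq_0 dist_norm norm_minus_commute)
    show "cball s r \<subseteq> {a..b}" using r(2) U(2) by blast
  qed
  moreover have "integral {a..b} g = 0"
    unfolding g_def by (rule zero) (use r in auto)
  ultimately have "integral (cball s r) g = 0" using integral_unique by metis
  with i have "(g has_integral 0) (cball s r)" by simp
  moreover have "g t \<ge> 0" if "t \<in> cball s r" for t
    using r(2)[OF that] bump_nonneg[of s r t] by (simp add: g_def)
  ultimately have "g s = 0"
    using cont r(1) unfolding cb(2)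
    by (intro has_integral_0_cbox_imp_0[of "s - r" "s + r" g s]) (auto simp: box_real)
  then show False using fs r(1) by (simp add: g_def bump_center)
qed

text \<open>Only bumps supported in the open interval are available, because variations vanish at
  the end-points. They give zero in the interior, and continuity extends this to the
  end-points.\<close>

lemma zero_of_bump_integrals:
  fixes f :: "real \<Rightarrow> real"
  assumes ab: "a < b" and W: "open W" and f: "continuous_on ({a..b} \<inter> W) f" and t: "t \<in> {a..b} \<inter> W"
    and zero: "\<And>s r. r > 0 \<Longrightarrow> cball s r \<subseteq> {a<..<b} \<inter> W \<Longrightarrow> integral {a..b} (\<lambda>t. bump s r t * f t) = 0"
  shows "f t = 0"
proof (rule ccontr)
  assume ne: "f t \<noteq> 0"
  define U where "U = {a<..<b} \<inter> W"
  have U: "open U" "U \<subseteq> {a..b}" "U \<subseteq> {a..b} \<inter> W" using W by (auto simp: U_def)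
  have fU: "continuous_on U f" by (rule continuous_on_subset[OF f U(3)])
  have 0: "f s = 0" if "s \<in> U" for s
  proof (rule antisym)
    show "f s \<le> 0"
      by (rule zero_of_bump_integrals_interior[OF U(1,2) fU that]) (rule zero, auto simp: U_def)
    have "- f s \<le> 0"
    proof (rule zero_of_bump_integrals_interior[OF U(1,2) _ that, of "\<lambda>t. - f t"])
      show "continuous_on U (\<lambda>t. - f t)" by (intro continuous_intros fU)
      show "integral {a..b} (\<lambda>t. bump s r t * - f t) = 0" if "r > 0" "cball s r \<subseteq> U" for s r
        using zero[of r s] that unfolding U_def by simp
    qed
    then show "0 \<le> f s" by simp
  qed
  have "continuous (at t within {a..b} \<inter> W) f"
    using f t by (simp add: continuous_on_eq_continuous_within)
  then have ct: "continuous (at t within {a..b}) f"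
    using at_within_nhd[of t W "{a..b}" "{a..b} \<inter> W"] W t by simp
  obtain d where d: "d > 0" "\<And>s. s \<in> {a..b} \<Longrightarrow> dist s t < d \<Longrightarrow> dist (f s) (f t) < \<bar>f t\<bar>"
    using ct ne unfolding continuous_within_eps_delta by (meson zero_less_abs_iff)
  obtain e where e: "e > 0" "ball t e \<subseteq> W" using W t openE by blast
  \<comment> \<open>A third of the minimum gives \<open>m < d\<close> and \<open>m < e\<close>,
    while \<open>2 * m < b - a\<close> ensures that \<open>t + m\<close> or \<open>t - m\<close>
    lies in the open interval.\<close>
  define m where "m = min (min d e) (b - a) / 3"
  have "0 < min (min d e) (b - a)" "min (min d e) (b - a) \<le> d" "min (min d e) (b - a) \<le> e"
    "min (min d e) (b - a) \<le> b - a" using d e ab by auto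
  then have m: "m > 0" "m < d" "m < e" "2 * m < b - a" unfolding m_def by linarith+
  define s where "s = (if t + m < b then t + m else t - m)"
  have "s \<in> {a<..<b}" "dist s t = m" using t m ab by (auto simp: s_def dist_real_def)
  then have "s \<in> U" "dist s t < d" "s \<in> {a..b}" using e m by (auto simp: U_def dist_commute)
  then show False using d(2)[of s] 0[of s] by (simp add: dist_real_def)
qed

section \<open>Tangent maps and velocities in arbitrary charts\<close>

section \<open>Derivatives in charts\<close>

text \<open>Only what concerns a single chart is kept, so that product charts qualify without
  \<open>prod_atlas\<close> being shown to be a smooth atlas.\<close>

definition chart_ok :: "('p::topological_space, 'e::real_normed_vector) chart \<Rightarrow> bool" where
  "chart_ok c \<longleftrightarrow> open (fst c) \<and> open (snd c ` fst c) \<and>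
     homeomorphism (fst c) (snd c ` fst c) (snd c) (chart_inv c)"

lemma smooth_atlas_chart_ok: "smooth_atlas A \<Longrightarrow> c \<in> A \<Longrightarrow> chart_ok c"
  by (simp add: smooth_atlas_def chart_ok_def)

lemma chart_at_in:
  assumes "smooth_atlas A"
  shows "chart_at A p \<in> A" "p \<in> fst (chart_at A p)"
proof -
  have "\<exists>c. c \<in> A \<and> p \<in> fst c" using assms unfolding smooth_atlas_def by blast
  from someI_ex[OF this] show "chart_at A p \<in> A" "p \<in> fst (chart_at A p)"
    unfolding chart_at_def by auto
qed

lemma chart_inv_chart: "chart_ok c \<Longrightarrow> p \<in> fst c \<Longrightarrow> chart_inv c (snd c p) = p"
  by (simp add: chart_ok_def homeomorphism_def)

lemma chart_chart_inv: "chart_ok c \<Longrightarrow> x \<in> snd c ` fst c \<Longrightarrow> snd c (chart_inv c x) = x"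
  by (auto simp: chart_ok_def homeomorphism_def)

lemma chart_inv_in: "chart_ok c \<Longrightarrow> x \<in> snd c ` fst c \<Longrightarrow> chart_inv c x \<in> fst c"
  by (auto simp: chart_inv_chart)

lemma open_chart_image:
  assumes "chart_ok c" "open U"
  shows "open (snd c ` (U \<inter> fst c))"
proof -
  have "openin (top_of_set (fst c)) (U \<inter> fst c)"
    using assms(2) by (metis inf_commute openin_open_Int)
  then have "openin (top_of_set (snd c ` fst c)) (snd c ` (U \<inter> fst c))"
    using assms(1) homeomorphism_imp_open_map unfolding chart_ok_def by blast
  then show ?thesis using assms(1) unfolding chart_ok_def by (metis openin_open_trans)
qed

lemma isCont_chart:
  fixes c :: "('p::t2_space, 'e::real_normed_vector) chart"
  shows "chart_ok c \<Longrightarrow> p \<in> fst c \<Longrightarrow> isCont (snd c) p"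
  unfolding chart_ok_def homeomorphism_def by (metis continuous_on_eq_continuous_at)

lemma isCont_chart_inv:
  fixes c :: "('p::t2_space, 'e::real_normed_vector) chart"
  shows "chart_ok c \<Longrightarrow> p \<in> fst c \<Longrightarrow> isCont (chart_inv c) (snd c p)"
  unfolding chart_ok_def homeomorphism_def by (metis continuous_on_eq_continuous_at imageI)

text \<open>Continuity of \<open>f\<close> at \<open>p\<close> is part of the notion: outside its
  domain a chart map is an arbitrary function, so differentiability of the coordinate expression
  alone would not keep \<open>f\<close> inside \<open>fst d\<close>, which the chain rule
  needs.\<close>

definition has_mder ::
  "('p::t2_space \<Rightarrow> 'q::topological_space) \<Rightarrow> ('p, 'e::real_normed_vector) chart \<Rightarrow>
   ('q, 'f::real_normed_vector) chart \<Rightarrow> 'p \<Rightarrow> ('e \<Rightarrow> 'f) \<Rightarrow> bool" where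
  "has_mder f c d p F \<longleftrightarrow> p \<in> fst c \<and> f p \<in> fst d \<and> isCont f p \<and>
     ((snd d \<circ> f \<circ> chart_inv c) has_derivative F) (at (snd c p))"

definition mder ::
  "('p \<Rightarrow> 'q) \<Rightarrow> ('p, 'e::real_normed_vector) chart \<Rightarrow>
   ('q, 'f::real_normed_vector) chart \<Rightarrow> 'p \<Rightarrow> 'e \<Rightarrow> 'f" where
  "mder f c d p = frechet_derivative (snd d \<circ> f \<circ> chart_inv c) (at (snd c p))"

lemma has_mder_unique: "has_mder f c d p F \<Longrightarrow> has_mder f c d p G \<Longrightarrow> F = G"
  unfolding has_mder_def using has_derivative_unique by blast

lemma has_mder_eq_mder: "has_mder f c d p F \<Longrightarrow> mder f c d p = F"
  unfolding has_mder_def mder_def using frechet_derivative_at by metis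

lemma has_mder_linear: "has_mder f c d p F \<Longrightarrow> linear F"
  unfolding has_mder_def using has_derivative_linear by blast

lemma has_mder_chain:
  assumes c: "chart_ok c" and d: "chart_ok d"
    and f: "has_mder f c d p F" and g: "has_mder g d e (f p) G"
  shows "has_mder (\<lambda>x. g (f x)) c e p (\<lambda>v. G (F v))"
proof -
  have p: "p \<in> fst c" "f p \<in> fst d" "isCont f p" "isCont g (f p)"
    using f g by (auto simp: has_mder_def)
  have inv: "chart_inv c (snd c p) = p" "chart_inv d (snd d (f p)) = f p"
    using p c d chart_inv_chart by blast+
  have "((snd e \<circ> g \<circ> chart_inv d) \<circ> (snd d \<circ> f \<circ> chart_inv c) has_derivative G \<circ> F) (at (snd c p))"
    using f g inv unfolding has_mder_def by (intro diff_chain_at) auto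
  moreover have "eventually (\<lambda>x. ((snd e \<circ> g \<circ> chart_inv d) \<circ> (snd d \<circ> f \<circ> chart_inv c)) x =
      (snd e \<circ> (\<lambda>x. g (f x)) \<circ> chart_inv c) x) (at (snd c p))"
  proof -
    have "isCont (\<lambda>x. f (chart_inv c x)) (snd c p)"
      using isCont_o2[OF isCont_chart_inv[OF c p(1)], of f] p inv by simp
    then have "((\<lambda>x. f (chart_inv c x)) \<longlongrightarrow> f p) (at (snd c p))"
      unfolding isCont_def inv .
    then have "eventually (\<lambda>x. f (chart_inv c x) \<in> fst d) (at (snd c p))"
      by (rule topological_tendstoD) (use d p in \<open>auto simp: chart_ok_def\<close>)
    then show ?thesis by eventually_elim (simp add: chart_inv_chart[OF d])
  qed
  ultimately have "(snd e \<circ> (\<lambda>x. g (f x)) \<circ> chart_inv c has_derivative G \<circ> F) (at (snd c p))"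
    by (rule has_derivative_transform_eventually) (simp_all add: inv)
  moreover have "isCont (\<lambda>x. g (f x)) p" using isCont_o2[OF p(3,4)] .
  ultimately show ?thesis using f g unfolding has_mder_def by (simp add: o_def)
qed

lemma has_mder_cong:
  assumes c: "chart_ok c" and f: "has_mder f c d p F"
    and U: "open U" "p \<in> U" "\<And>x. x \<in> U \<Longrightarrow> f x = g x"
  shows "has_mder g c d p F"
proof -
  have p: "p \<in> fst c" "isCont f p" using f by (auto simp: has_mder_def)
  have inv: "chart_inv c (snd c p) = p" using p c chart_inv_chart by blast
  have "((chart_inv c) \<longlongrightarrow> p) (at (snd c p))"
    using isCont_chart_inv[OF c p(1)] unfolding isCont_def inv .
  then have "eventually (\<lambda>x. chart_inv c x \<in> U) (at (snd c p))"
    by (rule topological_tendstoD) (use U in auto)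
  then have ev: "eventually (\<lambda>x. (snd d \<circ> f \<circ> chart_inv c) x = (snd d \<circ> g \<circ> chart_inv c) x) (at (snd c p))"
    by eventually_elim (simp add: U)
  have "(snd d \<circ> f \<circ> chart_inv c has_derivative F) (at (snd c p))"
    using f by (simp add: has_mder_def)
  then have "(snd d \<circ> g \<circ> chart_inv c has_derivative F) (at (snd c p))"
    by (rule has_derivative_transform_eventually[OF _ ev]) (simp_all add: inv U)
  moreover have "isCont g p"
  proof -
    have "eventually (\<lambda>x. f x = g x) (nhds p)"
      using U eventually_nhds by blast
    from isCont_cong[OF this] p(2) show ?thesis by simp
  qed
  ultimately show ?thesis using f U unfolding has_mder_def by auto
qed

lemma open_preimage_chart:
  fixes f :: "'p::t2_space \<Rightarrow> 'q::topological_space"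
  assumes "smooth_map_on A B S f" "open S" "chart_ok c" "chart_ok d"
  shows "open (S \<inter> fst c \<inter> f -` fst d)" "open (snd c ` (S \<inter> fst c \<inter> f -` fst d))"
proof -
  have 1: "open (S \<inter> f -` fst d)"
    using assms continuous_open_preimage[of S f "fst d"] by (auto simp: smooth_map_on_def chart_ok_def)
  have eq: "S \<inter> fst c \<inter> f -` fst d = (S \<inter> f -` fst d) \<inter> fst c" by blast
  show "open (S \<inter> fst c \<inter> f -` fst d)" unfolding eq using 1 assms(3) by (auto simp: chart_ok_def)
  show "open (snd c ` (S \<inter> fst c \<inter> f -` fst d))" unfolding eq by (rule open_chart_image[OF assms(3) 1])
qed

lemma smooth_map_on_has_mder:
  fixes f :: "'p::t2_space \<Rightarrow> 'q::topological_space"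
  assumes f: "smooth_map_on A B S f" and S: "open S" and ok: "chart_ok c" "chart_ok d"
    and cd: "c \<in> A" "d \<in> B" and p: "p \<in> S" "p \<in> fst c" "f p \<in> fst d"
  shows "has_mder f c d p (mder f c d p)"
proof -
  have "isCont f p" using f S p unfolding smooth_map_on_def by (metis continuous_on_eq_continuous_at)
  moreover have "smooth_on (snd c ` (S \<inter> fst c \<inter> f -` fst d)) (snd d \<circ> f \<circ> chart_inv c)"
    using f cd unfolding smooth_map_on_def by blast
  then have "(snd d \<circ> f \<circ> chart_inv c has_derivative mder f c d p) (at (snd c p))"
    unfolding mder_def
    by (rule smooth_on_has_derivative[OF open_preimage_chart(2)[OF f S ok]]) (use p in auto)
  ultimately show ?thesis using p unfolding has_mder_def by simp
qed

lemma smooth_on_mder: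
  fixes f :: "'p::t2_space \<Rightarrow> 'q::topological_space"
  assumes f: "smooth_map_on A B S f" and S: "open S" and ok: "chart_ok c" "chart_ok d"
    and cd: "c \<in> A" "d \<in> B"
  shows "smooth_on (snd c ` (S \<inter> fst c \<inter> f -` fst d)) (\<lambda>x. mder f c d (chart_inv c x) v)"
proof (rule smooth_on_eqI)
  have "smooth_on (snd c ` (S \<inter> fst c \<inter> f -` fst d)) (snd d \<circ> f \<circ> chart_inv c)"
    using f cd unfolding smooth_map_on_def by blast
  then show "smooth_on (snd c ` (S \<inter> fst c \<inter> f -` fst d))
      (\<lambda>x. frechet_derivative (snd d \<circ> f \<circ> chart_inv c) (at x) v)"
    by (rule smooth_on_frechet_derivative[OF open_preimage_chart(2)[OF f S ok]])
  show "frechet_derivative (snd d \<circ> f \<circ> chart_inv c) (at x) v = mder f c d (chart_inv c x) v"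
    if "x \<in> snd c ` (S \<inter> fst c \<inter> f -` fst d)" for x
    unfolding mder_def using chart_chart_inv[OF ok(1), of x] that by fastforce
qed

lemma has_mder_ident:
  assumes "chart_ok c" "p \<in> fst c"
  shows "has_mder (\<lambda>x. x) c c p (\<lambda>v. v)"
proof -
  have "((\<lambda>x. x) has_derivative (\<lambda>v. v)) (at (snd c p))" by (rule has_derivative_ident)
  then have "(snd c \<circ> (\<lambda>p. p) \<circ> chart_inv c has_derivative (\<lambda>v. v)) (at (snd c p))"
    by (rule has_derivative_transform_within_open[of _ _ _ _ "snd c ` fst c"])
      (use assms in \<open>auto simp: chart_ok_def chart_chart_inv[OF assms(1)]\<close>)
  then show ?thesis using assms unfolding has_mder_def by simp
qed

subsection \<open>Coordinate changes\<close>

text \<open>Coordinate changes of tangent vectors are derivatives of the identity map, so the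
  cocycle rule becomes an instance of the chain rule.\<close>

abbreviation ctrans :: "('p, 'e::real_normed_vector) chart \<Rightarrow> ('p, 'e) chart \<Rightarrow> 'p \<Rightarrow> 'e \<Rightarrow> 'e" where
  "ctrans \<equiv> mder (\<lambda>p. p)"

lemma smooth_atlas_ident:
  assumes "smooth_atlas A"
  shows "smooth_map_on A A UNIV (\<lambda>p. p)"
  using assms unfolding smooth_map_on_def smooth_atlas_def
  by (auto simp: o_def Int_def vimage_def)

lemma coords_in_eq: "coords_in A c p = ctrans (chart_at A p) c p"
  by (simp add: coords_in_def mder_def o_def)

lemma from_coords_eq: "from_coords A c p = ctrans c (chart_at A p) p"
  by (simp add: from_coords_def mder_def o_def)

lemma tangent_map_eq: "tangent_map A B f p = mder f (chart_at A p) (chart_at B (f p)) p"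
  by (simp add: tangent_map_def mder_def)

context
  fixes A :: "('p::{t2_space,second_countable_topology}, 'e::finite_euclidean) chart set"
  assumes A: "smooth_atlas A"
begin

lemma has_mder_ctrans: "c \<in> A \<Longrightarrow> d \<in> A \<Longrightarrow> p \<in> fst c \<Longrightarrow> p \<in> fst d \<Longrightarrow> has_mder (\<lambda>p. p) c d p (ctrans c d p)"
  by (rule smooth_map_on_has_mder[OF smooth_atlas_ident[OF A]]) (auto intro: smooth_atlas_chart_ok[OF A])

lemma ctrans_ctrans:
  assumes "c \<in> A" "d \<in> A" "e \<in> A" "p \<in> fst c" "p \<in> fst d" "p \<in> fst e"
  shows "ctrans d e p (ctrans c d p v) = ctrans c e p v"
proof -
  have "has_mder (\<lambda>p. p) c e p (\<lambda>v. ctrans d e p (ctrans c d p v))"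
    by (rule has_mder_chain[OF smooth_atlas_chart_ok[OF A assms(1)] smooth_atlas_chart_ok[OF A assms(2)]];
        rule has_mder_ctrans) (use assms in auto)
  from has_mder_eq_mder[OF this] show ?thesis by simp
qed

lemma ctrans_self: "c \<in> A \<Longrightarrow> p \<in> fst c \<Longrightarrow> ctrans c c p v = v"
  using has_mder_eq_mder[OF has_mder_ident[OF smooth_atlas_chart_ok[OF A]]] by metis

lemma linear_ctrans: "c \<in> A \<Longrightarrow> d \<in> A \<Longrightarrow> p \<in> fst c \<Longrightarrow> p \<in> fst d \<Longrightarrow> linear (ctrans c d p)"
  using has_mder_linear[OF has_mder_ctrans] .

lemma linear_coords_in: "c \<in> A \<Longrightarrow> p \<in> fst c \<Longrightarrow> linear (coords_in A c p)"
  unfolding coords_in_eq by (rule linear_ctrans) (simp_all add: chart_at_in[OF A])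

lemma linear_from_coords: "c \<in> A \<Longrightarrow> p \<in> fst c \<Longrightarrow> linear (from_coords A c p)"
  unfolding from_coords_eq by (rule linear_ctrans) (simp_all add: chart_at_in[OF A])

lemma coords_in_from_coords: "c \<in> A \<Longrightarrow> p \<in> fst c \<Longrightarrow> coords_in A c p (from_coords A c p v) = v"
  unfolding from_coords_eq coords_in_eq by (simp add: ctrans_ctrans ctrans_self chart_at_in[OF A])

lemma from_coords_coords_in: "c \<in> A \<Longrightarrow> p \<in> fst c \<Longrightarrow> from_coords A c p (coords_in A c p v) = v"
  unfolding from_coords_eq coords_in_eq by (simp add: ctrans_ctrans ctrans_self chart_at_in[OF A])

lemma coords_in_inj: "c \<in> A \<Longrightarrow> p \<in> fst c \<Longrightarrow> coords_in A c p v = coords_in A c p w \<longleftrightarrow> v = w"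
  by (metis from_coords_coords_in)

lemma coords_in_change:
  "c \<in> A \<Longrightarrow> d \<in> A \<Longrightarrow> p \<in> fst c \<Longrightarrow> p \<in> fst d \<Longrightarrow> coords_in A d p v = ctrans c d p (coords_in A c p v)"
  unfolding coords_in_eq by (simp add: ctrans_ctrans chart_at_in[OF A])

end

lemma has_mder_change:
  assumes A: "smooth_atlas A" and B: "smooth_atlas B" and f: "has_mder f c d p F"
    and c: "c \<in> A" "c' \<in> A" "p \<in> fst c'" and d: "d \<in> B" "d' \<in> B" "f p \<in> fst d'"
  shows "has_mder f c' d' p (\<lambda>v. ctrans d d' (f p) (F (ctrans c' c p v)))"
proof -
  have p: "p \<in> fst c" "f p \<in> fst d" using f by (auto simp: has_mder_def)
  have "has_mder f c' d p (\<lambda>v. F (ctrans c' c p v))"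
    by (rule has_mder_chain[OF smooth_atlas_chart_ok[OF A c(2)] smooth_atlas_chart_ok[OF A c(1)] has_mder_ctrans[OF A] f])
      (use c p in auto)
  then show ?thesis
    by (rule has_mder_chain[OF smooth_atlas_chart_ok[OF A c(2)] smooth_atlas_chart_ok[OF B d(1)]])
      (rule has_mder_ctrans[OF B], use d p in auto)
qed

text \<open>Frees \<open>tangent_map\<close> from the preferred charts, whose choice may jump from
  point to point.\<close>

lemma tangent_map_coords:
  assumes A: "smooth_atlas A" and B: "smooth_atlas B" and f: "has_mder f c d p F"
    and c: "c \<in> A" and d: "d \<in> B"
  shows "coords_in B d (f p) (tangent_map A B f p v) = F (coords_in A c p v)"
proof -
  have p: "p \<in> fst c" "f p \<in> fst d" using f by (auto simp: has_mder_def)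
  have "tangent_map A B f p v = ctrans d (chart_at B (f p)) (f p) (F (ctrans (chart_at A p) c p v))"
    unfolding tangent_map_eq
    by (subst has_mder_eq_mder[OF has_mder_change[OF A B f c _ _ d]]) (auto simp: chart_at_in[OF A] chart_at_in[OF B])
  then show ?thesis
    unfolding coords_in_eq using p c d
    by (simp add: ctrans_ctrans[OF B] ctrans_self[OF B] chart_at_in[OF B])
qed

subsection \<open>Product charts\<close>

definition prod_chart :: "('p, 'e) chart \<Rightarrow> ('q, 'f) chart \<Rightarrow> ('p \<times> 'q, 'e \<times> 'f) chart" where
  "prod_chart c d = (fst c \<times> fst d, map_prod (snd c) (snd d))"

lemma prod_chart_in: "c \<in> A \<Longrightarrow> d \<in> B \<Longrightarrow> prod_chart c d \<in> prod_atlas A B"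
  unfolding prod_chart_def prod_atlas_def by blast

lemma snd_prod_chart [simp]: "snd (prod_chart c d) (p, q) = (snd c p, snd d q)"
  and fst_prod_chart [simp]: "fst (prod_chart c d) = fst c \<times> fst d"
  by (simp_all add: prod_chart_def)

lemma chart_image_prod: "snd (prod_chart c d) ` fst (prod_chart c d) = (snd c ` fst c) \<times> (snd d ` fst d)"
  by (auto simp: prod_chart_def map_prod_def)

lemma inj_on_chart: "chart_ok c \<Longrightarrow> inj_on (snd c) (fst c)"
  by (metis chart_inv_chart inj_onI)

lemma chart_inv_prod:
  assumes "chart_ok c" "chart_ok d" "x \<in> snd c ` fst c" "y \<in> snd d ` fst d"
  shows "chart_inv (prod_chart c d) (x, y) = (chart_inv c x, chart_inv d y)"
proof -
  have inj: "inj_on (snd (prod_chart c d)) (fst (prod_chart c d))"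
    using inj_on_chart[OF assms(1)] inj_on_chart[OF assms(2)]
    by (auto simp: prod_chart_def inj_on_def)
  have "chart_inv (prod_chart c d) (snd (prod_chart c d) (chart_inv c x, chart_inv d y)) = (chart_inv c x, chart_inv d y)"
    unfolding chart_inv_def[of "prod_chart c d"]
    by (rule inv_into_f_f[OF inj]) (use assms in \<open>simp add: chart_inv_in\<close>)
  then show ?thesis using assms by (simp add: chart_chart_inv)
qed

lemma chart_ok_prod:
  assumes "chart_ok c" "chart_ok d"
  shows "chart_ok (prod_chart c d)"
  unfolding chart_ok_def chart_image_prod homeomorphism_def
proof (intro conjI refl)
  have c: "open (fst c)" "open (snd c ` fst c)" "continuous_on (fst c) (snd c)" "continuous_on (snd c ` fst c) (chart_inv c)"
    and d: "open (fst d)" "open (snd d ` fst d)" "continuous_on (fst d) (snd d)" "continuous_on (snd d ` fst d) (chart_inv d)"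
    using assms unfolding chart_ok_def homeomorphism_def by blast+
  show "open (fst (prod_chart c d))" "open ((snd c ` fst c) \<times> (snd d ` fst d))"
    using c d by (simp_all add: open_Times)
  show "continuous_on (fst (prod_chart c d)) (snd (prod_chart c d))"
    unfolding prod_chart_def map_prod_def case_prod_beta snd_conv fst_conv
    by (intro continuous_on_Pair continuous_on_compose2[OF c(3)] continuous_on_compose2[OF d(3)]
        continuous_on_fst continuous_on_snd continuous_on_id) auto
  have "continuous_on ((snd c ` fst c) \<times> (snd d ` fst d)) (\<lambda>z. (chart_inv c (fst z), chart_inv d (snd z)))"
    by (intro continuous_on_Pair continuous_on_compose2[OF c(4)] continuous_on_compose2[OF d(4)]
        continuous_on_fst continuous_on_snd continuous_on_id) auto
  then show "continuous_on ((snd c ` fst c) \<times> (snd d ` fst d)) (chart_inv (prod_chart c d))"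
    by (rule continuous_on_eq) (auto simp: chart_inv_prod[OF assms])
  show "chart_inv (prod_chart c d) ` ((snd c ` fst c) \<times> (snd d ` fst d)) = fst (prod_chart c d)"
    using assms by (force simp: chart_inv_prod chart_inv_chart)
  show "\<forall>x\<in>fst (prod_chart c d). chart_inv (prod_chart c d) (snd (prod_chart c d) x) = x"
    using assms by (auto simp: chart_inv_prod chart_inv_chart)
  show "\<forall>y\<in>(snd c ` fst c) \<times> (snd d ` fst d). snd (prod_chart c d) (chart_inv (prod_chart c d) y) = y"
    using assms by (auto simp: chart_inv_prod chart_inv_chart)
qed

lemma has_mder_Pair:
  assumes "has_mder f c d p F" "has_mder g c e p G"
  shows "has_mder (\<lambda>x. (f x, g x)) c (prod_chart d e) p (\<lambda>v. (F v, G v))"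
proof -
  have "((\<lambda>x. ((snd d \<circ> f \<circ> chart_inv c) x, (snd e \<circ> g \<circ> chart_inv c) x)) has_derivative (\<lambda>v. (F v, G v))) (at (snd c p))"
    using assms unfolding has_mder_def by (intro has_derivative_Pair) (simp_all add: o_def)
  then have "(snd (prod_chart d e) \<circ> (\<lambda>x. (f x, g x)) \<circ> chart_inv c has_derivative (\<lambda>v. (F v, G v))) (at (snd c p))"
    by (simp add: o_def)
  then show ?thesis using assms unfolding has_mder_def by (simp add: isCont_Pair)
qed

lemma has_mder_const: "p \<in> fst c \<Longrightarrow> q \<in> fst d \<Longrightarrow> has_mder (\<lambda>x. q) c d p (\<lambda>v. 0)"
  unfolding has_mder_def by (simp add: o_def)

subsection \<open>Curves\<close>

lemma thick_vector_derivative: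
  fixes f :: "real \<Rightarrow> 'b::real_normed_vector"
  assumes "thick I" "t \<in> I" "(f has_vector_derivative v) (at t within I)"
  shows "vector_derivative f (at t within I) = v"
proof -
  have "(f has_vector_derivative vector_derivative f (at t within I)) (at t within I)"
    using assms(3) vector_derivative_works differentiableI_vector by blast
  then have "(\<lambda>h. h *\<^sub>R vector_derivative f (at t within I)) = (\<lambda>h. h *\<^sub>R v)"
    using assms(3) thick_derivative_unique[OF assms(1,2)] unfolding has_vector_derivative_def by blast
  from fun_cong[OF this, of 1] show ?thesis by simp
qed

text \<open>Derivatives are taken within \<open>I\<close> so that end-points are included;
  continuity of the curve keeps it in the chart domain near \<open>t\<close>.\<close>

lemma has_vector_derivative_mder:
  fixes \<gamma> :: "real \<Rightarrow> 'p::t2_space"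
  assumes ok: "chart_ok c" and t: "t \<in> I" and \<gamma>: "continuous (at t within I) \<gamma>"
    "((\<lambda>s. snd c (\<gamma> s)) has_vector_derivative v) (at t within I)"
    and f: "has_mder f c d (\<gamma> t) F"
  shows "((\<lambda>s. snd d (f (\<gamma> s))) has_vector_derivative F v) (at t within I)"
proof -
  have p: "\<gamma> t \<in> fst c" using f by (simp add: has_mder_def)
  have "(snd d \<circ> f \<circ> chart_inv c has_derivative F) (at (snd c (\<gamma> t)))"
    using f by (simp add: has_mder_def)
  then have "((snd d \<circ> f \<circ> chart_inv c) \<circ> (\<lambda>s. snd c (\<gamma> s)) has_derivative F \<circ> (\<lambda>h. h *\<^sub>R v)) (at t within I)"
    using \<gamma>(2) unfolding has_vector_derivative_def
    by (intro diff_chain_within) (auto intro: has_derivative_at_withinI)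
  moreover have "eventually (\<lambda>s. ((snd d \<circ> f \<circ> chart_inv c) \<circ> (\<lambda>s. snd c (\<gamma> s))) s = snd d (f (\<gamma> s))) (at t within I)"
  proof -
    have "eventually (\<lambda>s. \<gamma> s \<in> fst c) (at t within I)"
      using \<gamma>(1) ok p unfolding continuous_within chart_ok_def by (intro topological_tendstoD) auto
    then show ?thesis by eventually_elim (simp add: chart_inv_chart[OF ok])
  qed
  ultimately have "((\<lambda>s. snd d (f (\<gamma> s))) has_derivative F \<circ> (\<lambda>h. h *\<^sub>R v)) (at t within I)"
    by (rule has_derivative_transform_eventually) (use t p in \<open>auto simp: chart_inv_chart[OF ok]\<close>)
  moreover have "F \<circ> (\<lambda>h. h *\<^sub>R v) = (\<lambda>h. h *\<^sub>R F v)"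
    using linear_scale[OF has_mder_linear[OF f]] by (auto simp: fun_eq_iff)
  ultimately show ?thesis unfolding has_vector_derivative_def by simp
qed

lemma smooth_curve_coords:
  assumes "smooth_map_on line_atlas A I \<gamma>" "c \<in> A"
  shows "smooth_on (I \<inter> \<gamma> -` fst c) (\<lambda>t. snd c (\<gamma> t))"
proof -
  have "chart_inv (UNIV, id) = (id :: real \<Rightarrow> real)"
    by (simp add: chart_inv_def fun_eq_iff inv_id[unfolded id_def] id_def)
  then show ?thesis
    using assms unfolding smooth_map_on_def line_atlas_def by (auto simp: o_def)
qed

text \<open>The preferred chart used by \<open>velocity\<close> may change along the curve, whereas
  smooth dependence on time can only be expressed in one fixed chart.\<close>

lemma smooth_curve_velocity:
  fixes A :: "('p::{t2_space,second_countable_topology}, 'e::finite_euclidean) chart set"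
  assumes A: "smooth_atlas A" and I: "thick I" and \<gamma>: "smooth_map_on line_atlas A I \<gamma>"
    and c: "c \<in> A" and t: "t \<in> I" "\<gamma> t \<in> fst c"
  shows "((\<lambda>s. snd c (\<gamma> s)) has_vector_derivative coords_in A c (\<gamma> t) (velocity A I \<gamma> t)) (at t within I)"
proof -
  have cont: "continuous_on I \<gamma>" using \<gamma> by (simp add: smooth_map_on_def)
  then have cont_t: "continuous (at t within I) \<gamma>" using t by (simp add: continuous_on_eq_continuous_within)
  let ?k = "chart_at A (\<gamma> t)"
  have ok: "chart_ok c" "chart_ok ?k" using smooth_atlas_chart_ok[OF A] c chart_at_in[OF A] by blast+
  have D: "((\<lambda>s. snd c (\<gamma> s)) has_vector_derivative vector_derivative (\<lambda>s. snd c (\<gamma> s)) (at t within I)) (at t within I)"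
  proof -
    obtain W where W: "open W" "W \<inter> I = \<gamma> -` fst c \<inter> I"
      using cont ok(1) unfolding continuous_on_open_invariant chart_ok_def by blast
    have "I \<inter> \<gamma> -` fst c = I \<inter> W" using W by blast
    then have "smooth_on (I \<inter> W) (\<lambda>s. snd c (\<gamma> s))" using smooth_curve_coords[OF \<gamma> c] by simp
    moreover have "t \<in> I \<inter> W" using W t by blast
    moreover have "at t within I \<inter> W = at t within I"
      using at_within_nhd[of t W "I \<inter> W" I] W t \<open>t \<in> I \<inter> W\<close> by auto
    ultimately show ?thesis using smooth_on_has_vector_derivative by metis
  qed
  have "has_mder (\<lambda>p. p) c ?k (\<gamma> t) (ctrans c ?k (\<gamma> t))"
    by (rule has_mder_ctrans[OF A c]) (use t chart_at_in[OF A] in auto)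
  from has_vector_derivative_mder[OF ok(1) t(1) cont_t D this]
  have "velocity A I \<gamma> t = ctrans c ?k (\<gamma> t) (vector_derivative (\<lambda>s. snd c (\<gamma> s)) (at t within I))"
    unfolding velocity_def by (simp add: o_def thick_vector_derivative[OF I t(1)])
  then show ?thesis
    using D t by (simp add: coords_in_eq ctrans_ctrans[OF A] ctrans_self[OF A] c chart_at_in[OF A])
qed

section \<open>Maps of two variables\<close>

context
  fixes A :: "('p::{t2_space,second_countable_topology}, 'e::finite_euclidean) chart set"
    and B :: "('q::{t2_space,second_countable_topology}, 'f::finite_euclidean) chart set"
    and C :: "('r::{t2_space,second_countable_topology}, 'h::finite_euclidean) chart set"
    and f :: "'p \<times> 'q \<Rightarrow> 'r"
  assumes A: "smooth_atlas A" and B: "smooth_atlas B" and C: "smooth_atlas C"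
    and f: "smooth_map_on (prod_atlas A B) C UNIV f"
begin

lemma has_mder_prod:
  assumes "c \<in> A" "d \<in> B" "k \<in> C" "p \<in> fst c" "q \<in> fst d" "f (p, q) \<in> fst k"
  shows "has_mder f (prod_chart c d) k (p, q) (mder f (prod_chart c d) k (p, q))"
  by (rule smooth_map_on_has_mder[OF f])
    (use assms in \<open>auto intro: chart_ok_prod prod_chart_in smooth_atlas_chart_ok[OF A]
      smooth_atlas_chart_ok[OF B] smooth_atlas_chart_ok[OF C]\<close>)

lemma has_mder_second:
  assumes "c \<in> A" "d \<in> B" "k \<in> C" "p \<in> fst c" "q \<in> fst d" "f (p, q) \<in> fst k"
  shows "has_mder (\<lambda>h. f (p, h)) d k q (\<lambda>v. mder f (prod_chart c d) k (p, q) (0, v))"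
proof -
  have ok: "chart_ok c" "chart_ok d" using assms A B smooth_atlas_chart_ok by blast+
  have "has_mder (\<lambda>h. (p, h)) d (prod_chart c d) q (\<lambda>v. (0, v))"
    by (rule has_mder_Pair[OF has_mder_const[OF assms(5,4)] has_mder_ident[OF ok(2) assms(5)]])
  from has_mder_chain[OF ok(2) chart_ok_prod[OF ok] this has_mder_prod[OF assms]] show ?thesis .
qed

text \<open>The derivative in the second variable is that of \<open>f\<close> on vectors
  \<open>(0, v)\<close> in a product chart, restricted to the slice of points
  \<open>(x, snd d q)\<close>. Smoothness of left-invariant fields and of fundamental fields are
  instances.\<close>

lemma smooth_on_mder_second:
  assumes cd: "c \<in> A" "d \<in> B" "k \<in> C" and q: "q \<in> fst d"
  shows "smooth_on (snd c ` {p \<in> fst c. f (p, q) \<in> fst k}) (\<lambda>x. mder (\<lambda>h. f (chart_inv c x, h)) d k q v)"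
proof (rule smooth_on_eqI)
  let ?T = "snd c ` {p \<in> fst c. f (p, q) \<in> fst k}"
  let ?S = "snd (prod_chart c d) ` (UNIV \<inter> fst (prod_chart c d) \<inter> f -` fst k)"
  have ok: "chart_ok c" "chart_ok d" "chart_ok k"
    using cd A B C smooth_atlas_chart_ok by blast+
  have "smooth_on ?S (\<lambda>z. mder f (prod_chart c d) k (chart_inv (prod_chart c d) z) (0, v))"
    by (rule smooth_on_mder[OF f open_UNIV chart_ok_prod[OF ok(1,2)] ok(3) prod_chart_in[OF cd(1,2)] cd(3)])
  moreover have "(\<lambda>x. (x, snd d q)) ` ?T \<subseteq> ?S" using q by force
  ultimately show "smooth_on ?T (\<lambda>x. mder f (prod_chart c d) k (chart_inv (prod_chart c d) (x, snd d q)) (0, v))"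
    by (rule smooth_on_compose[OF smooth_on_Pair[OF smooth_on_ident smooth_on_const]])
  fix x assume "x \<in> ?T"
  then obtain p where p: "x = snd c p" "p \<in> fst c" "f (p, q) \<in> fst k" by blast
  have "chart_inv (prod_chart c d) (x, snd d q) = (p, q)"
    using p q by (simp add: chart_inv_prod[OF ok(1,2)] chart_inv_chart ok)
  moreover have "mder (\<lambda>h. f (p, h)) d k q v = mder f (prod_chart c d) k (p, q) (0, v)"
    using has_mder_eq_mder[OF has_mder_second[OF cd p(2) q p(3)]] by simp
  ultimately show "mder f (prod_chart c d) k (chart_inv (prod_chart c d) (x, snd d q)) (0, v) =
      mder (\<lambda>h. f (chart_inv c x, h)) d k q v"
    using p by (simp add: chart_inv_chart ok)
qed

lemma smooth_map_second: "smooth_map_on B C UNIV (\<lambda>h. f (p, h))"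
  unfolding smooth_map_on_def
proof (intro conjI ballI)
  have "continuous_on UNIV f" using f by (simp add: smooth_map_on_def)
  then show "continuous_on UNIV (\<lambda>h. f (p, h))"
    by (rule continuous_on_compose2) (auto intro!: continuous_intros)
  fix d k assume dk: "d \<in> B" "k \<in> C"
  let ?c = "chart_at A p"
  have c: "?c \<in> A" "p \<in> fst ?c" using chart_at_in[OF A] by auto
  have ok: "chart_ok ?c" "chart_ok d" using c dk A B smooth_atlas_chart_ok by blast+
  let ?T = "snd d ` (UNIV \<inter> fst d \<inter> (\<lambda>h. f (p, h)) -` fst k)"
  let ?S = "snd (prod_chart ?c d) ` (UNIV \<inter> fst (prod_chart ?c d) \<inter> f -` fst k)"
  show "smooth_on ?T (snd k \<circ> (\<lambda>h. f (p, h)) \<circ> chart_inv d)"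
  proof (rule smooth_on_eqI)
    have "smooth_on ?S (snd k \<circ> f \<circ> chart_inv (prod_chart ?c d))"
      using f prod_chart_in[OF c(1) dk(1)] dk(2) unfolding smooth_map_on_def by blast
    moreover have "(\<lambda>y. (snd ?c p, y)) ` ?T \<subseteq> ?S" using c by force
    ultimately show "smooth_on ?T (\<lambda>y. (snd k \<circ> f \<circ> chart_inv (prod_chart ?c d)) (snd ?c p, y))"
      by (rule smooth_on_compose[OF smooth_on_Pair[OF smooth_on_const smooth_on_ident]])
    show "(snd k \<circ> f \<circ> chart_inv (prod_chart ?c d)) (snd ?c p, y) = (snd k \<circ> (\<lambda>h. f (p, h)) \<circ> chart_inv d) y"
      if "y \<in> ?T" for y
      using that c ok by (auto simp: chart_inv_prod chart_inv_chart)
  qed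
qed

end

lemma smooth_map_on_curve_compose:
  fixes \<gamma> :: "real \<Rightarrow> 'p::topological_space"
  assumes "smooth_map_on line_atlas A UNIV \<gamma>" "smooth_on UNIV h"
  shows "smooth_map_on line_atlas A UNIV (\<lambda>t. \<gamma> (h t))"
  unfolding smooth_map_on_def
proof (intro conjI ballI)
  show "continuous_on UNIV (\<lambda>t. \<gamma> (h t))"
    using assms continuous_on_compose2[of UNIV \<gamma> UNIV h] smooth_on_imp_continuous_on[OF assms(2)]
    unfolding smooth_map_on_def by auto
  fix c d assume c: "c \<in> line_atlas" and d: "d \<in> A"
  have inv: "chart_inv (UNIV, id) = (id :: real \<Rightarrow> real)"
    by (simp add: chart_inv_def fun_eq_iff inv_id[unfolded id_def] id_def)
  have "smooth_on (UNIV \<inter> \<gamma> -` fst d) (\<lambda>t. snd d (\<gamma> t))" by (rule smooth_curve_coords[OF assms(1) d])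
  then have "smooth_on ((\<lambda>t. \<gamma> (h t)) -` fst d) (\<lambda>t. snd d (\<gamma> (h t)))"
    by (rule smooth_on_compose[OF smooth_on_subset[OF assms(2) subset_UNIV]]) auto
  then show "smooth_on (snd c ` (UNIV \<inter> fst c \<inter> (\<lambda>t. \<gamma> (h t)) -` fst d)) (snd d \<circ> (\<lambda>t. \<gamma> (h t)) \<circ> chart_inv c)"
    using c by (simp add: line_atlas_def inv o_def)
qed

section \<open>The exponential map of a Lie group\<close>

section \<open>One-parameter subgroups\<close>

locale lie_grp =
  fixes A :: "('g::{t2_space,second_countable_topology}, 'e::finite_euclidean) chart set"
    and m :: "'g \<Rightarrow> 'g \<Rightarrow> 'g" and e :: 'g and i :: "'g \<Rightarrow> 'g"
  assumes lie: "lie_group A m e i"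
begin

sublocale group m e i
  using lie by (simp add: lie_group_def)

lemma A: "smooth_atlas A"
  and mul_smooth: "smooth_map_on (prod_atlas A A) A UNIV (\<lambda>(g, h). m g h)"
  using lie by (simp_all add: lie_group_def)

definition k where "k = chart_at A e"

lemma k: "k \<in> A" "e \<in> fst k" "chart_ok k"
  using chart_at_in[OF A] smooth_atlas_chart_ok[OF A] by (auto simp: k_def)

abbreviation kinv where "kinv \<equiv> chart_inv k"

lemma has_mder_left_mult:
  assumes "c \<in> A" "d \<in> A" "h \<in> fst c" "m g h \<in> fst d"
  shows "has_mder (\<lambda>h. m g h) c d h (mder (\<lambda>h. m g h) c d h)"
  using smooth_map_on_has_mder[OF smooth_map_second[OF A A A mul_smooth, of g, simplified] open_UNIV
      smooth_atlas_chart_ok[OF A assms(1)] smooth_atlas_chart_ok[OF A assms(2)] assms(1,2) UNIV_I assms(3,4)] .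

text \<open>The left-invariant vector field with value \<open>a\<close> at the unit, in the chart \<open>k\<close>.\<close>

definition V where "V a x = mder (\<lambda>h. m (kinv x) h) k k e a"

lemma V_chart: "g \<in> fst k \<Longrightarrow> V a (snd k g) = mder (\<lambda>h. m g h) k k e a"
  by (simp add: V_def chart_inv_chart[OF k(3)])

lemma smooth_V: "smooth_on (snd k ` fst k) (V a)"
  using smooth_on_mder_second[OF A A A mul_smooth k(1) k(1) k(1) k(2), of a]
  by (simp add: V_def[abs_def])

lemma V_unit: "V a (snd k e) = a"
proof -
  have "has_mder (\<lambda>h. m e h) k k e (\<lambda>v. v)"
    by (rule has_mder_cong[OF k(3) has_mder_ident[OF k(3,2)] open_UNIV]) auto
  from has_mder_eq_mder[OF this] show ?thesis by (simp add: V_chart k(2))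
qed

text \<open>Differentiation of \<open>m g (m h y) = m (m g h) y\<close> at the unit.\<close>

lemma V_left_invariant:
  assumes "g \<in> fst k" "h \<in> fst k" "m g h \<in> fst k"
  shows "mder (\<lambda>y. m g y) k k h (V a (snd k h)) = V a (snd k (m g h))"
proof -
  have "has_mder (\<lambda>y. m g (m h y)) k k e (\<lambda>v. mder (\<lambda>y. m g y) k k h (mder (\<lambda>y. m h y) k k e v))"
    by (rule has_mder_chain[OF k(3) k(3)]) (use has_mder_left_mult assms k in auto)
  then have "has_mder (\<lambda>y. m (m g h) y) k k e (\<lambda>v. mder (\<lambda>y. m g y) k k h (mder (\<lambda>y. m h y) k k e v))"
    by (simp add: assoc)
  from has_mder_eq_mder[OF this] show ?thesis by (simp add: V_chart assms)
qed

text \<open>\<open>one_parameter_subgroup\<close> for a bare Lie group; \<open>ops_eq\<close>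
  identifies the two notions for the structure group of a bundle.\<close>

definition ops :: "(real \<Rightarrow> 'g) \<Rightarrow> bool" where
  "ops \<gamma> \<longleftrightarrow> smooth_map_on line_atlas A UNIV \<gamma> \<and> \<gamma> 0 = e \<and> (\<forall>s t. \<gamma> (s + t) = m (\<gamma> s) (\<gamma> t))"

definition pw :: "'g \<Rightarrow> nat \<Rightarrow> 'g" where
  "pw g n = ((m g) ^^ n) e"

lemma pw_0 [simp]: "pw g 0 = e"
  and pw_Suc [simp]: "pw g (Suc n) = m g (pw g n)"
  by (simp_all add: pw_def)

lemma pw_add: "pw g (n + n') = m (pw g n) (pw g n')"
  by (induction n) (simp_all add: assoc)

lemma pw_mult: "pw (pw g n) n' = pw g (n * n')"
  by (induction n') (simp_all add: pw_add)

lemma pw_commute: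
  assumes "m g h = m h g"
  shows "m g (pw h n) = m (pw h n) g"
proof (induction n)
  case (Suc n)
  have "m g (m h (pw h n)) = m h (m g (pw h n))" by (simp add: assms flip: assoc)
  then show ?case using Suc by (simp add: assoc)
qed simp

lemma pw_m:
  assumes "m g h = m h g"
  shows "pw (m g h) n = m (pw g n) (pw h n)"
proof (induction n)
  case (Suc n)
  have "m (m g h) (m (pw g n) (pw h n)) = m g (m (m h (pw g n)) (pw h n))" by (simp add: assoc)
  also have "m h (pw g n) = m (pw g n) h" by (rule pw_commute) (simp add: assms)
  finally show ?case using Suc by (simp add: assoc)
qed simp

lemma pw_local_hom:
  assumes \<gamma>: "\<gamma> 0 = e" "\<And>s t. 0 \<le> s \<Longrightarrow> 0 \<le> t \<Longrightarrow> s + t \<le> \<delta> \<Longrightarrow> \<gamma> (s + t) = m (\<gamma> s) (\<gamma> t)"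
    and u: "0 \<le> u" "real n * u \<le> \<delta>"
  shows "pw (\<gamma> u) n = \<gamma> (real n * u)"
  using u(2)
proof (induction n)
  case (Suc n)
  have "real n * u \<le> real (Suc n) * u" using u by (simp add: algebra_simps)
  then have "pw (\<gamma> u) n = \<gamma> (real n * u)" using Suc by simp
  moreover have "\<gamma> (u + real n * u) = m (\<gamma> u) (\<gamma> (real n * u))"
    using u Suc.prems by (intro \<gamma>(2)) (auto simp: algebra_simps)
  ultimately show ?case by (simp add: algebra_simps)
qed (simp add: \<gamma>)

text \<open>Differentiating \<open>\<gamma> (t + s) = m (\<gamma> t) (\<gamma> s)\<close> at
  \<open>s = 0\<close> shows that a one-parameter subgroup is an integral curve of the
  left-invariant field.\<close>

lemma ops_has_derivative:
  assumes \<gamma>: "ops \<gamma>" and a: "velocity A UNIV \<gamma> 0 = a" and t: "\<gamma> t \<in> fst k"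
  shows "((\<lambda>s. snd k (\<gamma> s)) has_vector_derivative V a (snd k (\<gamma> t))) (at t)"
proof -
  have \<gamma>': "smooth_map_on line_atlas A UNIV \<gamma>" "\<gamma> 0 = e" "\<And>s t. \<gamma> (s + t) = m (\<gamma> s) (\<gamma> t)"
    using \<gamma> by (auto simp: ops_def)
  have "((\<lambda>s. snd k (\<gamma> s)) has_vector_derivative coords_in A k (\<gamma> 0) (velocity A UNIV \<gamma> 0)) (at 0)"
    by (rule smooth_curve_velocity[OF A thick_UNIV \<gamma>'(1) k(1)]) (simp_all add: \<gamma>' k)
  then have D0: "((\<lambda>s. snd k (\<gamma> s)) has_vector_derivative a) (at 0)"
    using k by (simp add: \<gamma>' a coords_in_eq k_def ctrans_self[OF A])
  have cont: "isCont \<gamma> 0"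
    using \<gamma>'(1) by (simp add: smooth_map_on_def continuous_on_eq_continuous_at)
  have "((\<lambda>s. snd k (m (\<gamma> t) (\<gamma> s))) has_vector_derivative mder (\<lambda>h. m (\<gamma> t) h) k k e a) (at 0)"
    using has_vector_derivative_mder[OF k(3) UNIV_I cont D0, of "\<lambda>h. m (\<gamma> t) h" k]
      has_mder_left_mult[OF k(1) k(1) k(2), of "\<gamma> t"] t by (simp add: \<gamma>')
  then have "((\<lambda>s. snd k (\<gamma> (t + s))) has_vector_derivative V a (snd k (\<gamma> t))) (at (t - t))"
    by (simp add: \<gamma>'(3) V_chart t)
  moreover have "((\<lambda>s. s - t) has_vector_derivative 1) (at t)"
    by (auto intro!: derivative_eq_intros)
  ultimately have "((\<lambda>s. snd k (\<gamma> (t + s))) \<circ> (\<lambda>s. s - t) has_vector_derivative 1 *\<^sub>R V a (snd k (\<gamma> t))) (at t)"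
    by (intro vector_diff_chain_at) auto
  then show ?thesis by (simp add: o_def)
qed

lemma ops_pw:
  assumes "ops \<gamma>"
  shows "\<gamma> (real n * t) = pw (\<gamma> t) n"
proof (induction n)
  case 0
  show ?case using assms by (simp add: ops_def)
next
  case (Suc n)
  have "\<gamma> (t + real n * t) = m (\<gamma> t) (\<gamma> (real n * t))" using assms by (simp add: ops_def)
  then show ?case using Suc by (simp add: algebra_simps)
qed

lemma lipschitz_ball:
  obtains r K where "r > 0" "K > 0" "cball (snd k e) r \<subseteq> snd k ` fst k"
    "\<And>x y. x \<in> cball (snd k e) r \<Longrightarrow> y \<in> cball (snd k e) r \<Longrightarrow> norm (V a x - V a y) \<le> K * norm (x - y)"
proof -
  have "open (snd k ` fst k)" using k(3) by (simp add: chart_ok_def)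
  from smooth_on_locally_lipschitz[OF this _ smooth_V, of "snd k e"] show thesis
    using that k(2) by blast
qed

text \<open>Near 0 both curves solve the same differential equation in a ball where the field is
  Lipschitz. Powers of \<open>\<gamma> (t / N)\<close> carry the equality to all
  \<open>t \<ge> 0\<close>, and inverses carry it to negative \<open>t\<close>.\<close>

lemma ops_unique:
  assumes "ops \<gamma>" "ops \<gamma>'" "velocity A UNIV \<gamma> 0 = a" "velocity A UNIV \<gamma>' 0 = a"
  shows "\<gamma> = \<gamma>'"
proof -
  obtain r K where r: "r > 0" "cball (snd k e) r \<subseteq> snd k ` fst k"
    and lip: "\<And>x y. x \<in> cball (snd k e) r \<Longrightarrow> y \<in> cball (snd k e) r \<Longrightarrow> norm (V a x - V a y) \<le> K * norm (x - y)"
    using lipschitz_ball by metis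
  have near: "\<exists>d>0. \<forall>t. \<bar>t\<bar> \<le> d \<longrightarrow> \<gamma> t \<in> fst k \<and> snd k (\<gamma> t) \<in> cball (snd k e) r" if "ops \<gamma>" for \<gamma>
  proof -
    have c: "isCont \<gamma> 0" "\<gamma> 0 = e"
      using that by (auto simp: ops_def smooth_map_on_def continuous_on_eq_continuous_at)
    have "isCont (\<lambda>t. snd k (\<gamma> t)) 0"
      using isCont_o2[OF c(1)] isCont_chart[OF k(3,2)] c(2) by simp
    then obtain d1 where d1: "d1 > 0" "\<And>t. \<bar>t\<bar> < d1 \<Longrightarrow> dist (snd k (\<gamma> t)) (snd k e) < r"
      unfolding continuous_at_eps_delta using r(1) c(2) by force
    have "continuous_on UNIV \<gamma>" using that by (simp add: ops_def smooth_map_on_def)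
    then have "open (\<gamma> -` fst k)" using k(3) by (simp add: chart_ok_def open_vimage)
    then have "eventually (\<lambda>t. t \<in> \<gamma> -` fst k) (nhds 0)"
      by (rule eventually_nhds_in_open) (simp add: c k)
    then obtain d2 where d2: "d2 > 0" "\<And>t. \<bar>t\<bar> < d2 \<Longrightarrow> \<gamma> t \<in> fst k"
      unfolding eventually_nhds_metric by (auto simp: dist_real_def)
    show ?thesis
      using d1 d2 by (intro exI[of _ "min d1 d2 / 2"]) (auto simp: dist_commute less_imp_le)
  qed
  obtain d1 where d1: "d1 > 0" "\<And>t. \<bar>t\<bar> \<le> d1 \<Longrightarrow> \<gamma> t \<in> fst k \<and> snd k (\<gamma> t) \<in> cball (snd k e) r"
    using near[OF assms(1)] by blast
  obtain d2 where d2: "d2 > 0" "\<And>t. \<bar>t\<bar> \<le> d2 \<Longrightarrow> \<gamma>' t \<in> fst k \<and> snd k (\<gamma>' t) \<in> cball (snd k e) r"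
    using near[OF assms(2)] by blast
  define d where "d = min d1 d2"
  have d: "d > 0" using d1 d2 by (simp add: d_def)
  have eq: "\<gamma> t = \<gamma>' t" if t: "0 \<le> t" "t \<le> d" for t
  proof -
    have in1: "\<gamma> t \<in> fst k \<and> snd k (\<gamma> t) \<in> cball (snd k e) r" if "t \<in> {0..d}" for t
      using that d1 by (auto simp: d_def)
    have in2: "\<gamma>' t \<in> fst k \<and> snd k (\<gamma>' t) \<in> cball (snd k e) r" if "t \<in> {0..d}" for t
      using that d2 by (auto simp: d_def)
    have "snd k (\<gamma> t) = snd k (\<gamma>' t)"
    proof (rule ode_unique[where a = 0 and b = d and K = K])
      show "((\<lambda>t. snd k (\<gamma> t)) has_vector_derivative V a (snd k (\<gamma> t))) (at t within {0..d})" if "t \<in> {0..d}" for t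
        using ops_has_derivative[OF assms(1,3)] in1[OF that] by (blast intro: has_vector_derivative_at_within)
      show "((\<lambda>t. snd k (\<gamma>' t)) has_vector_derivative V a (snd k (\<gamma>' t))) (at t within {0..d})" if "t \<in> {0..d}" for t
        using ops_has_derivative[OF assms(2,4)] in2[OF that] by (blast intro: has_vector_derivative_at_within)
      show "norm (V a (snd k (\<gamma> t)) - V a (snd k (\<gamma>' t))) \<le> K * norm (snd k (\<gamma> t) - snd k (\<gamma>' t))"
        if "t \<in> {0..d}" for t
        using lip in1[OF that] in2[OF that] by blast
      show "snd k (\<gamma> 0) = snd k (\<gamma>' 0)" using assms(1,2) by (simp add: ops_def)
    qed (use t in simp)
    then show ?thesis
      using in1[of t] in2[of t] t chart_inv_chart[OF k(3)] by (metis atLeastAtMost_iff)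
  qed
  have pos: "\<gamma> t = \<gamma>' t" if t: "0 \<le> t" for t
  proof -
    obtain n where n: "t / d \<le> real n" using real_arch_simple by blast
    define N where "N = Suc n"
    have N: "t / real N \<le> d" "real N * (t / real N) = t"
      using n d t by (auto simp: N_def field_simps)
    have "\<gamma> (t / real N) = \<gamma>' (t / real N)" by (rule eq) (use N t in auto)
    then show ?thesis using ops_pw[OF assms(1), of N "t / real N"] ops_pw[OF assms(2), of N "t / real N"] N(2) by simp
  qed
  have "\<gamma> t = \<gamma>' t" for t
  proof (cases "0 \<le> t")
    case False
    have "m (\<gamma> t) (\<gamma> (- t)) = e" "m (\<gamma>' t) (\<gamma>' (- t)) = e"
      using assms(1,2) unfolding ops_def by (metis add.right_inverse)+
    moreover have "\<gamma> (- t) = \<gamma>' (- t)" using pos[of "- t"] False by simp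
    ultimately show ?thesis by (metis assoc right_inverse right_neutral)
  qed (rule pos)
  then show ?thesis by blast
qed

text \<open>A homomorphism defined on \<open>[0, \<delta>]\<close> extends to the half line by \<open>t \<mapsto> \<gamma> (t / n) ^ n\<close>,
  and then to the real line.\<close>

lemma extend_local_hom:
  fixes \<gamma> :: "real \<Rightarrow> 'g"
  assumes \<delta>: "\<delta> > 0" and \<gamma>: "\<gamma> 0 = e"
    and hom: "\<And>s t. 0 \<le> s \<Longrightarrow> 0 \<le> t \<Longrightarrow> s + t \<le> \<delta> \<Longrightarrow> \<gamma> (s + t) = m (\<gamma> s) (\<gamma> t)"
  shows "\<exists>\<Gamma>. (\<forall>s t. \<Gamma> (s + t) = m (\<Gamma> s) (\<Gamma> t)) \<and> (\<forall>t\<in>{0..\<delta>}. \<Gamma> t = \<gamma> t)"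
proof -
  have pw_eq: "pw (\<gamma> (t / real n)) n = pw (\<gamma> (t / real n')) n'"
    if "0 \<le> t" "n > 0" "n' > 0" "t / real n \<le> \<delta>" "t / real n' \<le> \<delta>" for t n n'
  proof -
    \<comment> \<open>Both powers are compared with the one for the common refinement
      \<open>n * n'\<close>.\<close>
    have *: "pw (\<gamma> (t / real n)) n = pw (\<gamma> (t / real (n * n'))) (n * n')"
      if "0 \<le> t" "n > 0" "n' > 0" "t / real n \<le> \<delta>" for n n' t
    proof -
      have "\<gamma> (t / real n) = pw (\<gamma> (t / real (n * n'))) n'"
        using pw_local_hom[OF \<gamma> hom, of \<delta> "t / real (n * n')" n'] that by simp
      then show ?thesis by (simp add: pw_mult mult.commute)
    qed
    show ?thesis using *[of t n n'] *[of t n' n] that by (simp add: mult.commute)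
  qed
  define N where "N t = Suc (nat \<lceil>t / \<delta>\<rceil>)" for t
  have N: "N t > 0" "0 \<le> t \<Longrightarrow> t / real (N t) \<le> \<delta>" for t
  proof -
    assume t: "0 \<le> t"
    have "t / \<delta> \<le> real (N t)" unfolding N_def by linarith
    moreover have "real (N t) > 0" by (simp add: N_def)
    ultimately show "t / real (N t) \<le> \<delta>" using \<delta> by (simp add: field_simps)
  qed (simp add: N_def)
  define G where "G t = pw (\<gamma> (t / real (N t))) (N t)" for t
  have G: "G t = pw (\<gamma> (t / real n)) n" if "0 \<le> t" "n > 0" "t / real n \<le> \<delta>" for t n
    unfolding G_def by (rule pw_eq) (use that N in auto)
  have G_hom: "G (s + t) = m (G s) (G t)" if st: "0 \<le> s" "0 \<le> t" for s t
  proof -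
    define n where "n = N (s + t)"
    have n: "n > 0" "(s + t) / real n \<le> \<delta>" using N st by (auto simp: n_def)
    have le: "s / real n \<le> \<delta>" "t / real n \<le> \<delta>"
      using n st by (auto simp: add_divide_distrib intro: order_trans[rotated])
    have sum: "\<gamma> ((s + t) / real n) = m (\<gamma> (s / real n)) (\<gamma> (t / real n))"
      using hom[of "s / real n" "t / real n"] n st by (simp add: add_divide_distrib)
    have "\<gamma> ((t + s) / real n) = m (\<gamma> (t / real n)) (\<gamma> (s / real n))"
      using hom[of "t / real n" "s / real n"] n st by (simp add: add_divide_distrib add.commute)
    \<comment> \<open>Powers of a product split only for commuting factors; here commutation comes
      from writing the sum of the two times in both orders.\<close>
    then have "m (\<gamma> (s / real n)) (\<gamma> (t / real n)) = m (\<gamma> (t / real n)) (\<gamma> (s / real n))"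
      using sum by (simp add: add.commute)
    from pw_m[OF this, of n] show ?thesis
      using G[of s n] G[of t n] G[of "s + t" n] sum n le st by simp
  qed
  have G_comm: "m (G s) (G t) = m (G t) (G s)" if "0 \<le> s" "0 \<le> t" for s t
    using G_hom[OF that] G_hom[OF that(2,1)] by (simp add: add.commute)
  \<comment> \<open>The quotient of the values at the positive and negative parts of
    \<open>t\<close>. Any representation \<open>t = u - v\<close> with nonnegative \<open>u\<close>
    and \<open>v\<close> turns out to give the same value, which makes additivity a
    computation.\<close>
  define \<Gamma> where "\<Gamma> t = m (G (max t 0)) (i (G (max (- t) 0)))" for t
  have i_m: "i (m g h) = m (i h) (i g)" for g h
    by (rule inverse_distrib_swap)
  have comm_i: "m (i (G v)) (G u) = m (G u) (i (G v))" if "0 \<le> u" "0 \<le> v" for u v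
    using G_comm[OF that] by (metis assoc left_inverse left_neutral right_inverse right_neutral)
  have \<Gamma>: "\<Gamma> t = m (G u) (i (G v))" if "0 \<le> u" "0 \<le> v" "t = u - v" for t u v
  proof -
    let ?p = "G (max t 0)" and ?n = "G (max (- t) 0)"
    have "m (G u) ?n = G (u + max (- t) 0)" by (rule G_hom[symmetric]) (use that in auto)
    also have "u + max (- t) 0 = max t 0 + v" using that by auto
    also have "G \<dots> = m ?p (G v)" by (rule G_hom) (use that in auto)
    finally have "m (m (G u) ?n) (i (G v)) = ?p" by (simp add: assoc right_inverse)
    moreover have "m ?n (i (G v)) = m (i (G v)) ?n" by (rule comm_i[symmetric]) (use that in auto)
    ultimately have "?p = m (m (G u) (i (G v))) ?n" by (simp add: assoc)
    then show ?thesis unfolding \<Gamma>_def by (simp add: assoc right_inverse)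
  qed
  have "\<Gamma> (s + t) = m (\<Gamma> s) (\<Gamma> t)" for s t
  proof -
    let ?u = "max s 0" and ?v = "max (- s) 0" and ?u' = "max t 0" and ?v' = "max (- t) 0"
    have "\<Gamma> (s + t) = m (G (?u + ?u')) (i (G (?v' + ?v)))" by (rule \<Gamma>) auto
    also have "\<dots> = m (G ?u) (m (m (G ?u') (i (G ?v))) (i (G ?v')))"
      by (simp add: G_hom i_m assoc)
    also have "m (G ?u') (i (G ?v)) = m (i (G ?v)) (G ?u')" by (rule comm_i[symmetric]) auto
    finally show ?thesis by (simp add: \<Gamma>_def assoc)
  qed
  moreover have "\<Gamma> t = \<gamma> t" if "t \<in> {0..\<delta>}" for t
  proof -
    have "G t = \<gamma> t" "G 0 = e" using G[of t 1] G[of 0 1] that \<delta> \<gamma> by auto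
    then have "\<Gamma> t = m (\<gamma> t) (i e)" using \<Gamma>[of t 0 t] that by simp
    moreover have "i e = e" by (metis left_inverse right_neutral)
    ultimately show ?thesis by simp
  qed
  ultimately show ?thesis by blast
qed

text \<open>For fixed \<open>s\<close> the chart images of \<open>\<gamma> (s + t)\<close> and
  \<open>m (\<gamma> s) (\<gamma> t)\<close>, as functions of \<open>t\<close>, solve the equation
  of the left-invariant field with the same initial value, so they agree.\<close>

lemma local_ops:
  obtains \<delta> x where "\<delta> > 0" "x 0 = snd k e" "smooth_on {0..\<delta>} x"
    "\<And>t. t \<in> {0..\<delta>} \<Longrightarrow> x t \<in> snd k ` fst k"
    "\<And>t. t \<in> {0..\<delta>} \<Longrightarrow> (x has_vector_derivative V a (x t)) (at t within {0..\<delta>})"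
    "\<And>s t. 0 \<le> s \<Longrightarrow> 0 \<le> t \<Longrightarrow> s + t \<le> \<delta> \<Longrightarrow> kinv (x (s + t)) = m (kinv (x s)) (kinv (x t))"
proof -
  have op_img: "open (snd k ` fst k)" "open (fst k)" using k(3) by (simp_all add: chart_ok_def)
  obtain r K where r: "r > 0" "cball (snd k e) r \<subseteq> snd k ` fst k"
    and lip: "\<And>x y. x \<in> cball (snd k e) r \<Longrightarrow> y \<in> cball (snd k e) r \<Longrightarrow> norm (V a x - V a y) \<le> K * norm (x - y)"
    using lipschitz_ball by metis
  define N1 where "N1 = fst k \<inter> snd k -` ball (snd k e) r"
  have "continuous_on (fst k) (snd k)" using k(3) by (simp add: chart_ok_def homeomorphism_def)
  then have N1: "open N1" unfolding N1_def by (rule continuous_open_preimage[OF _ op_img(2) open_ball])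
  have "continuous_on UNIV (\<lambda>(g, h). m g h)" using mul_smooth by (simp add: smooth_map_on_def)
  then have "open ((\<lambda>(g, h). m g h) -` N1)" using N1 by (simp add: open_vimage)
  moreover have "(e, e) \<in> (\<lambda>(g, h). m g h) -` N1" using r k by (simp add: N1_def)
  ultimately obtain U1 U2 where U12: "open U1" "open U2" "(e, e) \<in> U1 \<times> U2" "U1 \<times> U2 \<subseteq> (\<lambda>(g, h). m g h) -` N1"
    by (rule open_prod_elim) blast
  define U where "U = U1 \<inter> U2"
  have U: "open U" "e \<in> U" "\<And>g h. g \<in> U \<Longrightarrow> h \<in> U \<Longrightarrow> m g h \<in> N1" using U12 by (auto simp: U_def)
  have UN: "g \<in> N1" if "g \<in> U" for g using U(3)[OF that U(2)] by simp
  \<comment> \<open>The flow is confined to \<open>\<Omega>\<close>; then \<open>\<gamma>\<close>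
    takes values in \<open>U\<close>, and products of two of its values remain in the ball on which
    the field is Lipschitz.\<close>
  define \<Omega> where "\<Omega> = snd k ` (U \<inter> fst k)"
  have \<Omega>: "open \<Omega>" "snd k e \<in> \<Omega>" "\<Omega> \<subseteq> snd k ` fst k"
    using open_chart_image[OF k(3) U(1)] U(2) k(2) by (auto simp: \<Omega>_def)
  obtain \<delta> x where \<delta>: "\<delta> > 0" and x: "x 0 = snd k e" "\<And>t. t \<in> {0..\<delta>} \<Longrightarrow> x t \<in> \<Omega>"
    "\<And>t. t \<in> {0..\<delta>} \<Longrightarrow> (x has_vector_derivative V a (x t)) (at t within {0..\<delta>})"
    using local_flow[OF \<Omega>(1,2) smooth_on_subset[OF smooth_V \<Omega>(3)]] by blast
  have "k_smooth_on n {0..\<delta>} x" for n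
  proof (induction n)
    case 0
    show ?case using x(3) has_vector_derivative_continuous
      unfolding k_smooth_on.simps(1) continuous_on_eq_continuous_within by blast
  next
    case (Suc n)
    have "k_smooth_on n (snd k ` fst k) (V a)" using smooth_V unfolding smooth_on_def by blast
    then have "k_smooth_on n {0..\<delta>} (\<lambda>t. V a (x t))"
      by (rule k_smooth_on_compose[OF Suc]) (use x(2) \<Omega>(3) in blast)
    then show ?case
      by (rule k_smooth_on_SucI_vector_derivative[where g = "\<lambda>t. V a (x t)", rotated]) (rule x(3))
  qed
  then have smooth: "smooth_on {0..\<delta>} x" by (simp add: smooth_on_def)
  define \<gamma> where "\<gamma> t = kinv (x t)" for t
  have \<gamma>: "\<gamma> t \<in> U" "\<gamma> t \<in> fst k" "snd k (\<gamma> t) = x t" if "t \<in> {0..\<delta>}" for t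
    using x(2)[OF that] unfolding \<Omega>_def \<gamma>_def by (auto simp: chart_inv_chart[OF k(3)])
  have cont_\<gamma>: "continuous (at t within {0..\<delta>}) \<gamma>" if "t \<in> {0..\<delta>}" for t
  proof -
    have "isCont kinv (x t)" using isCont_chart_inv[OF k(3) \<gamma>(2)[OF that]] \<gamma>(3)[OF that] by simp
    moreover have "continuous (at t within {0..\<delta>}) x"
      using has_vector_derivative_continuous[OF x(3)[OF that]] .
    ultimately show ?thesis unfolding \<gamma>_def using continuous_within_compose3 by blast
  qed
  have "\<gamma> (s + t) = m (\<gamma> s) (\<gamma> t)" if st: "0 \<le> s" "0 \<le> t" "s + t \<le> \<delta>" for s t
  proof -
    have sd: "s \<in> {0..\<delta>}" using st by auto
    have mN: "m (\<gamma> s) (\<gamma> t) \<in> N1" if "t \<in> {0..\<delta>}" for t using U(3) \<gamma>(1) sd that by blast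
    have sub: "{0..\<delta> - s} \<subseteq> {0..\<delta>}" using st by auto
    have "x (s + t) = snd k (m (\<gamma> s) (\<gamma> t))"
    proof (rule ode_unique[where a = 0 and b = "\<delta> - s" and K = K])
      fix t assume t: "t \<in> {0..\<delta> - s}"
      have t': "t \<in> {0..\<delta>}" "s + t \<in> {0..\<delta>}" using t st by auto
      have "((\<lambda>t. s + t) has_vector_derivative 1) (at t within {0..\<delta> - s})"
        by (auto intro!: derivative_eq_intros)
      moreover have "(x has_vector_derivative V a (x (s + t))) (at (s + t) within (\<lambda>t. s + t) ` {0..\<delta> - s})"
        by (rule has_vector_derivative_within_subset[OF x(3)[OF t'(2)]]) (use st in auto)
      ultimately have "(x \<circ> (\<lambda>t. s + t) has_vector_derivative 1 *\<^sub>R V a (x (s + t))) (at t within {0..\<delta> - s})"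
        by (rule vector_diff_chain_within)
      then show "((\<lambda>t. x (s + t)) has_vector_derivative V a (x (s + t))) (at t within {0..\<delta> - s})"
        by (simp add: o_def)
      have "((\<lambda>t. snd k (\<gamma> t)) has_vector_derivative V a (snd k (\<gamma> t))) (at t within {0..\<delta>})"
        by (rule has_vector_derivative_transform[OF t'(1) _ x(3)[OF t'(1), folded \<gamma>(3)[OF t'(1)]]]) (simp add: \<gamma>)
      then have "((\<lambda>t. snd k (m (\<gamma> s) (\<gamma> t))) has_vector_derivative mder (\<lambda>h. m (\<gamma> s) h) k k (\<gamma> t) (V a (snd k (\<gamma> t))))
          (at t within {0..\<delta>})"
        by (rule has_vector_derivative_mder[OF k(3) t'(1) cont_\<gamma>[OF t'(1)]])
          (rule has_mder_left_mult[OF k(1) k(1)], use \<gamma> t' mN in \<open>auto simp: N1_def\<close>)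
      also have "mder (\<lambda>h. m (\<gamma> s) h) k k (\<gamma> t) (V a (snd k (\<gamma> t))) = V a (snd k (m (\<gamma> s) (\<gamma> t)))"
        by (rule V_left_invariant) (use \<gamma> sd t' mN in \<open>auto simp: N1_def\<close>)
      finally show "((\<lambda>t. snd k (m (\<gamma> s) (\<gamma> t))) has_vector_derivative V a (snd k (m (\<gamma> s) (\<gamma> t)))) (at t within {0..\<delta> - s})"
        by (rule has_vector_derivative_within_subset[OF _ sub])
      have "x (s + t) \<in> cball (snd k e) r"
        using UN[OF \<gamma>(1)[OF t'(2)]] \<gamma>(3)[OF t'(2)] by (simp add: N1_def)
      moreover have "snd k (m (\<gamma> s) (\<gamma> t)) \<in> cball (snd k e) r"
        using mN[OF t'(1)] by (simp add: N1_def)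
      ultimately show "norm (V a (x (s + t)) - V a (snd k (m (\<gamma> s) (\<gamma> t)))) \<le> K * norm (x (s + t) - snd k (m (\<gamma> s) (\<gamma> t)))"
        by (rule lip)
    next
      have "\<gamma> 0 = e" by (simp add: \<gamma>_def x(1) chart_inv_chart[OF k(3,2)])
      then show "x (s + 0) = snd k (m (\<gamma> s) (\<gamma> 0))" using \<gamma>(3)[OF sd] by simp
      show "t \<in> {0..\<delta> - s}" using st by auto
    qed
    moreover have "m (\<gamma> s) (\<gamma> t) \<in> fst k" using mN[of t] st by (simp add: N1_def)
    ultimately show ?thesis using chart_inv_chart[OF k(3)] by (simp add: \<gamma>_def)
  qed
  then show thesis
    using \<delta> x(1) smooth x(2) \<Omega>(3) x(3) unfolding \<gamma>_def by (intro that[of \<delta> x]) auto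
qed

text \<open>Around any time \<open>t1\<close> the extended homomorphism is a left translate of the
  local solution near \<open>\<delta> / 2\<close>, an interior time at which that solution is
  two-sided; continuity and smoothness are inherited from there.\<close>

lemma ops_exists: "\<exists>\<gamma>. ops \<gamma> \<and> velocity A UNIV \<gamma> 0 = a"
proof -
  obtain \<delta> x where \<delta>: "\<delta> > 0" and x: "x 0 = snd k e" "smooth_on {0..\<delta>} x"
    "\<And>t. t \<in> {0..\<delta>} \<Longrightarrow> x t \<in> snd k ` fst k"
    "\<And>t. t \<in> {0..\<delta>} \<Longrightarrow> (x has_vector_derivative V a (x t)) (at t within {0..\<delta>})"
    "\<And>s t. 0 \<le> s \<Longrightarrow> 0 \<le> t \<Longrightarrow> s + t \<le> \<delta> \<Longrightarrow> kinv (x (s + t)) = m (kinv (x s)) (kinv (x t))"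
    using local_ops[of a] by blast
  have x0: "kinv (x 0) = e" by (simp add: x(1) chart_inv_chart[OF k(3,2)])
  obtain \<Gamma> where \<Gamma>: "\<And>s t. \<Gamma> (s + t) = m (\<Gamma> s) (\<Gamma> t)" "\<And>t. t \<in> {0..\<delta>} \<Longrightarrow> \<Gamma> t = kinv (x t)"
    using extend_local_hom[OF \<delta>, of "\<lambda>t. kinv (x t)", OF x0 x(5)] by blast
  have \<Gamma>0: "\<Gamma> 0 = e" using \<Gamma>(2)[of 0] \<delta> x0 by simp
  have trans: "\<Gamma> t = m (\<Gamma> (t1 - \<delta> / 2)) (\<Gamma> (t - t1 + \<delta> / 2))" for t t1
    using \<Gamma>(1)[of "t1 - \<delta> / 2" "t - t1 + \<delta> / 2"] by simp
  have mem: "t - t1 + \<delta> / 2 \<in> {0..\<delta>}" if "t \<in> ball t1 (\<delta> / 2)" for t t1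
    using that unfolding mem_ball dist_real_def atLeastAtMost_iff abs_less_iff by linarith
  have loc: "\<Gamma> t = m (\<Gamma> (t1 - \<delta> / 2)) (kinv (x (t - t1 + \<delta> / 2)))" if "t \<in> ball t1 (\<delta> / 2)" for t t1
    using trans[of t t1] \<Gamma>(2)[OF mem[OF that]] by simp
  have sm: "smooth_map_on A A UNIV (\<lambda>h. m g h)" for g
    using smooth_map_second[OF A A A mul_smooth, of g] by simp
  have isCont: "isCont \<Gamma> t1" for t1
  proof -
    have d2: "\<delta> / 2 \<in> {0..\<delta>}" using \<delta> by simp
    have "isCont x (\<delta> / 2)"
    proof -
      have "continuous_on {0<..<\<delta>} x"
        by (rule continuous_on_subset[OF smooth_on_imp_continuous_on[OF x(2)]]) auto
      then show ?thesis using \<delta> by (simp add: continuous_on_eq_continuous_at)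
    qed
    then have "isCont x (t1 - t1 + \<delta> / 2)" by simp
    moreover have "isCont (\<lambda>t. t - t1 + \<delta> / 2) t1" by (intro continuous_intros)
    ultimately have "isCont (\<lambda>t. x (t - t1 + \<delta> / 2)) t1" using isCont_o2 by fast
    moreover have "isCont kinv (x (\<delta> / 2))"
      using isCont_chart_inv[OF k(3) chart_inv_in[OF k(3) x(3)[OF d2]]] chart_chart_inv[OF k(3) x(3)[OF d2]] by simp
    then have "isCont kinv (x (t1 - t1 + \<delta> / 2))" by simp
    ultimately have "isCont (\<lambda>t. kinv (x (t - t1 + \<delta> / 2))) t1" using isCont_o2 by fast
    moreover have "isCont (\<lambda>h. m (\<Gamma> (t1 - \<delta> / 2)) h) y" for y
      using sm by (simp add: smooth_map_on_def continuous_on_eq_continuous_at)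
    ultimately have *: "isCont (\<lambda>t. m (\<Gamma> (t1 - \<delta> / 2)) (kinv (x (t - t1 + \<delta> / 2)))) t1"
      using isCont_o2 by fast
    have "eventually (\<lambda>t. t \<in> ball t1 (\<delta> / 2)) (nhds t1)"
      by (rule eventually_nhds_in_open) (use \<delta> in auto)
    then have "eventually (\<lambda>t. \<Gamma> t = m (\<Gamma> (t1 - \<delta> / 2)) (kinv (x (t - t1 + \<delta> / 2)))) (nhds t1)"
      by eventually_elim (rule loc)
    from isCont_cong[OF this] * show ?thesis by simp
  qed
  then have cont: "continuous_on UNIV \<Gamma>" by (simp add: continuous_on_eq_continuous_at)
  have "smooth_map_on line_atlas A UNIV \<Gamma>"
    unfolding smooth_map_on_def
  proof (intro conjI ballI cont)
    fix c :: "(real, real) chart" and d' assume c: "c \<in> line_atlas" and d: "d' \<in> A"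
    have inv: "chart_inv (UNIV, id) = (id :: real \<Rightarrow> real)"
      by (simp add: chart_inv_def fun_eq_iff inv_id[unfolded id_def] id_def)
    have op: "open (\<Gamma> -` fst d')"
      using cont smooth_atlas_chart_ok[OF A d] by (auto simp: chart_ok_def intro: open_vimage)
    have "smooth_on (\<Gamma> -` fst d') (\<lambda>t. snd d' (\<Gamma> t))"
    proof (rule smooth_on_local[OF thick_open[OF op]])
      fix t1 assume t1: "t1 \<in> \<Gamma> -` fst d'"
      let ?W = "ball t1 (\<delta> / 2)" and ?g = "\<Gamma> (t1 - \<delta> / 2)"
      let ?S = "snd k ` (UNIV \<inter> fst k \<inter> (\<lambda>h. m ?g h) -` fst d')"
      have "smooth_on ?S (snd d' \<circ> (\<lambda>h. m ?g h) \<circ> kinv)"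
        using sm[of ?g] k(1) d unfolding smooth_map_on_def by blast
      then have S: "smooth_on ?S (\<lambda>y. snd d' (m ?g (kinv y)))" by (simp add: o_def)
      have "smooth_on (\<Gamma> -` fst d' \<inter> ?W) (\<lambda>t. snd d' (m ?g (kinv (x (t - t1 + \<delta> / 2)))))"
      proof (rule smooth_on_compose[OF _ S])
        show "smooth_on (\<Gamma> -` fst d' \<inter> ?W) (\<lambda>t. x (t - t1 + \<delta> / 2))"
          by (rule smooth_on_compose[OF _ x(2)])
            (intro smooth_on_add smooth_on_diff smooth_on_ident smooth_on_const, use mem in blast)
        show "(\<lambda>t. x (t - t1 + \<delta> / 2)) ` (\<Gamma> -` fst d' \<inter> ?W) \<subseteq> ?S"
        proof
          fix y assume "y \<in> (\<lambda>t. x (t - t1 + \<delta> / 2)) ` (\<Gamma> -` fst d' \<inter> ?W)"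
          then obtain t where t: "y = x (t - t1 + \<delta> / 2)" "\<Gamma> t \<in> fst d'" "t \<in> ?W" by blast
          obtain g where "g \<in> fst k" "y = snd k g" using x(3)[OF mem[OF t(3)]] t(1) by blast
          then show "y \<in> ?S" using loc[OF t(3)] t by (auto simp: chart_inv_chart[OF k(3)])
        qed
      qed
      then have "smooth_on (\<Gamma> -` fst d' \<inter> ?W) (\<lambda>t. snd d' (\<Gamma> t))"
        by (rule smooth_on_eqI) (use loc in auto)
      then show "\<exists>W. open W \<and> t1 \<in> W \<and> smooth_on (\<Gamma> -` fst d' \<inter> W) (\<lambda>t. snd d' (\<Gamma> t))"
        using \<delta> by (intro exI[of _ ?W]) auto
    qed
    then show "smooth_on (snd c ` (UNIV \<inter> fst c \<inter> \<Gamma> -` fst d')) (snd d' \<circ> \<Gamma> \<circ> chart_inv c)"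
      using c by (simp add: line_atlas_def inv o_def)
  qed
  then have ops: "ops \<Gamma>" using \<Gamma> \<Gamma>0 by (simp add: ops_def)
  have "((\<lambda>s. snd k (\<Gamma> s)) has_vector_derivative coords_in A k (\<Gamma> 0) (velocity A UNIV \<Gamma> 0)) (at 0)"
    by (rule smooth_curve_velocity[OF A thick_UNIV _ k(1)]) (use ops k in \<open>auto simp: ops_def\<close>)
  then have "((\<lambda>s. snd k (\<Gamma> s)) has_vector_derivative velocity A UNIV \<Gamma> 0) (at 0)"
    using k by (simp add: \<Gamma>0 coords_in_eq k_def ctrans_self[OF A])
  \<comment> \<open>A one-sided derivative suffices: on \<open>{0..\<delta>}\<close> the curve is
    the local solution, whose initial velocity is \<open>a\<close>, and derivatives within this
    interval are unique.\<close>
  then have 1: "((\<lambda>s. snd k (\<Gamma> s)) has_vector_derivative velocity A UNIV \<Gamma> 0) (at 0 within {0..\<delta>})"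
    by (rule has_vector_derivative_at_within)
  have 0: "0 \<in> {0..\<delta>}" using \<delta> by simp
  have "(x has_vector_derivative velocity A UNIV \<Gamma> 0) (at 0 within {0..\<delta>})"
    by (rule has_vector_derivative_transform[OF 0 _ 1]) (simp add: \<Gamma>(2) chart_chart_inv[OF k(3) x(3)])
  moreover have "(x has_vector_derivative a) (at 0 within {0..\<delta>})"
    using x(4)[OF 0] by (simp add: x(1) V_unit)
  ultimately have "velocity A UNIV \<Gamma> 0 = a"
    using thick_vector_derivative[OF thick_interval[OF \<delta>] 0] by metis
  with ops show ?thesis by blast
qed

lemma ops_scale:
  assumes "ops \<gamma>"
  shows "ops (\<lambda>s. \<gamma> (t * s))" "velocity A UNIV (\<lambda>s. \<gamma> (t * s)) 0 = t *\<^sub>R velocity A UNIV \<gamma> 0"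
proof -
  have \<gamma>: "smooth_map_on line_atlas A UNIV \<gamma>" "\<gamma> 0 = e" "\<And>s t. \<gamma> (s + t) = m (\<gamma> s) (\<gamma> t)"
    using assms by (auto simp: ops_def)
  have "smooth_on UNIV (\<lambda>s. t * s)" by (rule smooth_on_bounded_linear[OF bounded_linear_mult_right])
  from smooth_map_on_curve_compose[OF \<gamma>(1) this]
  show "ops (\<lambda>s. \<gamma> (t * s))" unfolding ops_def by (simp add: \<gamma> algebra_simps)
  have "((\<lambda>s. snd k (\<gamma> s)) has_vector_derivative coords_in A k (\<gamma> 0) (velocity A UNIV \<gamma> 0)) (at 0)"
    by (rule smooth_curve_velocity[OF A thick_UNIV \<gamma>(1) k(1)]) (simp_all add: \<gamma> k)
  then have D: "((\<lambda>s. snd k (\<gamma> s)) has_vector_derivative velocity A UNIV \<gamma> 0) (at (t * 0))"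
    using k by (simp add: \<gamma> coords_in_eq k_def ctrans_self[OF A])
  have "((\<lambda>s. t * s) has_vector_derivative t) (at 0)" by (auto intro!: derivative_eq_intros)
  from vector_diff_chain_at[OF this D]
  have "((\<lambda>s. snd k (\<gamma> (t * s))) has_vector_derivative t *\<^sub>R velocity A UNIV \<gamma> 0) (at 0)" by (simp add: o_def)
  then show "velocity A UNIV (\<lambda>s. \<gamma> (t * s)) 0 = t *\<^sub>R velocity A UNIV \<gamma> 0"
    unfolding velocity_def by (simp add: \<gamma> o_def vector_derivative_at flip: k_def)
qed

text \<open>The subgroup with initial velocity \<open>t *\<^sub>R a\<close> is
  \<open>s \<mapsto> \<gamma> (t * s)\<close>, so a single smooth curve describes the exponential on
  the line through \<open>a\<close>. The definite description is spelled out so as to match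
  \<open>lie_exp\<close>.\<close>

lemma exp_curve:
  obtains \<gamma> where "ops \<gamma>" "((\<lambda>s. snd k (\<gamma> s)) has_vector_derivative a) (at 0)"
    "\<And>t. (THE \<gamma>. ops \<gamma> \<and> velocity A UNIV \<gamma> 0 = t *\<^sub>R a) 1 = \<gamma> t"
proof -
  obtain \<gamma> where \<gamma>: "ops \<gamma>" "velocity A UNIV \<gamma> 0 = a" using ops_exists by blast
  have "\<gamma> 0 = e" using \<gamma> by (simp add: ops_def)
  then have "((\<lambda>s. snd k (\<gamma> s)) has_vector_derivative a) (at 0)"
    using ops_has_derivative[OF \<gamma>, of 0] k V_unit by simp
  moreover have "(THE \<gamma>. ops \<gamma> \<and> velocity A UNIV \<gamma> 0 = t *\<^sub>R a) 1 = \<gamma> t" for t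
  proof -
    have "(THE \<gamma>. ops \<gamma> \<and> velocity A UNIV \<gamma> 0 = t *\<^sub>R a) = (\<lambda>s. \<gamma> (t * s))"
      using ops_scale[OF \<gamma>(1), of t] \<gamma>(2) ops_unique by (intro the_equality) auto
    then show ?thesis by simp
  qed
  ultimately show thesis using that \<gamma>(1) by blast
qed

end

section \<open>Connection form and horizontal lift of a principal bundle in charts\<close>

section \<open>Principal bundles in local coordinates\<close>

locale horizontal_bundle =
  fixes P :: "('q::{t2_space,second_countable_topology}, 'eq::finite_euclidean,
      'm::{t2_space,second_countable_topology}, 'em::finite_euclidean,
      'g::{t2_space,second_countable_topology}, 'eg::finite_euclidean) bundle_data"
    and H :: "'q \<Rightarrow> 'eq set"
  assumes pb: "principal_bundle P" and hd: "horizontal_distribution P H"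
begin

lemma totA: "smooth_atlas (tot P)" and baseA: "smooth_atlas (base P)"
  and lie_group_grp: "lie_group (grp P) (mul P) (unit P) (ginv P)"
  and proj_smooth: "smooth_map_on (tot P) (base P) UNIV (proj P)"
  and act_smooth: "smooth_map_on (prod_atlas (tot P) (grp P)) (tot P) UNIV (\<lambda>(q, g). act P q g)"
  and act_unit [simp]: "act P q (unit P) = q"
  and proj_act [simp]: "proj P (act P q g) = proj P q"
  using pb by (auto simp: principal_bundle_def)

sublocale lie: lie_grp "grp P" "mul P" "unit P" "ginv P"
  by (rule lie_grp.intro) (rule lie_group_grp)

lemma grpA: "smooth_atlas (grp P)" by (rule lie.A)

lemma okQ: "c \<in> tot P \<Longrightarrow> chart_ok c" and okM: "d \<in> base P \<Longrightarrow> chart_ok d" and okG: "e \<in> grp P \<Longrightarrow> chart_ok e"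
  using smooth_atlas_chart_ok totA baseA grpA by blast+

subsection \<open>The fundamental vector fields\<close>

text \<open>The fundamental fields in coordinates. As derivatives of the orbit map at the unit they
  are visibly linear in the Lie algebra element and smooth in the point, which the definition
  through \<open>lie_exp\<close> does not show; \<open>coords_fundamental\<close> relates the
  two.\<close>

definition alpha :: "('q, 'eq) chart \<Rightarrow> 'q \<Rightarrow> 'eg \<Rightarrow> 'eq" where
  "alpha c q = mder (\<lambda>g. act P q g) lie.k c (unit P)"

lemma has_mder_act:
  assumes "c \<in> tot P" "q \<in> fst c"
  shows "has_mder (\<lambda>g. act P q g) lie.k c (unit P) (alpha c q)"
proof -
  have "has_mder (\<lambda>g. act P q g) lie.k c (unit P)
      (\<lambda>v. mder (\<lambda>(q, g). act P q g) (prod_chart c lie.k) c (q, unit P) (0, v))"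
    using has_mder_second[OF totA grpA totA act_smooth assms(1) lie.k(1) assms(1) assms(2) lie.k(2)] assms by simp
  then show ?thesis unfolding alpha_def using has_mder_eq_mder by metis
qed

lemma linear_alpha: "c \<in> tot P \<Longrightarrow> q \<in> fst c \<Longrightarrow> linear (alpha c q)"
  using has_mder_linear[OF has_mder_act] .

lemma smooth_alpha: "c \<in> tot P \<Longrightarrow> smooth_on (snd c ` fst c) (\<lambda>x. alpha c (chart_inv c x) a)"
  using smooth_on_mder_second[OF totA grpA totA act_smooth _ lie.k(1) _ lie.k(2), of c c a]
  by (simp add: alpha_def)

lemma ops_eq: "one_parameter_subgroup P = lie.ops"
  by (simp add: fun_eq_iff one_parameter_subgroup_def lie.ops_def)

lemma orbit_derivative:
  assumes "c \<in> tot P" "q \<in> fst c"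
  shows "((\<lambda>t. snd c (act P q (lie_exp P (t *\<^sub>R a)))) has_vector_derivative alpha c q a) (at 0)"
    and "isCont (\<lambda>t. act P q (lie_exp P (t *\<^sub>R a))) 0" and "lie_exp P 0 = unit P"
proof -
  obtain \<gamma> where \<gamma>: "lie.ops \<gamma>" "((\<lambda>s. snd lie.k (\<gamma> s)) has_vector_derivative a) (at 0)"
    "\<And>t. (THE \<gamma>. lie.ops \<gamma> \<and> velocity (grp P) UNIV \<gamma> 0 = t *\<^sub>R a) 1 = \<gamma> t"
    using lie.exp_curve by blast
  have e: "lie_exp P (t *\<^sub>R a) = \<gamma> t" for t
    unfolding lie_exp_def ops_eq by (rule \<gamma>(3))
  have \<gamma>0: "\<gamma> 0 = unit P" and cont: "isCont \<gamma> 0"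
    using \<gamma>(1) by (auto simp: lie.ops_def smooth_map_on_def continuous_on_eq_continuous_at)
  show "lie_exp P 0 = unit P" using e[of 0] \<gamma>0 by simp
  have D: "has_mder (\<lambda>g. act P q g) lie.k c (\<gamma> 0) (alpha c q)"
    unfolding \<gamma>0 by (rule has_mder_act[OF assms])
  from has_vector_derivative_mder[OF lie.k(3) UNIV_I cont \<gamma>(2) D]
  show "((\<lambda>t. snd c (act P q (lie_exp P (t *\<^sub>R a)))) has_vector_derivative alpha c q a) (at 0)"
    unfolding e .
  have "isCont (\<lambda>g. act P q g) (\<gamma> 0)" using D by (simp add: has_mder_def)
  then show "isCont (\<lambda>t. act P q (lie_exp P (t *\<^sub>R a))) 0"
    unfolding e using isCont_o2[OF cont, of "act P q"] by simp
qed

lemma coords_fundamental: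
  assumes c: "c \<in> tot P" "q \<in> fst c"
  shows "coords_in (tot P) c q (fundamental_field P a q) = alpha c q a"
proof -
  let ?c = "chart_at (tot P) q"
  have c': "?c \<in> tot P" "q \<in> fst ?c" using chart_at_in[OF totA] by auto
  have "fundamental_field P a q = alpha ?c q a"
    unfolding fundamental_field_def velocity_def
    using vector_derivative_at[OF orbit_derivative(1)[OF c', of a]] orbit_derivative(3)[OF c'] by (simp add: o_def)
  moreover have "alpha c q a = ctrans ?c c q (alpha ?c q a)"
  proof -
    have "has_mder (\<lambda>g. act P q g) lie.k c (unit P) (\<lambda>v. ctrans ?c c q (alpha ?c q v))"
      by (rule has_mder_chain[OF lie.k(3) okQ[OF c'(1)] has_mder_act[OF c']])
        (simp add: has_mder_ctrans[OF totA] c c')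
    from has_mder_unique[OF has_mder_act[OF c] this] show ?thesis by metis
  qed
  ultimately show ?thesis by (simp add: coords_in_eq)
qed

subsection \<open>Vertical vectors\<close>

lemma has_mder_proj:
  assumes "c \<in> tot P" "d \<in> base P" "q \<in> fst c" "proj P q \<in> fst d"
  shows "has_mder (proj P) c d q (mder (proj P) c d q)"
  by (rule smooth_map_on_has_mder[OF proj_smooth open_UNIV okQ[OF assms(1)] okM[OF assms(2)]]) (use assms in auto)

lemma coords_tangent_map:
  assumes "c \<in> tot P" "d \<in> base P" "q \<in> fst c" "proj P q \<in> fst d"
  shows "coords_in (base P) d (proj P q) (tangent_map (tot P) (base P) (proj P) q v) =
    mder (proj P) c d q (coords_in (tot P) c q v)"
  by (rule tangent_map_coords[OF totA baseA has_mder_proj[OF assms] assms(1,2)])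

lemma linear_tangent_proj: "linear (tangent_map (tot P) (base P) (proj P) q)"
  unfolding tangent_map_eq
  by (rule has_mder_linear[OF has_mder_proj]) (auto simp: chart_at_in[OF totA] chart_at_in[OF baseA])

lemma vertical_iff:
  assumes "c \<in> tot P" "d \<in> base P" "q \<in> fst c" "proj P q \<in> fst d"
  shows "v \<in> vertical P q \<longleftrightarrow> mder (proj P) c d q (coords_in (tot P) c q v) = 0"
  unfolding vertical_def mem_Collect_eq coords_tangent_map[OF assms, symmetric]
  using coords_in_inj[OF baseA assms(2,4), of _ 0] linear_0[OF linear_coords_in[OF baseA assms(2,4)]] by metis

lemma proj_alpha:
  assumes "c \<in> tot P" "d \<in> base P" "q \<in> fst c" "proj P q \<in> fst d"
  shows "mder (proj P) c d q (alpha c q a) = 0"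
proof -
  have "has_mder (\<lambda>g. proj P (act P q g)) lie.k d (unit P) (\<lambda>a. mder (proj P) c d q (alpha c q a))"
    by (rule has_mder_chain[OF lie.k(3) okQ[OF assms(1)] has_mder_act[OF assms(1,3)]])
      (simp add: has_mder_proj assms)
  moreover have "has_mder (\<lambda>g. proj P (act P q g)) lie.k d (unit P) (\<lambda>a. 0)"
    using has_mder_const[OF lie.k(2) assms(4)] by simp
  ultimately show ?thesis by (metis has_mder_unique)
qed

lemma trivialization:
  obtains V \<tau> \<kappa> where "open V" "x \<in> V" "smooth_map_on (tot P) (grp P) (proj P -` V) \<tau>"
    "smooth_map_on (prod_atlas (base P) (grp P)) (tot P) (V \<times> UNIV) \<kappa>"
    "\<And>q. proj P q \<in> V \<Longrightarrow> \<kappa> (proj P q, \<tau> q) = q"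
    "\<And>y g. y \<in> V \<Longrightarrow> proj P (\<kappa> (y, g)) = y"
    "\<And>q g. proj P q \<in> V \<Longrightarrow> \<tau> (act P q g) = mul P (\<tau> q) g"
proof -
  have "\<exists>V \<tau> \<kappa>. open V \<and> x \<in> V \<and>
       smooth_map_on (tot P) (grp P) (proj P -` V) \<tau> \<and>
       smooth_map_on (prod_atlas (base P) (grp P)) (tot P) (V \<times> UNIV) \<kappa> \<and>
       (\<forall>q. proj P q \<in> V \<longrightarrow> \<kappa> (proj P q, \<tau> q) = q) \<and>
       (\<forall>y\<in>V. \<forall>g. proj P (\<kappa> (y, g)) = y \<and> \<tau> (\<kappa> (y, g)) = g) \<and>
       (\<forall>q g. proj P q \<in> V \<longrightarrow> \<tau> (act P q g) = mul P (\<tau> q) g)"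
    using pb unfolding principal_bundle_def by blast
  then obtain V \<tau> \<kappa> where V: "open V" "x \<in> V" "smooth_map_on (tot P) (grp P) (proj P -` V) \<tau>"
    "smooth_map_on (prod_atlas (base P) (grp P)) (tot P) (V \<times> UNIV) \<kappa>"
    "\<forall>q. proj P q \<in> V \<longrightarrow> \<kappa> (proj P q, \<tau> q) = q"
    "\<forall>y\<in>V. \<forall>g. proj P (\<kappa> (y, g)) = y \<and> \<tau> (\<kappa> (y, g)) = g"
    "\<forall>q g. proj P q \<in> V \<longrightarrow> \<tau> (act P q g) = mul P (\<tau> q) g"
    by (elim exE conjE)
  then show thesis by (intro that[of V \<tau> \<kappa>]) simp_all
qed

lemma isCont_proj: "continuous_on UNIV (proj P)"
  using proj_smooth by (simp add: smooth_map_on_def)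

lemma open_proj_vimage: "open V \<Longrightarrow> open (proj P -` V)"
  using isCont_proj by (rule open_vimage[rotated])

lemma left_mult_inverse:
  assumes "e \<in> grp P" "g \<in> fst e"
  shows "mder (\<lambda>h. mul P (ginv P g) h) e lie.k g (mder (\<lambda>h. mul P g h) lie.k e (unit P) a) = a"
    and "mder (\<lambda>h. mul P g h) lie.k e (unit P) (mder (\<lambda>h. mul P (ginv P g) h) e lie.k g v) = v"
proof -
  have 1: "has_mder (\<lambda>h. mul P g h) lie.k e (unit P) (mder (\<lambda>h. mul P g h) lie.k e (unit P))"
    by (rule lie.has_mder_left_mult) (use assms lie.k in auto)
  have 2: "has_mder (\<lambda>h. mul P (ginv P g) h) e lie.k g (mder (\<lambda>h. mul P (ginv P g) h) e lie.k g)"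
    by (rule lie.has_mder_left_mult) (use assms lie.k in \<open>auto simp: lie.left_inverse\<close>)
  have "has_mder (\<lambda>h. mul P (ginv P g) (mul P g h)) lie.k lie.k (unit P)
      (\<lambda>a. mder (\<lambda>h. mul P (ginv P g) h) e lie.k g (mder (\<lambda>h. mul P g h) lie.k e (unit P) a))"
    by (rule has_mder_chain[OF lie.k(3) okG[OF assms(1)] 1]) (simp add: 2)
  moreover have "(\<lambda>h. mul P (ginv P g) (mul P g h)) = (\<lambda>h. h)"
    by (simp add: fun_eq_iff lie.left_inverse flip: lie.assoc)
  ultimately show "mder (\<lambda>h. mul P (ginv P g) h) e lie.k g (mder (\<lambda>h. mul P g h) lie.k e (unit P) a) = a"
    using has_mder_ident[OF lie.k(3,2)] has_mder_unique by metis
  have "has_mder (\<lambda>h. mul P g (mul P (ginv P g) h)) e e g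
      (\<lambda>v. mder (\<lambda>h. mul P g h) lie.k e (unit P) (mder (\<lambda>h. mul P (ginv P g) h) e lie.k g v))"
    by (rule has_mder_chain[OF okG[OF assms(1)] lie.k(3) 2]) (simp add: 1 lie.left_inverse)
  moreover have "(\<lambda>h. mul P g (mul P (ginv P g) h)) = (\<lambda>h. h)"
    by (simp add: fun_eq_iff lie.right_inverse flip: lie.assoc)
  ultimately show "mder (\<lambda>h. mul P g h) lie.k e (unit P) (mder (\<lambda>h. mul P (ginv P g) h) e lie.k g v) = v"
    using has_mder_ident[OF okG[OF assms(1)] assms(2)] has_mder_unique by metis
qed

text \<open>By equivariance of the group component \<open>\<tau>\<close> of a trivialization, its
  derivative composed with \<open>alpha\<close> is the derivative of the left translation by
  \<open>\<tau> q\<close>, which is invertible. Through \<open>\<kappa>\<close> a vector is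
  recovered from its projection and its image under the derivative of \<open>\<tau>\<close>, so a
  vertical vector is determined by the latter.\<close>

lemma
  assumes "c \<in> tot P" "d \<in> base P" "q \<in> fst c" "proj P q \<in> fst d"
  shows alpha_inj: "alpha c q a = 0 \<Longrightarrow> a = 0"
    and alpha_surj: "mder (proj P) c d q v = 0 \<Longrightarrow> \<exists>a. v = alpha c q a"
proof -
  obtain V \<tau> \<kappa> where V: "open V" "proj P q \<in> V" "smooth_map_on (tot P) (grp P) (proj P -` V) \<tau>"
    "smooth_map_on (prod_atlas (base P) (grp P)) (tot P) (V \<times> UNIV) \<kappa>"
    "\<And>q. proj P q \<in> V \<Longrightarrow> \<kappa> (proj P q, \<tau> q) = q"
    "\<And>q g. proj P q \<in> V \<Longrightarrow> \<tau> (act P q g) = mul P (\<tau> q) g"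
    using trivialization[of "proj P q"] by metis
  let ?e = "chart_at (grp P) (\<tau> q)"
  have e: "?e \<in> grp P" "\<tau> q \<in> fst ?e" using chart_at_in[OF grpA] by auto
  let ?T = "mder \<tau> c ?e q" and ?L = "mder (\<lambda>h. mul P (\<tau> q) h) lie.k ?e (unit P)"
  let ?L' = "mder (\<lambda>h. mul P (ginv P (\<tau> q)) h) ?e lie.k (\<tau> q)"
  let ?K = "mder \<kappa> (prod_chart d ?e) c (proj P q, \<tau> q)"
  have T: "has_mder \<tau> c ?e q ?T"
    by (rule smooth_map_on_has_mder[OF V(3) open_proj_vimage[OF V(1)] okQ[OF assms(1)] okG[OF e(1)]])
      (use assms e V in auto)
  have L: "?T (alpha c q a) = ?L a" for a
  proof -
    have "has_mder (\<lambda>g. \<tau> (act P q g)) lie.k ?e (unit P) (\<lambda>a. ?T (alpha c q a))"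
      by (rule has_mder_chain[OF lie.k(3) okQ[OF assms(1)] has_mder_act[OF assms(1,3)]]) (simp add: T)
    then have "has_mder (\<lambda>g. mul P (\<tau> q) g) lie.k ?e (unit P) (\<lambda>a. ?T (alpha c q a))"
      by (simp add: V)
    from has_mder_eq_mder[OF this] show ?thesis by simp
  qed
  have L'L: "?L' (?L a) = a" and LL': "?L (?L' v) = v" for a v
    using left_mult_inverse[OF e] by auto
  have T0: "?T 0 = 0" "?L' 0 = 0"
    using linear_0[OF has_mder_linear[OF T]]
      linear_0[OF has_mder_linear[OF lie.has_mder_left_mult[OF e(1) lie.k(1) e(2), of "ginv P (\<tau> q)"]]]
    by (simp_all add: lie.left_inverse lie.k)
  show "a = 0" if "alpha c q a = 0"
    using L[of a] L'L[of a] T0 that by simp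
  have okp: "chart_ok (prod_chart d ?e)" by (rule chart_ok_prod[OF okM[OF assms(2)] okG[OF e(1)]])
  have K: "has_mder \<kappa> (prod_chart d ?e) c (proj P q, \<tau> q) ?K"
    by (rule smooth_map_on_has_mder[OF V(4) _ okp okQ[OF assms(1)] prod_chart_in[OF assms(2) e(1)] assms(1)])
      (use V assms e in \<open>auto intro: open_Times\<close>)
  have "has_mder (\<lambda>q. \<kappa> (proj P q, \<tau> q)) c c q (\<lambda>v. ?K (mder (proj P) c d q v, ?T v))"
    by (rule has_mder_chain[OF okQ[OF assms(1)] okp has_mder_Pair[OF has_mder_proj[OF assms] T] K])
  then have "has_mder (\<lambda>q. q) c c q (\<lambda>v. ?K (mder (proj P) c d q v, ?T v))"
    by (rule has_mder_cong[OF okQ[OF assms(1)] _ open_proj_vimage[OF V(1)]]) (use V in auto)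
  from fun_cong[OF has_mder_unique[OF this has_mder_ident[OF okQ[OF assms(1)] assms(3)]]]
  have KK: "?K (mder (proj P) c d q v, ?T v) = v" for v .
  show "\<exists>a. v = alpha c q a" if v: "mder (proj P) c d q v = 0"
  proof
    have "alpha c q (?L' (?T v)) = ?K (0, ?T (alpha c q (?L' (?T v))))"
      using KK[of "alpha c q (?L' (?T v))"] proj_alpha[OF assms] by simp
    also have "?T (alpha c q (?L' (?T v))) = ?T v" by (simp add: L LL')
    also have "?K (0, ?T v) = v" using KK[of v] v by simp
    finally show "v = alpha c q (?L' (?T v))" by simp
  qed
qed

text \<open>Freezing the group component in \<open>\<kappa>\<close> gives a local section through
  each point; the derivatives of these sections form a smooth right inverse of the derivative of the
  projection. It need not be horizontal; \<open>smooth_hhat\<close> subtracts its vertical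
  part.\<close>

lemma local_lift:
  assumes "c \<in> tot P" "d \<in> base P" "q0 \<in> fst c" "proj P q0 \<in> fst d"
  shows "\<exists>W \<sigma>. open W \<and> q0 \<in> W \<and> W \<subseteq> fst c \<inter> proj P -` fst d \<and> (\<forall>u. smooth_on (snd c ` W) (\<lambda>x. \<sigma> x u)) \<and>
    (\<forall>q\<in>W. \<forall>u. mder (proj P) c d q (\<sigma> (snd c q) u) = u)"
proof -
  obtain V \<tau> \<kappa> where V: "open V" "proj P q0 \<in> V" "smooth_map_on (tot P) (grp P) (proj P -` V) \<tau>"
    "smooth_map_on (prod_atlas (base P) (grp P)) (tot P) (V \<times> UNIV) \<kappa>"
    "\<And>q. proj P q \<in> V \<Longrightarrow> \<kappa> (proj P q, \<tau> q) = q" "\<And>y g. y \<in> V \<Longrightarrow> proj P (\<kappa> (y, g)) = y"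
    using trivialization[of "proj P q0"] by metis
  let ?e = "chart_at (grp P) (\<tau> q0)"
  have e: "?e \<in> grp P" "\<tau> q0 \<in> fst ?e" using chart_at_in[OF grpA] by auto
  have ok: "chart_ok c" "chart_ok d" "chart_ok ?e" using okQ okM okG assms e by blast+
  have okp: "chart_ok (prod_chart d ?e)" by (rule chart_ok_prod[OF ok(2,3)])
  define W where "W = (proj P -` V \<inter> \<tau> -` fst ?e) \<inter> (fst c \<inter> proj P -` fst d)"
  have "open (proj P -` V \<inter> \<tau> -` fst ?e)"
    using V(3) ok(3) by (intro continuous_open_preimage open_proj_vimage V(1)) (auto simp: smooth_map_on_def chart_ok_def)
  then have W: "open W" "q0 \<in> W" "W \<subseteq> fst c \<inter> proj P -` fst d"
    unfolding W_def using ok V assms e by (auto simp: chart_ok_def intro!: open_Int open_proj_vimage)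
  define \<sigma> where "\<sigma> x u = mder \<kappa> (prod_chart d ?e) c (proj P (chart_inv c x), \<tau> (chart_inv c x)) (u, 0)" for x u
  have "mder (proj P) c d q (\<sigma> (snd c q) u) = u" if q: "q \<in> W" for q u
  proof -
    have q': "q \<in> fst c" "proj P q \<in> fst d" "proj P q \<in> V" "\<tau> q \<in> fst ?e" using q by (auto simp: W_def)
    let ?K = "mder \<kappa> (prod_chart d ?e) c (proj P q, \<tau> q)"
    have K: "has_mder \<kappa> (prod_chart d ?e) c (proj P q, \<tau> q) ?K"
      by (rule smooth_map_on_has_mder[OF V(4) _ okp ok(1) prod_chart_in[OF assms(2) e(1)] assms(1)])
        (use V q' in \<open>auto intro: open_Times\<close>)
    have "has_mder (\<lambda>y. \<kappa> (y, \<tau> q)) d c (proj P q) (\<lambda>u. ?K (u, 0))"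
      by (rule has_mder_chain[OF ok(2) okp has_mder_Pair[OF has_mder_ident[OF ok(2) q'(2)] has_mder_const[OF q'(2,4)]] K])
    then have "has_mder (\<lambda>y. proj P (\<kappa> (y, \<tau> q))) d d (proj P q) (\<lambda>u. mder (proj P) c d q (?K (u, 0)))"
      by (rule has_mder_chain[OF ok(2) ok(1)]) (use q' V has_mder_proj[OF assms(1,2)] in simp)
    then have "has_mder (\<lambda>y. y) d d (proj P q) (\<lambda>u. mder (proj P) c d q (?K (u, 0)))"
      by (rule has_mder_cong[OF ok(2) _ V(1) q'(3)]) (use V in auto)
    from fun_cong[OF has_mder_unique[OF this has_mder_ident[OF ok(2) q'(2)]]]
    have "mder (proj P) c d q (?K (u, 0)) = u" .
    then show ?thesis by (simp add: \<sigma>_def chart_inv_chart[OF ok(1) q'(1)])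
  qed
  moreover have "smooth_on (snd c ` W) (\<lambda>x. \<sigma> x u)" for u
  proof (rule smooth_on_eqI)
    let ?S = "snd (prod_chart d ?e) ` ((V \<times> UNIV) \<inter> fst (prod_chart d ?e) \<inter> \<kappa> -` fst c)"
    have K: "smooth_on ?S (\<lambda>z. mder \<kappa> (prod_chart d ?e) c (chart_inv (prod_chart d ?e) z) (u, 0))"
      by (rule smooth_on_mder[OF V(4) _ okp ok(1) prod_chart_in[OF assms(2) e(1)] assms(1)])
        (use V(1) in \<open>auto intro: open_Times\<close>)
    let ?h = "\<lambda>x. (snd d (proj P (chart_inv c x)), snd ?e (\<tau> (chart_inv c x)))"
    have "smooth_on (snd c ` (UNIV \<inter> fst c \<inter> proj P -` fst d)) (snd d \<circ> proj P \<circ> chart_inv c)"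
      using proj_smooth assms by (simp add: smooth_map_on_def)
    then have "smooth_on (snd c ` W) (\<lambda>x. snd d (proj P (chart_inv c x)))"
      unfolding o_def by (rule smooth_on_subset) (auto simp: W_def)
    moreover have "smooth_on (snd c ` (proj P -` V \<inter> fst c \<inter> \<tau> -` fst ?e)) (snd ?e \<circ> \<tau> \<circ> chart_inv c)"
      using V(3) assms(1) e(1) by (simp add: smooth_map_on_def)
    then have "smooth_on (snd c ` W) (\<lambda>x. snd ?e (\<tau> (chart_inv c x)))"
      unfolding o_def by (rule smooth_on_subset) (auto simp: W_def)
    ultimately have "smooth_on (snd c ` W) ?h" by (rule smooth_on_Pair)
    then show "smooth_on (snd c ` W) (\<lambda>x. mder \<kappa> (prod_chart d ?e) c (chart_inv (prod_chart d ?e) (?h x)) (u, 0))"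
    proof (rule smooth_on_compose[OF _ K])
      show "?h ` snd c ` W \<subseteq> ?S"
      proof clarify
        fix q assume q: "q \<in> W"
        have "(proj P q, \<tau> q) \<in> (V \<times> UNIV) \<inter> fst (prod_chart d ?e) \<inter> \<kappa> -` fst c"
          using q V by (auto simp: W_def)
        then have "snd (prod_chart d ?e) (proj P q, \<tau> q) \<in> ?S" by (rule imageI)
        then show "?h (snd c q) \<in> ?S"
          using q by (simp add: W_def chart_inv_chart[OF ok(1)])
      qed
    qed
    fix x assume "x \<in> snd c ` W"
    then obtain q where q: "q \<in> W" "x = snd c q" by blast
    then show "mder \<kappa> (prod_chart d ?e) c (chart_inv (prod_chart d ?e) (?h x)) (u, 0) = \<sigma> x u"
      by (simp add: \<sigma>_def W_def chart_inv_prod[OF ok(2,3)] chart_inv_chart[OF ok(1)] chart_inv_chart[OF ok(2)] chart_inv_chart[OF ok(3)])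
  qed
  ultimately show ?thesis using W by blast
qed

subsection \<open>The splitting\<close>

lemma fundamental_eq:
  "c \<in> tot P \<Longrightarrow> q \<in> fst c \<Longrightarrow> fundamental_field P a q = from_coords (tot P) c q (alpha c q a)"
  by (metis coords_fundamental from_coords_coords_in[OF totA])

lemma linear_fundamental: "linear (\<lambda>a. fundamental_field P a q)"
proof -
  let ?c = "chart_at (tot P) q"
  have c: "?c \<in> tot P" "q \<in> fst ?c" using chart_at_in[OF totA] by auto
  show ?thesis
    unfolding fundamental_eq[OF c]
    using linear_compose[OF linear_alpha[OF c] linear_from_coords[OF totA c]] by (simp add: o_def)
qed

lemma vertical_eq: "vertical P q = range (\<lambda>a. fundamental_field P a q)"
proof -
  let ?c = "chart_at (tot P) q" and ?d = "chart_at (base P) (proj P q)"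
  have c: "?c \<in> tot P" "?d \<in> base P" "q \<in> fst ?c" "proj P q \<in> fst ?d"
    using chart_at_in[OF totA] chart_at_in[OF baseA] by auto
  have "v \<in> vertical P q \<longleftrightarrow> (\<exists>a. v = fundamental_field P a q)" for v
  proof
    assume "v \<in> vertical P q"
    then obtain a where "coords_in (tot P) ?c q v = alpha ?c q a"
      unfolding vertical_iff[OF c] using alpha_surj[OF c] by blast
    then have "v = fundamental_field P a q"
      unfolding coords_fundamental[OF c(1,3), symmetric] coords_in_inj[OF totA c(1,3)] .
    then show "\<exists>a. v = fundamental_field P a q" ..
  next
    assume "\<exists>a. v = fundamental_field P a q"
    then show "v \<in> vertical P q"
      unfolding vertical_iff[OF c] using proj_alpha[OF c] coords_fundamental[OF c(1,3)] by auto
  qed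
  then show ?thesis by auto
qed

lemma fundamental_inj: "fundamental_field P a q = 0 \<Longrightarrow> a = 0"
proof -
  let ?c = "chart_at (tot P) q" and ?d = "chart_at (base P) (proj P q)"
  have c: "?c \<in> tot P" "?d \<in> base P" "q \<in> fst ?c" "proj P q \<in> fst ?d"
    using chart_at_in[OF totA] chart_at_in[OF baseA] by auto
  assume "fundamental_field P a q = 0"
  then have "alpha ?c q a = 0"
    using coords_fundamental[OF c(1,3), of a] linear_0[OF linear_coords_in[OF totA c(1,3)]] by simp
  then show "a = 0" by (rule alpha_inj[OF c])
qed

lemma subspace_H: "subspace (H q)"
proof -
  obtain W k X where "q \<in> W" "\<forall>r\<in>W. H r = span ((\<lambda>i. X i r) ` {..<(k::nat)})"
    using hd unfolding horizontal_distribution_def smooth_distribution_def by metis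
  then show ?thesis by (simp add: subspace_span)
qed

lemma H_vertical: "v \<in> H q \<Longrightarrow> v \<in> vertical P q \<Longrightarrow> v = 0"
  using hd unfolding horizontal_distribution_def by blast

lemma H_vertical_decomp: obtains a where "v - fundamental_field P a q \<in> H q"
proof -
  have "v \<in> {h + v | h v. h \<in> H q \<and> v \<in> vertical P q}"
    using hd unfolding horizontal_distribution_def by blast
  then obtain h w where "v = h + w" "h \<in> H q" "w \<in> vertical P q" by blast
  moreover obtain a where "w = fundamental_field P a q" using \<open>w \<in> vertical P q\<close> vertical_eq by blast
  ultimately show thesis using that[of a] by simp
qed

lemma vert_part_unique:
  assumes "v - fundamental_field P a q \<in> H q" "v - fundamental_field P b q \<in> H q"
  shows "a = b"
proof -
  have "fundamental_field P (a - b) q = (v - fundamental_field P b q) - (v - fundamental_field P a q)"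
    by (simp add: linear_diff[OF linear_fundamental])
  then have "fundamental_field P (a - b) q \<in> H q" using subspace_diff[OF subspace_H] assms by metis
  then have "fundamental_field P (a - b) q = 0" by (rule H_vertical) (simp add: vertical_eq)
  from fundamental_inj[OF this] show ?thesis by simp
qed

lemma vert_part_eqI: "v - fundamental_field P a q \<in> H q \<Longrightarrow> vert_part P H q v = a"
  unfolding vert_part_def by (rule the_equality) (auto dest: vert_part_unique)

lemma vert_part_in: "v - fundamental_field P (vert_part P H q v) q \<in> H q"
  using H_vertical_decomp[of v q] vert_part_eqI by metis

lemma linear_vert_part: "linear (vert_part P H q)"
proof (rule linearI)
  fix v w :: 'eq and r :: real
  show "vert_part P H q (v + w) = vert_part P H q v + vert_part P H q w"
  proof (rule vert_part_eqI)
    have "v + w - fundamental_field P (vert_part P H q v + vert_part P H q w) q =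
        (v - fundamental_field P (vert_part P H q v) q) + (w - fundamental_field P (vert_part P H q w) q)"
      by (simp add: linear_add[OF linear_fundamental])
    then show "v + w - fundamental_field P (vert_part P H q v + vert_part P H q w) q \<in> H q"
      using subspace_add[OF subspace_H vert_part_in vert_part_in] by metis
  qed
  show "vert_part P H q (r *\<^sub>R v) = r *\<^sub>R vert_part P H q v"
  proof (rule vert_part_eqI)
    have "r *\<^sub>R v - fundamental_field P (r *\<^sub>R vert_part P H q v) q = r *\<^sub>R (v - fundamental_field P (vert_part P H q v) q)"
      by (simp add: linear_scale[OF linear_fundamental] scaleR_diff_right)
    then show "r *\<^sub>R v - fundamental_field P (r *\<^sub>R vert_part P H q v) q \<in> H q"
      using subspace_scale[OF subspace_H vert_part_in] by metis
  qed
qed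

lemma horizontal_lift_eqI:
  assumes "v \<in> H q" "tangent_map (tot P) (base P) (proj P) q v = u"
  shows "horizontal_lift P H q u = v"
  unfolding horizontal_lift_def
proof (rule the_equality)
  fix w assume w: "w \<in> H q \<and> tangent_map (tot P) (base P) (proj P) q w = u"
  have "w - v = 0"
  proof (rule H_vertical)
    show "w - v \<in> H q" using w assms subspace_diff[OF subspace_H] by blast
    show "w - v \<in> vertical P q" using w assms by (simp add: vertical_def linear_diff[OF linear_tangent_proj])
  qed
  then show "w = v" by simp
qed (use assms in simp)

text \<open>Any lift of \<open>u\<close> minus its vertical part is horizontal and still projects to
  \<open>u\<close>.\<close>

lemma horizontal_lift:
  shows horizontal_lift_in: "horizontal_lift P H q u \<in> H q"
    and tangent_horizontal_lift: "tangent_map (tot P) (base P) (proj P) q (horizontal_lift P H q u) = u"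
proof -
  let ?c = "chart_at (tot P) q" and ?d = "chart_at (base P) (proj P q)"
  have c: "?c \<in> tot P" "?d \<in> base P" "q \<in> fst ?c" "proj P q \<in> fst ?d"
    using chart_at_in[OF totA] chart_at_in[OF baseA] by auto
  obtain w where w: "mder (proj P) ?c ?d q w = coords_in (base P) ?d (proj P q) u"
    using local_lift[OF c] by blast
  let ?w = "from_coords (tot P) ?c q w"
  have "tangent_map (tot P) (base P) (proj P) q ?w = u"
    using coords_tangent_map[OF c, of ?w] w coords_in_inj[OF baseA c(2,4)]
    by (simp add: coords_in_from_coords[OF totA c(1,3)])
  then have "tangent_map (tot P) (base P) (proj P) q (?w - fundamental_field P (vert_part P H q ?w) q) = u"
    using vertical_eq[of q] by (simp add: linear_diff[OF linear_tangent_proj] vertical_def set_eq_iff)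
  from horizontal_lift_eqI[OF vert_part_in this] this
  show "horizontal_lift P H q u \<in> H q" "tangent_map (tot P) (base P) (proj P) q (horizontal_lift P H q u) = u"
    using vert_part_in[of ?w q] by simp_all
qed

lemma horizontal_lift_tangent: "v \<in> H q \<Longrightarrow> horizontal_lift P H q (tangent_map (tot P) (base P) (proj P) q v) = v"
  by (rule horizontal_lift_eqI) auto

lemma linear_horizontal_lift: "linear (horizontal_lift P H q)"
  by (rule linearI; rule horizontal_lift_eqI)
    (simp_all add: subspace_add[OF subspace_H] subspace_scale[OF subspace_H] horizontal_lift
      linear_add[OF linear_tangent_proj] linear_scale[OF linear_tangent_proj])

subsection \<open>The splitting in coordinates\<close>

text \<open>\<open>vhat\<close> and \<open>hhat\<close> express the connection form and the
  horizontal lift as families of linear maps between fixed vector spaces, to which the calculus of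
  smooth functions applies.\<close>

definition vhat :: "('q, 'eq) chart \<Rightarrow> 'eq \<Rightarrow> 'eq \<Rightarrow> 'eg" where
  "vhat c x w = vert_part P H (chart_inv c x) (from_coords (tot P) c (chart_inv c x) w)"

definition hhat :: "('q, 'eq) chart \<Rightarrow> ('m, 'em) chart \<Rightarrow> 'eq \<Rightarrow> 'em \<Rightarrow> 'eq" where
  "hhat c d x u = coords_in (tot P) c (chart_inv c x)
     (horizontal_lift P H (chart_inv c x) (from_coords (base P) d (proj P (chart_inv c x)) u))"

lemma linear_vhat: "c \<in> tot P \<Longrightarrow> x \<in> snd c ` fst c \<Longrightarrow> linear (vhat c x)"
  unfolding vhat_def
  using linear_compose[OF linear_from_coords[OF totA, of c "chart_inv c x"] linear_vert_part]
  by (simp add: o_def chart_inv_in okQ)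

lemma vert_part_vhat:
  "c \<in> tot P \<Longrightarrow> q \<in> fst c \<Longrightarrow> vert_part P H q v = vhat c (snd c q) (coords_in (tot P) c q v)"
  by (simp add: vhat_def chart_inv_chart okQ from_coords_coords_in[OF totA])

lemma linear_hhat:
  assumes "c \<in> tot P" "d \<in> base P" "x \<in> snd c ` (fst c \<inter> proj P -` fst d)"
  shows "linear (hhat c d x)"
proof -
  have q: "chart_inv c x \<in> fst c" "proj P (chart_inv c x) \<in> fst d"
    using assms by (auto simp: chart_inv_chart okQ)
  show ?thesis unfolding hhat_def
    using linear_compose[OF linear_compose[OF linear_from_coords[OF baseA assms(2) q(2)] linear_horizontal_lift]
        linear_coords_in[OF totA assms(1) q(1)]] by (simp add: o_def)
qed

text \<open>A local frame of \<open>H\<close> joined with the fundamental fields of an orthonormal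
  basis of the Lie algebra is a smooth frame of the tangent spaces. The vertical part consists of
  the coefficients of the second half, which \<open>smooth_frame\<close> shows to be smooth.\<close>

lemma smooth_vhat:
  assumes c: "c \<in> tot P"
  shows "smooth_on (snd c ` fst c) (\<lambda>x. vhat c x w)"
proof (rule smooth_on_local)
  have ok: "chart_ok c" by (rule okQ[OF c])
  show "thick (snd c ` fst c)" using ok by (simp add: chart_ok_def thick_open)
  fix x0 assume "x0 \<in> snd c ` fst c"
  then obtain q0 where q0: "q0 \<in> fst c" "x0 = snd c q0" by blast
  have "smooth_distribution (tot P) H" using hd by (simp add: horizontal_distribution_def)
  from spec[OF this[unfolded smooth_distribution_def], of q0]
  obtain W and n :: nat and X where W: "open W" "q0 \<in> W" and X: "\<forall>i<n. smooth_vector_field_on (tot P) W (X i)"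
    and frame': "\<forall>r\<in>W. inj_on (\<lambda>i. X i r) {..<n} \<and> independent ((\<lambda>i. X i r) ` {..<n}) \<and>
          H r = span ((\<lambda>i. X i r) ` {..<n})"
    by (elim exE conjE)
  note frame = bspec[OF frame']
  define S where "S = snd c ` (W \<inter> fst c)"
  define J where "J = Inl ` {..<n} \<union> Inr ` (obasis :: 'eg set)"
  define f where "f j x = (case j of Inl i \<Rightarrow> local_rep (tot P) c (X i) x | Inr b \<Rightarrow> alpha c (chart_inv c x) b)" for j x
  have S: "open S" unfolding S_def by (rule open_chart_image[OF ok W(1)])
  have sumJ: "(\<Sum>j\<in>J. a j *\<^sub>R f j x) =
      coords_in (tot P) c q ((\<Sum>i<n. a (Inl i) *\<^sub>R X i q) + fundamental_field P (\<Sum>b\<in>obasis. a (Inr b) *\<^sub>R b) q)"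
    if q: "q \<in> W" "q \<in> fst c" "x = snd c q" for a x q
  proof -
    have inv: "chart_inv c x = q" using q ok chart_inv_chart by blast
    have "(\<Sum>j\<in>J. a j *\<^sub>R f j x) = (\<Sum>j\<in>Inl ` {..<n}. a j *\<^sub>R f j x) + (\<Sum>j\<in>Inr ` obasis. a j *\<^sub>R f j x)"
      unfolding J_def by (rule sum.union_disjoint) auto
    also have "(\<Sum>j\<in>Inl ` {..<n}. a j *\<^sub>R f j x) = (\<Sum>i<n. a (Inl i) *\<^sub>R coords_in (tot P) c q (X i q))"
      by (simp add: sum.reindex f_def local_rep_def inv)
    also have "(\<Sum>j\<in>Inr ` obasis. a j *\<^sub>R f j x) = (\<Sum>b\<in>obasis. a (Inr b) *\<^sub>R alpha c q b)"
      by (simp add: sum.reindex f_def inv)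
    also have "\<dots> = alpha c q (\<Sum>b\<in>obasis. a (Inr b) *\<^sub>R b)"
      by (simp add: linear_sum[OF linear_alpha[OF c q(2)]] linear_scale[OF linear_alpha[OF c q(2)]])
    also have "\<dots> = coords_in (tot P) c q (fundamental_field P (\<Sum>b\<in>obasis. a (Inr b) *\<^sub>R b) q)"
      by (rule coords_fundamental[OF c q(2), symmetric])
    finally show ?thesis
      by (simp add: linear_add[OF linear_coords_in[OF totA c q(2)]] linear_sum[OF linear_coords_in[OF totA c q(2)]]
          linear_scale[OF linear_coords_in[OF totA c q(2)]])
  qed
  have XH: "(\<Sum>i<n. a i *\<^sub>R X i q) \<in> H q" if "q \<in> W" for a q
  proof -
    have "(\<Sum>i<n. a i *\<^sub>R X i q) \<in> span ((\<lambda>i. X i q) ` {..<n})"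
      by (intro span_sum span_scale span_base imageI) simp
    then show ?thesis using frame[OF that] by simp
  qed
  interpret F: smooth_frame S J f
  proof
    show "open S" by (rule S)
    show "finite J" by (simp add: J_def)
    show "smooth_on S (f j)" if "j \<in> J" for j
    proof (cases j)
      case (Inl i)
      then have "i < n" using that by (auto simp: J_def)
      then have "smooth_on S (local_rep (tot P) c (X i))"
        using X c unfolding smooth_vector_field_on_def S_def by blast
      then show ?thesis by (simp add: f_def[abs_def] Inl)
    next
      case (Inr b)
      have "smooth_on S (\<lambda>x. alpha c (chart_inv c x) b)"
        by (rule smooth_on_subset[OF smooth_alpha[OF c]]) (auto simp: S_def)
      then show ?thesis by (simp add: f_def[abs_def] Inr)
    qed
    show "\<forall>j\<in>J. a j = 0" if x: "x \<in> S" and zero: "(\<Sum>j\<in>J. a j *\<^sub>R f j x) = 0" for x a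
    proof -
      obtain q where q: "q \<in> W" "q \<in> fst c" "x = snd c q" using x unfolding S_def by blast
      let ?h = "\<Sum>i<n. a (Inl i) *\<^sub>R X i q" and ?b = "\<Sum>b\<in>obasis. a (Inr b) *\<^sub>R b"
      have sum0: "?h + fundamental_field P ?b q = 0"
        using zero unfolding sumJ[OF q] using coords_in_inj[OF totA c q(2), of "?h + fundamental_field P ?b q" 0]
        unfolding linear_0[OF linear_coords_in[OF totA c q(2)]] by blast
      then have h: "?h = fundamental_field P (- ?b) q"
        by (simp add: linear_neg[OF linear_fundamental] add_eq_0_iff2)
      have "?h = 0" by (rule H_vertical[OF XH[OF q(1)]]) (simp add: h vertical_eq)
      have fr: "inj_on (\<lambda>i. X i q) {..<n}" "independent ((\<lambda>i. X i q) ` {..<n})" using frame[OF q(1)] by auto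
      have "a (Inl i) = 0" if i: "i < n" for i
      proof -
        \<comment> \<open>\<open>independent\<close> speaks of the set of frame vectors, so the
          coefficients are transported from indices to vectors by injectivity of the
          indexing.\<close>
        define u where "u v = a (Inl (inv_into {..<n} (\<lambda>i. X i q) v))" for v
        have u: "u (X i q) = a (Inl i)" if "i < n" for i
          using inv_into_f_f[OF fr(1), of i] that by (simp add: u_def)
        have "(\<Sum>v\<in>(\<lambda>i. X i q) ` {..<n}. u v *\<^sub>R v) = ?h"
          using fr(1) by (simp add: sum.reindex u)
        then have "u (X i q) = 0"
          using independentD[OF fr(2), of "(\<lambda>i. X i q) ` {..<n}" u "X i q"] \<open>?h = 0\<close> i by simp
        then show ?thesis using u[OF i] by simp
      qed
      moreover have "a (Inr b) = 0" if "b \<in> obasis" for b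
      proof -
        have "?b = 0" using sum0 \<open>?h = 0\<close> by (intro fundamental_inj[of _ q]) simp
        then show ?thesis using inner_sum_obasis[OF that, of "\<lambda>b. a (Inr b)"] by simp
      qed
      ultimately show ?thesis by (auto simp: J_def)
    qed
    show "\<exists>a. v = (\<Sum>j\<in>J. a j *\<^sub>R f j x)" if x: "x \<in> S" for x v
    proof -
      obtain q where q: "q \<in> W" "q \<in> fst c" "x = snd c q" using x unfolding S_def by blast
      let ?v = "from_coords (tot P) c q v"
      define b where "b = vert_part P H q ?v"
      have fr: "inj_on (\<lambda>i. X i q) {..<n}" "H q = span ((\<lambda>i. X i q) ` {..<n})" using frame[OF q(1)] by auto
      have "?v - fundamental_field P b q \<in> span ((\<lambda>i. X i q) ` {..<n})"
        using vert_part_in[of ?v q] fr(2) by (simp add: b_def)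
      then obtain u where u: "?v - fundamental_field P b q = (\<Sum>v\<in>(\<lambda>i. X i q) ` {..<n}. u v *\<^sub>R v)"
        unfolding span_finite[OF finite_imageI[OF finite_lessThan]] by blast
      define a where "a j = (case j of Inl i \<Rightarrow> u (X i q) | Inr b' \<Rightarrow> inner b b')" for j
      have "?v = (\<Sum>i<n. a (Inl i) *\<^sub>R X i q) + fundamental_field P (\<Sum>b'\<in>obasis. a (Inr b') *\<^sub>R b') q"
        using u fr(1) by (simp add: sum.reindex a_def obasis_expansion algebra_simps)
      from arg_cong[OF this, of "coords_in (tot P) c q"]
      have "v = (\<Sum>j\<in>J. a j *\<^sub>R f j x)"
        unfolding sumJ[OF q] coords_in_from_coords[OF totA c q(2)] .
      then show ?thesis by (rule exI[of _ a])
    qed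
  qed
  have vh: "vhat c x w = (\<Sum>b\<in>obasis. F.coeff x w (Inr b) *\<^sub>R b)" if x: "x \<in> S" for x
  proof -
    obtain q where q: "q \<in> W" "q \<in> fst c" "x = snd c q" using x unfolding S_def by blast
    have inv: "chart_inv c x = q" using q ok chart_inv_chart by blast
    have "from_coords (tot P) c q w =
        (\<Sum>i<n. F.coeff x w (Inl i) *\<^sub>R X i q) + fundamental_field P (\<Sum>b\<in>obasis. F.coeff x w (Inr b) *\<^sub>R b) q"
      (is "_ = ?z")
    proof -
      have "w = coords_in (tot P) c q ?z" using F.sum_coeff[OF x, of w] unfolding sumJ[OF q] by (rule sym)
      from arg_cong[OF this, of "from_coords (tot P) c q"] show ?thesis
        unfolding from_coords_coords_in[OF totA c q(2)] .
    qed
    then show ?thesis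
      unfolding vhat_def inv by (intro vert_part_eqI) (simp add: XH[OF q(1)])
  qed
  have "smooth_on S (\<lambda>x. \<Sum>b\<in>obasis. F.coeff x w (Inr b) *\<^sub>R b)"
    by (rule smooth_on_sum, rule smooth_on_bounded_linear_comp[OF bounded_linear_scaleR_left],
        rule F.smooth_on_coeff[OF smooth_on_const]) (simp add: J_def)
  then have "smooth_on S (\<lambda>x. vhat c x w)" by (rule smooth_on_eqI) (simp add: vh)
  then have "smooth_on (snd c ` fst c \<inter> S) (\<lambda>x. vhat c x w)" by (rule smooth_on_subset) blast
  moreover have "x0 \<in> S" using q0 W by (auto simp: S_def)
  ultimately show "\<exists>W. open W \<and> x0 \<in> W \<and> smooth_on (snd c ` fst c \<inter> W) (\<lambda>x. vhat c x w)"
    using S by blast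
qed

lemma open_coord_domain:
  assumes "c \<in> tot P" "d \<in> base P"
  shows "open (snd c ` (fst c \<inter> proj P -` fst d))"
proof -
  have "open (proj P -` fst d)" by (rule open_proj_vimage) (use okM[OF assms(2)] in \<open>simp add: chart_ok_def\<close>)
  from open_chart_image[OF okQ[OF assms(1)] this] show ?thesis by (simp add: Int_commute)
qed

text \<open>The horizontal lift is a smooth local lift \<sigma> minus its vertical part, which in
  coordinates is \<open>alpha\<close> applied to \<open>vhat\<close> of \<sigma>; all three are
  already known to be smooth.\<close>

lemma smooth_hhat:
  assumes cd: "c \<in> tot P" "d \<in> base P"
  shows "smooth_on (snd c ` (fst c \<inter> proj P -` fst d)) (\<lambda>x. hhat c d x u)"
proof (rule smooth_on_local[OF thick_open[OF open_coord_domain[OF cd]]])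
  have ok: "chart_ok c" by (rule okQ[OF cd(1)])
  fix x0 assume "x0 \<in> snd c ` (fst c \<inter> proj P -` fst d)"
  then obtain q0 where q0: "q0 \<in> fst c" "proj P q0 \<in> fst d" "x0 = snd c q0" by blast
  obtain W \<sigma> where W: "open W" "q0 \<in> W" "W \<subseteq> fst c \<inter> proj P -` fst d"
    and \<sigma>: "\<And>u. smooth_on (snd c ` W) (\<lambda>x. \<sigma> x u)"
      "\<And>q u. q \<in> W \<Longrightarrow> mder (proj P) c d q (\<sigma> (snd c q) u) = u"
    using local_lift[OF cd q0(1,2)] by metis
  define S where "S = snd c ` W"
  have "W = W \<inter> fst c" using W by blast
  then have S: "open S" using open_chart_image[OF ok W(1)] by (simp add: S_def)
  have sub: "S \<subseteq> snd c ` fst c" using W by (auto simp: S_def)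
  have "smooth_on S (\<lambda>x. \<sigma> x u - alpha c (chart_inv c x) (vhat c x (\<sigma> x u)))"
  proof (intro smooth_on_diff)
    show s: "smooth_on S (\<lambda>x. \<sigma> x u)" using \<sigma>(1) by (simp add: S_def)
    show "smooth_on S (\<lambda>x. alpha c (chart_inv c x) (vhat c x (\<sigma> x u)))"
    proof (rule smooth_on_apply[where A = "\<lambda>x. alpha c (chart_inv c x)" and v = "\<lambda>x. vhat c x (\<sigma> x u)"])
      show "linear (alpha c (chart_inv c x))" if "x \<in> S" for x
        using that sub by (intro linear_alpha cd chart_inv_in ok) auto
      show "smooth_on S (\<lambda>x. alpha c (chart_inv c x) a)" for a
        by (rule smooth_on_subset[OF smooth_alpha[OF cd(1)] sub])
      show "smooth_on S (\<lambda>x. vhat c x (\<sigma> x u))"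
        by (rule smooth_on_apply[where A = "vhat c" and v = "\<lambda>x. \<sigma> x u",
              OF _ smooth_on_subset[OF smooth_vhat[OF cd(1)] sub] s])
          (use sub linear_vhat[OF cd(1)] in blast)
    qed
  qed
  then have "smooth_on S (\<lambda>x. hhat c d x u)"
  proof (rule smooth_on_eqI)
    fix x assume "x \<in> S"
    then obtain q where q: "q \<in> W" "q \<in> fst c" "proj P q \<in> fst d" "x = snd c q" using W unfolding S_def by blast
    have inv: "chart_inv c x = q" using q ok chart_inv_chart by blast
    let ?w = "from_coords (tot P) c q (\<sigma> x u)"
    have "coords_in (base P) d (proj P q) (tangent_map (tot P) (base P) (proj P) q ?w) = u"
      unfolding coords_tangent_map[OF cd q(2,3)] coords_in_from_coords[OF totA cd(1) q(2)] q(4)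
      by (rule \<sigma>(2)[OF q(1)])
    then have "tangent_map (tot P) (base P) (proj P) q ?w = from_coords (base P) d (proj P q) u"
      by (metis from_coords_coords_in[OF baseA cd(2) q(3)])
    moreover have "tangent_map (tot P) (base P) (proj P) q (fundamental_field P a q) = 0" for a
      using vertical_eq[of q] by (auto simp: vertical_def)
    ultimately have "horizontal_lift P H q (from_coords (base P) d (proj P q) u) = ?w - fundamental_field P (vert_part P H q ?w) q"
      by (intro horizontal_lift_eqI vert_part_in) (simp add: linear_diff[OF linear_tangent_proj])
    then show "\<sigma> x u - alpha c (chart_inv c x) (vhat c x (\<sigma> x u)) = hhat c d x u"
      unfolding hhat_def inv vhat_def
      by (simp add: linear_diff[OF linear_coords_in[OF totA cd(1) q(2)]] coords_in_from_coords[OF totA cd(1) q(2)]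
          coords_fundamental[OF cd(1) q(2)])
  qed
  then have "smooth_on (snd c ` (fst c \<inter> proj P -` fst d) \<inter> S) (\<lambda>x. hhat c d x u)"
    by (rule smooth_on_subset) blast
  moreover have "x0 \<in> S" using q0 W by (auto simp: S_def)
  ultimately show "\<exists>W. open W \<and> x0 \<in> W \<and> smooth_on (snd c ` (fst c \<inter> proj P -` fst d) \<inter> W) (\<lambda>x. hhat c d x u)"
    using S by blast
qed

end

section \<open>The Lie bracket in an arbitrary chart\<close>

lemma smooth_on_has_derivative_mder_ident:
  fixes A :: "('p::{t2_space,second_countable_topology}, 'e::finite_euclidean) chart set"
  assumes A: "smooth_atlas A" and c: "c \<in> A" and d: "d \<in> A"
  shows "open (snd c ` (fst c \<inter> fst d))" "smooth_on (snd c ` (fst c \<inter> fst d)) (\<lambda>x. snd d (chart_inv c x))"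
    "x \<in> snd c ` (fst c \<inter> fst d) \<Longrightarrow>
      frechet_derivative (\<lambda>x. snd d (chart_inv c x)) (at x) = ctrans c d (chart_inv c x)"
proof -
  have ok: "chart_ok c" "chart_ok d" using smooth_atlas_chart_ok[OF A] c d by auto
  have "open (snd c ` (fst d \<inter> fst c))"
    by (rule open_chart_image[OF ok(1)]) (use ok(2) in \<open>simp add: chart_ok_def\<close>)
  then show "open (snd c ` (fst c \<inter> fst d))" by (simp add: Int_commute)
  show "smooth_on (snd c ` (fst c \<inter> fst d)) (\<lambda>x. snd d (chart_inv c x))"
    using A c d by (simp add: smooth_atlas_def o_def)
  show "frechet_derivative (\<lambda>x. snd d (chart_inv c x)) (at x) = ctrans c d (chart_inv c x)"
    if "x \<in> snd c ` (fst c \<inter> fst d)"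
    using that ok(1) by (auto simp: mder_def o_def chart_inv_chart)
qed

text \<open>The second derivatives of the coordinate change cancel by symmetry.\<close>

lemma lie_bracket_coords:
  fixes A :: "('p::{t2_space,second_countable_topology}, 'e::finite_euclidean) chart set"
  assumes A: "smooth_atlas A" and W: "open W" "p \<in> W"
    and X: "smooth_vector_field_on A W X" and Y: "smooth_vector_field_on A W Y"
    and c: "c \<in> A" "p \<in> fst c"
  shows "coords_in A c p (lie_bracket A X Y p) =
    frechet_derivative (local_rep A c Y) (at (snd c p)) (local_rep A c X (snd c p)) -
    frechet_derivative (local_rep A c X) (at (snd c p)) (local_rep A c Y (snd c p))"
proof -
  let ?k = "chart_at A p"
  have k: "?k \<in> A" "p \<in> fst ?k" using chart_at_in[OF A] by auto
  have ok: "chart_ok c" "chart_ok ?k" using smooth_atlas_chart_ok[OF A] c k by auto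
  define x where "x = snd ?k p"
  define \<phi> where "\<phi> = (\<lambda>x. snd c (chart_inv ?k x))"
  define S where "S = snd ?k ` (W \<inter> fst c \<inter> fst ?k)"
  have invx: "chart_inv ?k x = p" "chart_inv c (snd c p) = p" using ok k c by (simp_all add: x_def chart_inv_chart)
  then have \<phi>x: "\<phi> x = snd c p" by (simp add: \<phi>_def)
  have "open (W \<inter> fst c)" using W ok by (auto simp: chart_ok_def)
  then have S: "open S" "x \<in> S" unfolding S_def using open_chart_image[OF ok(2)] W c k by (auto simp: x_def)
  have SS: "S \<subseteq> snd ?k ` (fst ?k \<inter> fst c)" by (auto simp: S_def)
  have \<phi>: "smooth_on S \<phi>"
    unfolding \<phi>_def by (rule smooth_on_subset[OF smooth_on_has_derivative_mder_ident(2)[OF A k(1) c(1)] SS])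
  define D where "D y = frechet_derivative \<phi> (at y)" for y
  have D: "D y = ctrans ?k c (chart_inv ?k y)" if "y \<in> S" for y
    unfolding D_def \<phi>_def
    by (rule smooth_on_has_derivative_mder_ident(3)[OF A k(1) c(1)]) (use SS that in blast)
  have \<phi>': "(\<phi> has_derivative D y) (at y)" if "y \<in> S" for y
    unfolding D_def by (rule smooth_on_has_derivative[OF S(1) \<phi> that])
  define DD where "DD e = frechet_derivative (\<lambda>y. D y e) (at x)" for e
  have DD: "((\<lambda>y. D y e) has_derivative DD e) (at x)" for e
    unfolding DD_def
    by (rule smooth_on_has_derivative[OF S(1) _ S(2)]) (unfold D_def, rule smooth_on_frechet_derivative[OF S(1) \<phi>])
  have sym: "DD u v = DD v u" for u v
    unfolding DD_def D_def by (rule second_derivative_symmetric[OF S \<phi>])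
  \<comment> \<open>The representative of \<open>Z\<close> in \<open>c\<close>, composed with
    \<open>\<phi>\<close>, is \<open>D\<close> applied to the representative in \<open>?k\<close>.
    Differentiating this relation produces the second derivative \<open>DD\<close> of the coordinate
    change.\<close>
  have main: "frechet_derivative (local_rep A c Z) (at (snd c p)) (D x v) =
      DD (local_rep A ?k Z x) v + D x (frechet_derivative (local_rep A ?k Z) (at x) v)"
    if Z: "smooth_vector_field_on A W Z" for Z v
  proof -
    have sc: "smooth_on (snd c ` (W \<inter> fst c)) (local_rep A c Z)" "smooth_on (snd ?k ` (W \<inter> fst ?k)) (local_rep A ?k Z)"
      using Z c k unfolding smooth_vector_field_on_def by auto
    have Dc: "(local_rep A c Z has_derivative frechet_derivative (local_rep A c Z) (at (snd c p))) (at (\<phi> x))"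
      unfolding \<phi>x by (rule smooth_on_has_derivative[OF open_chart_image[OF ok(1) W(1)] sc(1)]) (use W c in auto)
    have Dk: "(local_rep A ?k Z has_derivative frechet_derivative (local_rep A ?k Z) (at x)) (at x)"
      by (rule smooth_on_has_derivative[OF open_chart_image[OF ok(2) W(1)] sc(2)]) (use W k in \<open>auto simp: x_def\<close>)
    have "(local_rep A c Z \<circ> \<phi> has_derivative frechet_derivative (local_rep A c Z) (at (snd c p)) \<circ> D x) (at x)"
      by (rule diff_chain_at[OF \<phi>'[OF S(2)] Dc])
    moreover have "((\<lambda>y. D y (local_rep A ?k Z y)) has_derivative
        (\<lambda>h. DD (local_rep A ?k Z x) h + D x (frechet_derivative (local_rep A ?k Z) (at x) h))) (at x)"
      by (rule has_derivative_apply[OF has_derivative_linear[OF \<phi>'] S DD Dk])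
    then have "(local_rep A c Z \<circ> \<phi> has_derivative
        (\<lambda>h. DD (local_rep A ?k Z x) h + D x (frechet_derivative (local_rep A ?k Z) (at x) h))) (at x)"
    proof (rule has_derivative_transform_within_open[OF _ S])
      fix y assume y: "y \<in> S"
      then obtain r where r: "y = snd ?k r" "r \<in> W" "r \<in> fst c" "r \<in> fst ?k" by (auto simp: S_def)
      have inv: "chart_inv ?k y = r" "chart_inv c (\<phi> y) = r" using r ok by (auto simp: \<phi>_def chart_inv_chart)
      show "D y (local_rep A ?k Z y) = (local_rep A c Z \<circ> \<phi>) y"
        unfolding D[OF y] by (simp add: local_rep_def inv coords_in_change[OF A k(1) c(1) r(4,3)])
    qed
    ultimately have "frechet_derivative (local_rep A c Z) (at (snd c p)) \<circ> D x =
        (\<lambda>h. DD (local_rep A ?k Z x) h + D x (frechet_derivative (local_rep A ?k Z) (at x) h))"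
      by (rule has_derivative_unique)
    from fun_cong[OF this, of v] show ?thesis by simp
  qed
  have rep: "local_rep A c Z (snd c p) = D x (local_rep A ?k Z x)" for Z
    unfolding D[OF S(2)] local_rep_def invx by (rule coords_in_change[OF A k(1) c(1) k(2) c(2)])
  have "coords_in A c p (lie_bracket A X Y p) = D x (lie_bracket A X Y p)"
    unfolding D[OF S(2)] invx by (simp add: coords_in_eq)
  also have "\<dots> = D x (frechet_derivative (local_rep A ?k Y) (at x) (local_rep A ?k X x)) -
      D x (frechet_derivative (local_rep A ?k X) (at x) (local_rep A ?k Y x))"
    by (simp add: lie_bracket_def Let_def x_def linear_diff[OF has_derivative_linear[OF \<phi>'[OF S(2)], unfolded x_def]])
  finally show ?thesis
    unfolding rep main[OF X] main[OF Y] using sym by (simp add: algebra_simps)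
qed

section \<open>Vector fields with a given value\<close>

text \<open>A field that is constant in a chart is cut off by a bump. It vanishes outside the image
  \<open>K\<close> of a compact ball, and \<open>K\<close> is closed because the manifold is
  Hausdorff, so extension by zero is smooth. \<open>curvature\<close> and
  \<open>vert_bracket\<close> quantify over global extensions, and one must exist for the described
  value to be unique.\<close>

lemma vector_field_extension:
  fixes A :: "('p::{t2_space,second_countable_topology}, 'e::finite_euclidean) chart set"
  assumes A: "smooth_atlas A"
  shows "\<exists>X. smooth_vector_field_on A UNIV X \<and> X p = v"
proof -
  let ?d = "chart_at A p"
  have d: "?d \<in> A" "p \<in> fst ?d" using chart_at_in[OF A] by auto
  have okd: "chart_ok ?d" by (rule smooth_atlas_chart_ok[OF A d(1)])
  have "open (snd ?d ` fst ?d)" using okd by (simp add: chart_ok_def)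
  moreover have "snd ?d p \<in> snd ?d ` fst ?d" using d(2) by (rule imageI)
  ultimately obtain r where r: "r > 0" "cball (snd ?d p) r \<subseteq> snd ?d ` fst ?d"
    using open_contains_cball by blast
  define K where "K = chart_inv ?d ` cball (snd ?d p) r"
  have "continuous_on (cball (snd ?d p) r) (chart_inv ?d)"
    by (rule continuous_on_subset[OF _ r(2)]) (use okd in \<open>simp add: chart_ok_def homeomorphism_def\<close>)
  then have "compact K" unfolding K_def by (rule compact_continuous_image[OF _ compact_cball])
  then have K: "open (- K)" by (simp add: compact_imp_closed open_Compl)
  define X where "X s = (if s \<in> fst ?d then bump (snd ?d p) r (snd ?d s) *\<^sub>R from_coords A ?d s v else 0)" for s
  have X0: "X s = 0" if "s \<notin> K" for s
  proof (cases "s \<in> fst ?d")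
    case True
    have "snd ?d s \<notin> cball (snd ?d p) r"
    proof
      assume "snd ?d s \<in> cball (snd ?d p) r"
      then have "chart_inv ?d (snd ?d s) \<in> K" unfolding K_def by (rule imageI)
      then show False using that chart_inv_chart[OF okd True] by simp
    qed
    then have "bump (snd ?d p) r (snd ?d s) = 0"
      using r(1) by (intro bump_eq_0) (auto simp: dist_norm norm_minus_commute)
    then show ?thesis by (simp add: X_def)
  qed (simp add: X_def)
  have "smooth_vector_field_on A UNIV X"
    unfolding smooth_vector_field_on_def
  proof
    fix c assume c: "c \<in> A"
    have ok: "chart_ok c" by (rule smooth_atlas_chart_ok[OF A c])
    have "smooth_on (snd c ` fst c) (local_rep A c X)"
    proof (rule smooth_on_local)
      show "thick (snd c ` fst c)" using ok by (simp add: chart_ok_def thick_open)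
      fix y0 assume "y0 \<in> snd c ` fst c"
      then obtain s0 where s0: "s0 \<in> fst c" "y0 = snd c s0" by blast
      show "\<exists>W. open W \<and> y0 \<in> W \<and> smooth_on (snd c ` fst c \<inter> W) (local_rep A c X)"
      proof (cases "s0 \<in> fst ?d")
        case True
        let ?W = "snd c ` (fst c \<inter> fst ?d)"
        note psi = smooth_on_has_derivative_mder_ident[OF A c d(1)]
        note phi = smooth_on_has_derivative_mder_ident[OF A d(1) c]
        have "smooth_on (snd ?d ` (fst ?d \<inter> fst c)) (\<lambda>x. ctrans ?d c (chart_inv ?d x) v)"
          by (rule smooth_on_eqI[OF smooth_on_frechet_derivative[OF phi(1,2), of v]]) (simp add: phi(3))
        then have "smooth_on ?W (\<lambda>y. ctrans ?d c (chart_inv ?d (snd ?d (chart_inv c y))) v)"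
          by (rule smooth_on_compose[OF psi(2)]) (use ok in \<open>auto simp: chart_inv_chart\<close>)
        then have "smooth_on ?W (\<lambda>y. bump (snd ?d p) r (snd ?d (chart_inv c y)) *\<^sub>R
            ctrans ?d c (chart_inv ?d (snd ?d (chart_inv c y))) v)"
          by (rule smooth_on_scaleR[OF smooth_on_compose[OF psi(2) smooth_on_bump subset_UNIV]])
        then have "smooth_on ?W (local_rep A c X)"
        proof (rule smooth_on_eqI)
          fix y assume "y \<in> ?W"
          then obtain s where s: "s \<in> fst c" "s \<in> fst ?d" "y = snd c s" by blast
          have inv: "chart_inv c y = s" using s ok chart_inv_chart by blast
          show "bump (snd ?d p) r (snd ?d (chart_inv c y)) *\<^sub>R
            ctrans ?d c (chart_inv ?d (snd ?d (chart_inv c y))) v = local_rep A c X y"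
            by (simp add: local_rep_def inv X_def s(1,2) linear_scale[OF linear_coords_in[OF A d(1) s(2)]]
                linear_scale[OF linear_ctrans[OF A d(1) c s(2,1)]] chart_inv_chart[OF okd]
                coords_in_change[OF A d(1) c s(2,1)] coords_in_from_coords[OF A d(1) s(2)])
        qed
        then have "smooth_on (snd c ` fst c \<inter> ?W) (local_rep A c X)" by (rule smooth_on_subset) blast
        then show ?thesis using psi(1) True s0 by blast
      next
        case False
        let ?W = "snd c ` (- K \<inter> fst c)"
        have "K \<subseteq> fst ?d" unfolding K_def using r(2) chart_inv_in[OF okd] by blast
        then have y0: "y0 \<in> ?W" using False s0 by blast
        have "smooth_on (snd c ` fst c \<inter> ?W) (local_rep A c X)"
        proof (rule smooth_on_eqI[OF smooth_on_const])
          fix y assume "y \<in> snd c ` fst c \<inter> ?W"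
          then obtain s where s: "s \<in> fst c" "s \<notin> K" "y = snd c s" by blast
          then show "0 = local_rep A c X y"
            by (simp add: local_rep_def chart_inv_chart[OF ok] X0 linear_0[OF linear_coords_in[OF A c s(1)]])
        qed
        then show ?thesis using open_chart_image[OF ok K] y0 by blast
      qed
    qed
    then show "smooth_on (snd c ` (UNIV \<inter> fst c)) (local_rep A c X)" by simp
  qed
  moreover have "X p = v"
    using d r(1) by (simp add: X_def bump_center from_coords_eq ctrans_self[OF A])
  ultimately show ?thesis by blast
qed

section \<open>Coordinate formulas for curvature, vertical bracket and derivatives of the
  Lagrangian\<close>

section \<open>Curvature and the vertical bracket in coordinates\<close>

context horizontal_bundle
begin

definition Dh :: "('q, 'eq) chart \<Rightarrow> ('m, 'em) chart \<Rightarrow> 'eq \<Rightarrow> 'eq \<Rightarrow> 'em \<Rightarrow> 'eq" where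
  "Dh c d x \<xi> u = frechet_derivative (\<lambda>y. hhat c d y u) (at x) \<xi>"

definition Dalpha :: "('q, 'eq) chart \<Rightarrow> 'eq \<Rightarrow> 'eq \<Rightarrow> 'eg \<Rightarrow> 'eq" where
  "Dalpha c x \<xi> a = frechet_derivative (\<lambda>y. alpha c (chart_inv c y) a) (at x) \<xi>"

definition dom :: "('q, 'eq) chart \<Rightarrow> ('m, 'em) chart \<Rightarrow> 'eq set" where
  "dom c d = snd c ` (fst c \<inter> proj P -` fst d)"

lemma open_dom: "c \<in> tot P \<Longrightarrow> d \<in> base P \<Longrightarrow> open (dom c d)"
  unfolding dom_def by (rule open_coord_domain)

lemma dom_subset: "dom c d \<subseteq> snd c ` fst c"
  by (auto simp: dom_def)

lemma hhat_has_derivative: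
  "c \<in> tot P \<Longrightarrow> d \<in> base P \<Longrightarrow> x \<in> dom c d \<Longrightarrow> ((\<lambda>y. hhat c d y u) has_derivative (\<lambda>\<xi>. Dh c d x \<xi> u)) (at x)"
  using smooth_on_has_derivative[OF open_dom smooth_hhat[folded dom_def]] by (simp add: Dh_def)

lemma alpha_has_derivative:
  "c \<in> tot P \<Longrightarrow> x \<in> snd c ` fst c \<Longrightarrow>
    ((\<lambda>y. alpha c (chart_inv c y) a) has_derivative (\<lambda>\<xi>. Dalpha c x \<xi> a)) (at x)"
  using smooth_on_has_derivative[OF _ smooth_alpha] okQ[of c] by (simp add: Dalpha_def chart_ok_def)

lemma linear_Dh_left: "c \<in> tot P \<Longrightarrow> d \<in> base P \<Longrightarrow> x \<in> dom c d \<Longrightarrow> linear (\<lambda>\<xi>. Dh c d x \<xi> u)"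
  by (rule has_derivative_linear[OF hhat_has_derivative])

lemma linear_Dalpha_left: "c \<in> tot P \<Longrightarrow> x \<in> snd c ` fst c \<Longrightarrow> linear (\<lambda>\<xi>. Dalpha c x \<xi> a)"
  by (rule has_derivative_linear[OF alpha_has_derivative])

text \<open>Additivity and homogeneity of \<open>B y\<close> are identities between functions of
  \<open>y\<close>; uniqueness of derivatives carries them over to \<open>B'\<close>.\<close>

lemma linear_derivative_family:
  assumes S: "open S" "x \<in> S" and lin: "\<And>y. y \<in> S \<Longrightarrow> linear (B y)"
    and D: "\<And>u. ((\<lambda>y. B y u) has_derivative (\<lambda>\<xi>. B' \<xi> u)) (at x)"
  shows "linear (B' \<xi>)"
proof (rule linearI)
  fix u w and r :: real
  have "((\<lambda>y. B y u + B y w) has_derivative (\<lambda>\<xi>. B' \<xi> u + B' \<xi> w)) (at x)"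
    by (intro has_derivative_add D)
  then have "((\<lambda>y. B y (u + w)) has_derivative (\<lambda>\<xi>. B' \<xi> u + B' \<xi> w)) (at x)"
    by (rule has_derivative_transform_within_open[OF _ S]) (simp add: linear_add[OF lin])
  from fun_cong[OF has_derivative_unique[OF D this]] show "B' \<xi> (u + w) = B' \<xi> u + B' \<xi> w" .
  have "((\<lambda>y. r *\<^sub>R B y u) has_derivative (\<lambda>\<xi>. r *\<^sub>R B' \<xi> u)) (at x)"
    by (intro has_derivative_scaleR_right D)
  then have "((\<lambda>y. B y (r *\<^sub>R u)) has_derivative (\<lambda>\<xi>. r *\<^sub>R B' \<xi> u)) (at x)"
    by (rule has_derivative_transform_within_open[OF _ S]) (simp add: linear_scale[OF lin])
  from fun_cong[OF has_derivative_unique[OF D this]] show "B' \<xi> (r *\<^sub>R u) = r *\<^sub>R B' \<xi> u" .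
qed

lemma linear_Dh_right:
  assumes "c \<in> tot P" "d \<in> base P" "x \<in> dom c d"
  shows "linear (Dh c d x \<xi>)"
  by (rule linear_derivative_family[OF open_dom[OF assms(1,2)] assms(3), of "hhat c d" "Dh c d x"])
    (use assms linear_hhat hhat_has_derivative in \<open>auto simp: dom_def\<close>)

lemma linear_Dalpha_right:
  assumes "c \<in> tot P" "x \<in> snd c ` fst c"
  shows "linear (Dalpha c x \<xi>)"
proof (rule linear_derivative_family[of "snd c ` fst c" x "\<lambda>y. alpha c (chart_inv c y)" "Dalpha c x"])
  show "open (snd c ` fst c)" using okQ[OF assms(1)] by (simp add: chart_ok_def)
  show "linear (alpha c (chart_inv c y))" if "y \<in> snd c ` fst c" for y
    by (rule linear_alpha[OF assms(1) chart_inv_in[OF okQ[OF assms(1)] that]])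
qed (use assms alpha_has_derivative in auto)

lemma smooth_Dh: "c \<in> tot P \<Longrightarrow> d \<in> base P \<Longrightarrow> smooth_on (dom c d) (\<lambda>x. Dh c d x \<xi> u)"
  unfolding Dh_def by (rule smooth_on_frechet_derivative[OF open_dom smooth_hhat[folded dom_def]])

lemma smooth_Dalpha: "c \<in> tot P \<Longrightarrow> smooth_on (snd c ` fst c) (\<lambda>x. Dalpha c x \<xi> a)"
  unfolding Dalpha_def using okQ[of c]
  by (intro smooth_on_frechet_derivative smooth_alpha) (auto simp: chart_ok_def)

abbreviation phat :: "('q, 'eq) chart \<Rightarrow> ('m, 'em) chart \<Rightarrow> 'eq \<Rightarrow> 'em" where
  "phat c d x \<equiv> snd d (proj P (chart_inv c x))"

lemma smooth_phat: "c \<in> tot P \<Longrightarrow> d \<in> base P \<Longrightarrow> smooth_on (dom c d) (phat c d)"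
  using proj_smooth by (simp add: smooth_map_on_def dom_def o_def)

lemma mder_proj_hhat:
  assumes "c \<in> tot P" "d \<in> base P" "q \<in> fst c" "proj P q \<in> fst d"
  shows "mder (proj P) c d q (hhat c d (snd c q) u) = u"
  unfolding hhat_def chart_inv_chart[OF okQ[OF assms(1)] assms(3)] coords_tangent_map[OF assms, symmetric]
    tangent_horizontal_lift by (rule coords_in_from_coords[OF baseA assms(2,4)])

lemma phat_has_derivative:
  assumes "c \<in> tot P" "d \<in> base P" "q \<in> fst c" "proj P q \<in> fst d"
  shows "(phat c d has_derivative mder (proj P) c d q) (at (snd c q))"
  using has_mder_proj[OF assms] by (simp add: has_mder_def o_def)

lemma lift_field_rep:
  assumes "c \<in> tot P" "d \<in> base P" "x \<in> dom c d"
  shows "local_rep (tot P) c (lift_field P H X) x = hhat c d x (local_rep (base P) d X (phat c d x))"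
proof -
  obtain q where q: "q \<in> fst c" "proj P q \<in> fst d" "x = snd c q" using assms by (auto simp: dom_def)
  have inv: "chart_inv c x = q" "chart_inv d (snd d (proj P q)) = proj P q"
    using q by (simp_all add: chart_inv_chart okQ[OF assms(1)] okM[OF assms(2)])
  show ?thesis
    by (simp add: local_rep_def lift_field_def hhat_def inv from_coords_coords_in[OF baseA assms(2) q(2)])
qed

lemma smooth_lift_field_rep:
  assumes cd: "c \<in> tot P" "d \<in> base P" and X: "smooth_vector_field_on (base P) UNIV X"
  shows "smooth_on (dom c d) (local_rep (tot P) c (lift_field P H X))"
proof (rule smooth_on_eqI)
  have "smooth_on (snd d ` fst d) (local_rep (base P) d X)"
    using X cd by (simp add: smooth_vector_field_on_def)
  then have "smooth_on (dom c d) (\<lambda>x. local_rep (base P) d X (phat c d x))"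
    by (rule smooth_on_compose[OF smooth_phat[OF cd]]) (use okQ[OF cd(1)] in \<open>auto simp: dom_def chart_inv_chart\<close>)
  then show "smooth_on (dom c d) (\<lambda>x. hhat c d x (local_rep (base P) d X (phat c d x)))"
    by (rule smooth_on_apply[where A = "hhat c d", rotated 2])
      (use linear_hhat[OF cd] smooth_hhat[OF cd] in \<open>auto simp: dom_def\<close>)
qed (simp add: lift_field_rep[OF cd])

lemma smooth_lift_field:
  assumes "d \<in> base P" "smooth_vector_field_on (base P) UNIV X"
  shows "smooth_vector_field_on (tot P) (proj P -` fst d) (lift_field P H X)"
  unfolding smooth_vector_field_on_def
  using smooth_lift_field_rep[OF _ assms] by (auto simp: dom_def Int_commute)

lemma lift_field_has_derivative:
  assumes cd: "c \<in> tot P" "d \<in> base P" "q \<in> fst c" "proj P q \<in> fst d"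
    and X: "smooth_vector_field_on (base P) UNIV X"
  shows "frechet_derivative (local_rep (tot P) c (lift_field P H X)) (at (snd c q)) \<xi> =
    Dh c d (snd c q) \<xi> (local_rep (base P) d X (snd d (proj P q))) +
    hhat c d (snd c q) (frechet_derivative (local_rep (base P) d X) (at (snd d (proj P q))) (mder (proj P) c d q \<xi>))"
proof -
  define x where "x = snd c q"
  have x: "x \<in> dom c d" using cd by (auto simp: x_def dom_def)
  have p: "phat c d x = snd d (proj P q)" using cd okQ by (simp add: x_def chart_inv_chart)
  have okd: "chart_ok d" by (rule okM[OF cd(2)])
  have "smooth_on (snd d ` fst d) (local_rep (base P) d X)"
    using X cd by (simp add: smooth_vector_field_on_def)
  then have DX: "(local_rep (base P) d X has_derivative frechet_derivative (local_rep (base P) d X) (at (snd d (proj P q))))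
      (at (phat c d x))"
    unfolding p by (rule smooth_on_has_derivative[rotated]) (use okd cd in \<open>auto simp: chart_ok_def\<close>)
  from diff_chain_at[OF phat_has_derivative[OF cd, folded x_def] DX]
  have DXp: "((\<lambda>y. local_rep (base P) d X (phat c d y)) has_derivative
      (\<lambda>\<xi>. frechet_derivative (local_rep (base P) d X) (at (snd d (proj P q))) (mder (proj P) c d q \<xi>))) (at x)"
    by (simp add: o_def)
  have "((\<lambda>y. hhat c d y (local_rep (base P) d X (phat c d y))) has_derivative
      (\<lambda>\<xi>. Dh c d x \<xi> (local_rep (base P) d X (phat c d x)) +
        hhat c d x (frechet_derivative (local_rep (base P) d X) (at (snd d (proj P q))) (mder (proj P) c d q \<xi>)))) (at x)"
    by (rule has_derivative_apply[where A = "hhat c d" and A' = "\<lambda>u \<xi>. Dh c d x \<xi> u",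
          OF _ open_dom[OF cd(1,2)] x hhat_has_derivative[OF cd(1,2) x] DXp])
      (use linear_hhat[OF cd(1,2)] in \<open>auto simp: dom_def\<close>)
  then have "(local_rep (tot P) c (lift_field P H X) has_derivative
      (\<lambda>\<xi>. Dh c d x \<xi> (local_rep (base P) d X (phat c d x)) +
        hhat c d x (frechet_derivative (local_rep (base P) d X) (at (snd d (proj P q))) (mder (proj P) c d q \<xi>)))) (at x)"
    by (rule has_derivative_transform_within_open[OF _ open_dom[OF cd(1,2)] x]) (simp add: lift_field_rep[OF cd(1,2)])
  from fun_cong[OF frechet_derivative_at[OF this, symmetric], of \<xi>] show ?thesis
    unfolding p unfolding x_def .
qed

lemma coords_lift_field:
  assumes "c \<in> tot P" "d \<in> base P" "q \<in> fst c" "proj P q \<in> fst d"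
  shows "coords_in (tot P) c q (lift_field P H X q) = hhat c d (snd c q) (coords_in (base P) d (proj P q) (X (proj P q)))"
  unfolding lift_field_def hhat_def
  by (simp add: chart_inv_chart[OF okQ[OF assms(1)] assms(3)] from_coords_coords_in[OF baseA assms(2,4)])

text \<open>Because \<open>hhat\<close> is a right inverse of the derivative of the projection, the
  derivatives of the extensions enter the bracket of the lifts only through \<open>hhat\<close> of
  the bracket on the base, and cancel against its lift. What remains depends on the values of the
  fields at one point.\<close>

lemma curvature_coords:
  assumes cd: "c \<in> tot P" "d \<in> base P" "q \<in> fst c" "proj P q \<in> fst d"
  defines "x \<equiv> snd c q" and "u \<equiv> coords_in (base P) d (proj P q)"
  shows "curvature P H q X Y = vhat c x (Dh c d x (hhat c d x (u X)) (u Y) - Dh c d x (hhat c d x (u Y)) (u X))"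
proof -
  let ?R = "vhat c x (Dh c d x (hhat c d x (u X)) (u Y) - Dh c d x (hhat c d x (u Y)) (u X))"
  have x: "x \<in> dom c d" using cd by (auto simp: x_def dom_def)
  have opd: "open (proj P -` fst d)" by (rule open_proj_vimage) (use okM[OF cd(2)] in \<open>simp add: chart_ok_def\<close>)
  have main: "vert_part P H q
           (lie_bracket (tot P) (lift_field P H X') (lift_field P H Y') q
            - lift_field P H (lie_bracket (base P) X' Y') q) = ?R"
    if X': "smooth_vector_field_on (base P) UNIV X'" "X' (proj P q) = X"
      and Y': "smooth_vector_field_on (base P) UNIV Y'" "Y' (proj P q) = Y" for X' Y'
  proof -
    let ?X = "local_rep (base P) d X'" and ?Y = "local_rep (base P) d Y'" and ?y = "snd d (proj P q)"
    have uX: "?X ?y = u X" "?Y ?y = u Y"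
      using X' Y' by (simp_all add: local_rep_def u_def chart_inv_chart[OF okM[OF cd(2)] cd(4)])
    have rep: "local_rep (tot P) c (lift_field P H Z) x = hhat c d x (local_rep (base P) d Z ?y)" for Z
      using lift_field_rep[OF cd(1,2) x, of Z] by (simp add: x_def chart_inv_chart[OF okQ[OF cd(1)] cd(3)])
    have e1: "coords_in (tot P) c q (lie_bracket (tot P) (lift_field P H X') (lift_field P H Y') q) =
        (Dh c d x (hhat c d x (u X)) (u Y) + hhat c d x (frechet_derivative ?Y (at ?y) (u X))) -
        (Dh c d x (hhat c d x (u Y)) (u X) + hhat c d x (frechet_derivative ?X (at ?y) (u Y)))"
      by (subst lie_bracket_coords[OF totA opd _ smooth_lift_field[OF cd(2) X'(1)] smooth_lift_field[OF cd(2) Y'(1)] cd(1,3)])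
        (simp_all add: cd lift_field_has_derivative[OF cd X'(1)] lift_field_has_derivative[OF cd Y'(1)]
          rep[unfolded x_def] uX mder_proj_hhat[OF cd] x_def)
    have e2: "coords_in (tot P) c q (lift_field P H (lie_bracket (base P) X' Y') q) =
        hhat c d x (frechet_derivative ?Y (at ?y) (u X)) - hhat c d x (frechet_derivative ?X (at ?y) (u Y))"
      unfolding coords_lift_field[OF cd] lie_bracket_coords[OF baseA open_UNIV UNIV_I X'(1) Y'(1) cd(2,4)] uX x_def[symmetric]
      by (rule linear_diff[OF linear_hhat[OF cd(1,2) x[unfolded dom_def]]])
    show ?thesis
      unfolding vert_part_vhat[OF cd(1,3)] linear_diff[OF linear_coords_in[OF totA cd(1,3)]] x_def[symmetric] e1 e2
      by (simp add: algebra_simps)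
  qed
  obtain X' where X': "smooth_vector_field_on (base P) UNIV X'" "X' (proj P q) = X"
    using vector_field_extension[OF baseA] by blast
  obtain Y' where Y': "smooth_vector_field_on (base P) UNIV Y'" "Y' (proj P q) = Y"
    using vector_field_extension[OF baseA] by blast
  show ?thesis
    unfolding curvature_def
  proof (rule the_equality)
    fix r assume "\<forall>X' Y'.
       smooth_vector_field_on (base P) UNIV X' \<and> X' (proj P q) = X \<and>
       smooth_vector_field_on (base P) UNIV Y' \<and> Y' (proj P q) = Y \<longrightarrow>
       r = vert_part P H q
           (lie_bracket (tot P) (lift_field P H X') (lift_field P H Y') q
            - lift_field P H (lie_bracket (base P) X' Y') q)"
    then have "r = vert_part P H q
           (lie_bracket (tot P) (lift_field P H X') (lift_field P H Y') q
            - lift_field P H (lie_bracket (base P) X' Y') q)"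
      using X' Y' by blast
    then show "r = ?R" using main[OF X' Y'] by simp
  qed (use main in auto)
qed

lemma fundamental_rep: "c \<in> tot P \<Longrightarrow> x \<in> snd c ` fst c \<Longrightarrow>
    local_rep (tot P) c (fundamental_field P a) x = alpha c (chart_inv c x) a"
  by (simp add: local_rep_def coords_fundamental chart_inv_in okQ)

lemma smooth_fundamental: "smooth_vector_field_on (tot P) W (fundamental_field P a)"
  unfolding smooth_vector_field_on_def
proof
  fix c assume c: "c \<in> tot P"
  have "smooth_on (snd c ` fst c) (local_rep (tot P) c (fundamental_field P a))"
    by (rule smooth_on_eqI[OF smooth_alpha[OF c, of a]]) (simp add: fundamental_rep[OF c])
  then show "smooth_on (snd c ` (W \<inter> fst c)) (local_rep (tot P) c (fundamental_field P a))"
    by (rule smooth_on_subset) auto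
qed

text \<open>Fundamental fields project to zero, so along them the lift of a base field varies
  through \<open>hhat\<close> alone, and the derivative of the extension drops out of the
  bracket.\<close>

lemma vert_bracket_coords:
  assumes cd: "c \<in> tot P" "d \<in> base P" "q \<in> fst c" "proj P q \<in> fst d"
  defines "x \<equiv> snd c q" and "u \<equiv> coords_in (base P) d (proj P q)"
  shows "vert_bracket P H q X a = vhat c x (Dalpha c x (hhat c d x (u X)) a - Dh c d x (alpha c q a) (u X))"
proof -
  let ?R = "vhat c x (Dalpha c x (hhat c d x (u X)) a - Dh c d x (alpha c q a) (u X))"
  have x: "x \<in> dom c d" "x \<in> snd c ` fst c" using cd by (auto simp: x_def dom_def)
  have opd: "open (proj P -` fst d)" by (rule open_proj_vimage) (use okM[OF cd(2)] in \<open>simp add: chart_ok_def\<close>)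
  have opc: "open (snd c ` fst c)" using okQ[OF cd(1)] by (simp add: chart_ok_def)
  have inv: "chart_inv c x = q" by (simp add: x_def chart_inv_chart[OF okQ[OF cd(1)] cd(3)])
  have Df: "frechet_derivative (local_rep (tot P) c (fundamental_field P a)) (at x) \<xi> = Dalpha c x \<xi> a" for \<xi>
  proof -
    have "(local_rep (tot P) c (fundamental_field P a) has_derivative (\<lambda>\<xi>. Dalpha c x \<xi> a)) (at x)"
      by (rule has_derivative_transform_within_open[OF alpha_has_derivative[OF cd(1) x(2)] opc x(2)])
        (simp add: fundamental_rep[OF cd(1)])
    from fun_cong[OF frechet_derivative_at[OF this], of \<xi>] show ?thesis by simp
  qed
  have main: "vert_part P H q (lie_bracket (tot P) (lift_field P H X') (fundamental_field P a) q) = ?R"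
    if X': "smooth_vector_field_on (base P) UNIV X'" "X' (proj P q) = X" for X'
  proof -
    let ?X = "local_rep (base P) d X'" and ?y = "snd d (proj P q)"
    have uX: "?X ?y = u X"
      using X' by (simp add: local_rep_def u_def chart_inv_chart[OF okM[OF cd(2)] cd(4)])
    have rep: "local_rep (tot P) c (lift_field P H X') x = hhat c d x (u X)"
      using lift_field_rep[OF cd(1,2) x(1), of X'] by (simp add: inv uX)
    have DX0: "frechet_derivative ?X (at ?y) 0 = 0"
    proof -
      have "smooth_on (snd d ` fst d) ?X" using X' cd by (simp add: smooth_vector_field_on_def)
      then have "(?X has_derivative frechet_derivative ?X (at ?y)) (at ?y)"
        by (rule smooth_on_has_derivative[rotated]) (use okM[OF cd(2)] cd in \<open>auto simp: chart_ok_def\<close>)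
      from linear_0[OF has_derivative_linear[OF this]] show ?thesis .
    qed
    have "coords_in (tot P) c q (lie_bracket (tot P) (lift_field P H X') (fundamental_field P a) q) =
        frechet_derivative (local_rep (tot P) c (fundamental_field P a)) (at x) (local_rep (tot P) c (lift_field P H X') x) -
        frechet_derivative (local_rep (tot P) c (lift_field P H X')) (at x) (local_rep (tot P) c (fundamental_field P a) x)"
      unfolding x_def
      by (rule lie_bracket_coords[OF totA opd _ smooth_lift_field[OF cd(2) X'(1)] smooth_fundamental cd(1,3)]) (simp add: cd)
    also have "\<dots> = Dalpha c x (hhat c d x (u X)) a - Dh c d x (alpha c q a) (u X)"
      unfolding Df rep fundamental_rep[OF cd(1) x(2)] inv
      unfolding x_def lift_field_has_derivative[OF cd X'(1)] proj_alpha[OF cd] uX DX0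
        linear_0[OF linear_hhat[OF cd(1,2) x(1)[unfolded dom_def], unfolded x_def]] by simp
    finally show ?thesis
      unfolding vert_part_vhat[OF cd(1,3)] x_def by simp
  qed
  obtain X' where X': "smooth_vector_field_on (base P) UNIV X'" "X' (proj P q) = X"
    using vector_field_extension[OF baseA] by blast
  show ?thesis
    unfolding vert_bracket_def
  proof (rule the_equality)
    fix r assume "\<forall>X'. smooth_vector_field_on (base P) UNIV X' \<and> X' (proj P q) = X \<longrightarrow>
       r = vert_part P H q (lie_bracket (tot P) (lift_field P H X') (fundamental_field P a) q)"
    then have "r = vert_part P H q (lie_bracket (tot P) (lift_field P H X') (fundamental_field P a) q)"
      using X' by blast
    then show "r = ?R" using main[OF X'] by simp
  qed (use main in auto)
qed

section \<open>Derivatives of the Lagrangian in coordinates\<close>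

definition Lhat :: "('q \<times> 'eq \<Rightarrow> real) \<Rightarrow> ('q, 'eq) chart \<Rightarrow> 'eq \<times> 'eq \<Rightarrow> real" where
  "Lhat L c = (\<lambda>(x, w). L (chart_inv c x, from_coords (tot P) c (chart_inv c x) w))"

lemma L_eq_Lhat: "c \<in> tot P \<Longrightarrow> q \<in> fst c \<Longrightarrow> L (q, v) = Lhat L c (snd c q, coords_in (tot P) c q v)"
  by (simp add: Lhat_def chart_inv_chart okQ from_coords_coords_in[OF totA])

lemma Lhat_has_derivative:
  assumes "smooth_on_tangent_bundle (tot P) L" "c \<in> tot P" "x \<in> snd c ` fst c"
  shows "(Lhat L c has_derivative frechet_derivative (Lhat L c) (at (x, w))) (at (x, w))"
proof (rule smooth_on_has_derivative)
  show "open ((snd c ` fst c) \<times> (UNIV :: 'eq set))" using okQ[OF assms(2)] by (simp add: chart_ok_def open_Times)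
  show "smooth_on ((snd c ` fst c) \<times> UNIV) (Lhat L c)"
    using assms unfolding smooth_on_tangent_bundle_def Lhat_def by blast
qed (use assms in auto)

text \<open>\<open>Blinfun\<close> returns the given function only if that is bounded linear.
  Linearity in \<open>b\<close> holds since all the directional derivatives come from one total
  derivative of the Lagrangian, composed with the linear map \<open>alpha\<close>.\<close>

lemma FL_coords:
  assumes L: "smooth_on_tangent_bundle (tot P) L" and c: "c \<in> tot P" "q \<in> fst c"
  shows "blinfun_apply (FL P L q v) b =
    frechet_derivative (Lhat L c) (at (snd c q, coords_in (tot P) c q v)) (0, alpha c q b)"
proof -
  define x where "x = snd c q"
  define w where "w = coords_in (tot P) c q v"
  have D: "(Lhat L c has_derivative frechet_derivative (Lhat L c) (at (x, w))) (at (x, w))"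
    by (rule Lhat_has_derivative[OF L c(1)]) (use c in \<open>simp add: x_def\<close>)
  have "deriv (\<lambda>t. L (q, v + t *\<^sub>R fundamental_field P b q)) 0 = frechet_derivative (Lhat L c) (at (x, w)) (0, alpha c q b)" for b
  proof -
    have "L (q, v + t *\<^sub>R fundamental_field P b q) = Lhat L c ((x, w) + t *\<^sub>R (0, alpha c q b))" for t
      by (simp add: L_eq_Lhat[OF c] x_def w_def linear_add[OF linear_coords_in[OF totA c]]
          linear_scale[OF linear_coords_in[OF totA c]] coords_fundamental[OF c])
    moreover have "((\<lambda>t. Lhat L c ((x, w) + t *\<^sub>R (0, alpha c q b))) has_derivative
        (\<lambda>h. h *\<^sub>R frechet_derivative (Lhat L c) (at (x, w)) (0, alpha c q b))) (at 0)"
      by (rule has_derivative_along_line) (use D in \<open>simp flip: zero_prod_def\<close>)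
    ultimately have "((\<lambda>t. L (q, v + t *\<^sub>R fundamental_field P b q)) has_real_derivative
        frechet_derivative (Lhat L c) (at (x, w)) (0, alpha c q b)) (at 0)"
      by (simp add: has_field_derivative_def mult_commute_abs)
    then show ?thesis by (rule DERIV_imp_deriv)
  qed
  moreover have "bounded_linear (\<lambda>b. frechet_derivative (Lhat L c) (at (x, w)) (0, alpha c q b))"
  proof (rule linear_imp_bounded_linear, rule linearI)
    fix b b' :: 'eg and r :: real
    have "(0, alpha c q (b + b')) = (0, alpha c q b) + (0 :: 'eq, alpha c q b')"
      by (simp add: linear_add[OF linear_alpha[OF c]])
    then show "frechet_derivative (Lhat L c) (at (x, w)) (0, alpha c q (b + b')) =
        frechet_derivative (Lhat L c) (at (x, w)) (0, alpha c q b) + frechet_derivative (Lhat L c) (at (x, w)) (0, alpha c q b')"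
      using linear_add[OF has_derivative_linear[OF D]] by metis
    have "(0, alpha c q (r *\<^sub>R b)) = r *\<^sub>R (0 :: 'eq, alpha c q b)"
      by (simp add: linear_scale[OF linear_alpha[OF c]])
    then show "frechet_derivative (Lhat L c) (at (x, w)) (0, alpha c q (r *\<^sub>R b)) =
        r *\<^sub>R frechet_derivative (Lhat L c) (at (x, w)) (0, alpha c q b)"
      using linear_scale[OF has_derivative_linear[OF D]] by metis
  qed
  ultimately show ?thesis
    unfolding FL_def x_def w_def by (simp add: bounded_linear_Blinfun_apply)
qed

text \<open>The orbit of \<open>q\<close> stays in its fibre, so the projected vector has the same
  coordinates \<open>u\<close> throughout, and only the point and \<open>hhat\<close> vary. The
  chain rule along the orbit yields both components of the direction.\<close>

lemma HL_coords:
  assumes L: "smooth_on_tangent_bundle (tot P) L"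
    and cd: "c \<in> tot P" "d \<in> base P" "q \<in> fst c" "proj P q \<in> fst d" and v: "v \<in> H q"
  defines "u \<equiv> coords_in (base P) d (proj P q) (tangent_map (tot P) (base P) (proj P) q v)"
  shows "blinfun_apply (HL P H L q v) b =
    frechet_derivative (Lhat L c) (at (snd c q, coords_in (tot P) c q v)) (alpha c q b, Dh c d (snd c q) (alpha c q b) u)"
proof -
  define x where "x = snd c q"
  define w where "w = coords_in (tot P) c q v"
  have x: "x \<in> dom c d" using cd by (auto simp: x_def dom_def)
  let ?U = "tangent_map (tot P) (base P) (proj P) q v"
  have inv: "chart_inv c x = q" by (simp add: x_def chart_inv_chart[OF okQ[OF cd(1)] cd(3)])
  have hw: "hhat c d x u = w"
    unfolding hhat_def inv u_def w_def from_coords_coords_in[OF baseA cd(2,4)] horizontal_lift_tangent[OF v] ..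
  have D: "(Lhat L c has_derivative frechet_derivative (Lhat L c) (at (x, w))) (at (x, w))"
    by (rule Lhat_has_derivative[OF L cd(1)]) (use cd in \<open>simp add: x_def\<close>)
  have "deriv (\<lambda>t. let q' = act P q (lie_exp P (t *\<^sub>R b)) in L (q', horizontal_lift P H q' ?U)) 0 =
      frechet_derivative (Lhat L c) (at (x, w)) (alpha c q b, Dh c d x (alpha c q b) u)" for b
  proof -
    define \<gamma> where "\<gamma> t = act P q (lie_exp P (t *\<^sub>R b))" for t
    have \<gamma>0: "\<gamma> 0 = q" using orbit_derivative(3)[OF cd(1,3)] by (simp add: \<gamma>_def)
    have cont: "isCont \<gamma> 0" using orbit_derivative(2)[OF cd(1,3)] by (simp add: \<gamma>_def[abs_def])
    have D\<gamma>: "((\<lambda>t. snd c (\<gamma> t)) has_derivative (\<lambda>h. h *\<^sub>R alpha c q b)) (at 0)"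
      using orbit_derivative(1)[OF cd(1,3)] by (simp add: \<gamma>_def has_vector_derivative_def)
    have "((\<lambda>y. hhat c d y u) has_derivative (\<lambda>\<xi>. Dh c d x \<xi> u)) (at (snd c (\<gamma> 0)))"
      using hhat_has_derivative[OF cd(1,2) x] by (simp add: \<gamma>0 x_def)
    from diff_chain_at[OF D\<gamma> this]
    have "((\<lambda>t. hhat c d (snd c (\<gamma> t)) u) has_derivative (\<lambda>h. h *\<^sub>R Dh c d x (alpha c q b) u)) (at 0)"
      by (simp add: o_def linear_scale[OF linear_Dh_left[OF cd(1,2) x]])
    from has_derivative_Pair[OF D\<gamma> this]
    have "((\<lambda>t. (snd c (\<gamma> t), hhat c d (snd c (\<gamma> t)) u)) has_derivative
        (\<lambda>h. h *\<^sub>R (alpha c q b, Dh c d x (alpha c q b) u))) (at 0)" by simp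
    from diff_chain_at[OF this, of "Lhat L c" "frechet_derivative (Lhat L c) (at (x, w))"] D
    have "((\<lambda>t. Lhat L c (snd c (\<gamma> t), hhat c d (snd c (\<gamma> t)) u)) has_derivative
        (\<lambda>h. h *\<^sub>R frechet_derivative (Lhat L c) (at (x, w)) (alpha c q b, Dh c d x (alpha c q b) u))) (at 0)"
      unfolding \<gamma>0 x_def[symmetric] hw o_def linear_scale[OF has_derivative_linear[OF D]] by blast
    \<comment> \<open>The orbit is known to lie in the chart only for small \<open>t\<close>, which
      is enough for a derivative at 0.\<close>
    moreover have "eventually (\<lambda>t. Lhat L c (snd c (\<gamma> t), hhat c d (snd c (\<gamma> t)) u) = L (\<gamma> t, horizontal_lift P H (\<gamma> t) ?U)) (at 0)"
    proof -
      have "eventually (\<lambda>t. \<gamma> t \<in> fst c) (at 0)"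
        using cont okQ[OF cd(1)] cd(3) unfolding isCont_def \<gamma>0 by (intro topological_tendstoD) (auto simp: chart_ok_def)
      then show ?thesis
      proof eventually_elim
        case (elim t)
        have "proj P (\<gamma> t) = proj P q" by (simp add: \<gamma>_def)
        then show ?case
          by (simp add: L_eq_Lhat[OF cd(1) elim] hhat_def chart_inv_chart[OF okQ[OF cd(1)] elim] u_def
              from_coords_coords_in[OF baseA cd(2,4)])
      qed
    qed
    ultimately have "((\<lambda>t. L (\<gamma> t, horizontal_lift P H (\<gamma> t) ?U)) has_derivative
        (\<lambda>h. h *\<^sub>R frechet_derivative (Lhat L c) (at (x, w)) (alpha c q b, Dh c d x (alpha c q b) u))) (at 0)"
      by (rule has_derivative_transform_eventually)
        (simp_all add: \<gamma>0 x_def[symmetric] hw L_eq_Lhat[OF cd(1,3)] horizontal_lift_tangent[OF v] w_def)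
    then have "((\<lambda>t. L (\<gamma> t, horizontal_lift P H (\<gamma> t) ?U)) has_real_derivative
        frechet_derivative (Lhat L c) (at (x, w)) (alpha c q b, Dh c d x (alpha c q b) u)) (at 0)"
      by (simp add: has_field_derivative_def mult_commute_abs)
    then show ?thesis unfolding \<gamma>_def Let_def by (rule DERIV_imp_deriv)
  qed
  moreover have "bounded_linear (\<lambda>b. frechet_derivative (Lhat L c) (at (x, w)) (alpha c q b, Dh c d x (alpha c q b) u))"
  proof (rule linear_imp_bounded_linear, rule linearI)
    fix b b' :: 'eg and r :: real
    let ?z = "\<lambda>b. (alpha c q b, Dh c d x (alpha c q b) u)"
    have "?z (b + b') = ?z b + ?z b'"
      by (simp add: linear_add[OF linear_alpha[OF cd(1,3)]] linear_add[OF linear_Dh_left[OF cd(1,2) x]])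
    then show "frechet_derivative (Lhat L c) (at (x, w)) (?z (b + b')) =
        frechet_derivative (Lhat L c) (at (x, w)) (?z b) + frechet_derivative (Lhat L c) (at (x, w)) (?z b')"
      using linear_add[OF has_derivative_linear[OF D]] by metis
    have "?z (r *\<^sub>R b) = r *\<^sub>R ?z b"
      by (simp add: linear_scale[OF linear_alpha[OF cd(1,3)]] linear_scale[OF linear_Dh_left[OF cd(1,2) x]])
    then show "frechet_derivative (Lhat L c) (at (x, w)) (?z (r *\<^sub>R b)) =
        r *\<^sub>R frechet_derivative (Lhat L c) (at (x, w)) (?z b)"
      using linear_scale[OF has_derivative_linear[OF D]] by metis
  qed
  ultimately show ?thesis
    unfolding HL_def x_def w_def by (simp add: bounded_linear_Blinfun_apply)
qed

end

section \<open>Smooth dependence along the path and the two implications\<close>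

section \<open>Horizontal paths\<close>

locale horizontal_path = horizontal_bundle P H
  for P :: "('q::{t2_space,second_countable_topology}, 'eq::finite_euclidean,
      'm::{t2_space,second_countable_topology}, 'em::finite_euclidean,
      'g::{t2_space,second_countable_topology}, 'eg::finite_euclidean) bundle_data"
    and H :: "'q \<Rightarrow> 'eq set" +
  fixes L :: "'q \<times> 'eq \<Rightarrow> real" and t0 t1 :: real and q :: "real \<Rightarrow> 'q" and Xt :: "real \<Rightarrow> 'eq"
  assumes L: "smooth_on_tangent_bundle (tot P) L" and t01: "t0 < t1"
    and path: "horizontal_admissible_path P H {t0..t1} q Xt"
begin

abbreviation I where "I \<equiv> {t0..t1}"

lemma thick_I: "thick I"
  by (rule thick_interval[OF t01])

lemma q_smooth: "smooth_map_on line_atlas (tot P) I q"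
  and Xt_velocity: "t \<in> I \<Longrightarrow> Xt t = velocity (tot P) I q t"
  and Xt_H: "t \<in> I \<Longrightarrow> Xt t \<in> H (q t)"
  using path unfolding horizontal_admissible_path_def by blast+

abbreviation pd where "pd \<equiv> pushdown P q"

text \<open>Times at which both the path and its projection are in given charts. These sets are
  relatively open and cover the interval, so smoothness in time can be checked on each of them,
  where the coordinate formulas apply.\<close>

definition T :: "('q, 'eq) chart \<Rightarrow> ('m, 'em) chart \<Rightarrow> real set" where
  "T c d = I \<inter> q -` (fst c \<inter> proj P -` fst d)"

lemma relatively_open:
  assumes "open U"
  obtains W where "open W" "I \<inter> q -` U = I \<inter> W"
proof -
  have "continuous_on I q" using q_smooth by (simp add: smooth_map_on_def)
  then obtain W where "open W" "W \<inter> I = q -` U \<inter> I"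
    using assms unfolding continuous_on_open_invariant by blast
  then show thesis using that[of W] by blast
qed

lemma T_open:
  assumes "c \<in> tot P" "d \<in> base P"
  obtains W where "open W" "T c d = I \<inter> W"
proof -
  have "open (fst c \<inter> proj P -` fst d)"
    using okQ[OF assms(1)] okM[OF assms(2)] by (auto simp: chart_ok_def intro!: open_Int open_proj_vimage)
  then show thesis using relatively_open that unfolding T_def by metis
qed

lemma smooth_on_I:
  assumes "\<And>c d. c \<in> tot P \<Longrightarrow> d \<in> base P \<Longrightarrow> smooth_on (T c d) f"
  shows "smooth_on I f"
proof (rule smooth_on_local[OF thick_I])
  fix t assume t: "t \<in> I"
  let ?c = "chart_at (tot P) (q t)" and ?d = "chart_at (base P) (proj P (q t))"
  have cd: "?c \<in> tot P" "q t \<in> fst ?c" "?d \<in> base P" "proj P (q t) \<in> fst ?d"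
    using chart_at_in[OF totA] chart_at_in[OF baseA] by auto
  obtain W where W: "open W" "T ?c ?d = I \<inter> W" using T_open[OF cd(1,3)] by blast
  have "t \<in> T ?c ?d" using cd t by (simp add: T_def)
  then show "\<exists>W. open W \<and> t \<in> W \<and> smooth_on (I \<inter> W) f"
    using W assms[OF cd(1,3)] by auto
qed

lemma T_dom: "c \<in> tot P \<Longrightarrow> d \<in> base P \<Longrightarrow> (\<lambda>t. snd c (q t)) ` T c d \<subseteq> dom c d"
  by (auto simp: T_def dom_def)

lemma T_D: "t \<in> T c d \<Longrightarrow> t \<in> I \<and> q t \<in> fst c \<and> proj P (q t) \<in> fst d"
  by (auto simp: T_def)

lemma smooth_position: "c \<in> tot P \<Longrightarrow> smooth_on (T c d) (\<lambda>t. snd c (q t))"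
  by (rule smooth_on_subset[OF smooth_curve_coords[OF q_smooth]]) (auto simp: T_def)

lemma smooth_along:
  assumes "c \<in> tot P" "d \<in> base P" "smooth_on (dom c d) f"
  shows "smooth_on (T c d) (\<lambda>t. f (snd c (q t)))"
  by (rule smooth_on_compose[OF smooth_position[OF assms(1)] assms(3) T_dom[OF assms(1,2)]])

lemma smooth_tangent_curve_T:
  assumes "smooth_tangent_curve (tot P) I q Yt" "c \<in> tot P"
  shows "smooth_on (T c d) (\<lambda>t. coords_in (tot P) c (q t) (Yt t))"
  by (rule smooth_on_subset[of "I \<inter> q -` fst c"]) (use assms in \<open>auto simp: T_def smooth_tangent_curve_def\<close>)

text \<open>In a fixed chart the velocity is the ordinary derivative of the coordinates of the path,
  taken within the interval, and derivatives of smooth functions on thick sets are smooth.\<close>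

lemma Xt_smooth: "smooth_tangent_curve (tot P) I q Xt"
  unfolding smooth_tangent_curve_def
proof (intro conjI ballI q_smooth)
  fix c assume c: "c \<in> tot P"
  have "open (fst c)" using okQ[OF c] by (simp add: chart_ok_def)
  then obtain W where W: "open W" "I \<inter> q -` fst c = I \<inter> W" using relatively_open by blast
  have sm: "smooth_on (I \<inter> W) (\<lambda>t. snd c (q t))" using smooth_curve_coords[OF q_smooth c] W by simp
  have th: "thick (I \<inter> W)" by (rule thick_Int_open[OF thick_I W(1)])
  show "smooth_on (I \<inter> q -` fst c) (\<lambda>t. coords_in (tot P) c (q t) (Xt t))"
    unfolding W(2)
  proof (rule smooth_on_eqI[OF smooth_on_vector_derivative[OF th sm]])
    fix t assume t: "t \<in> I \<inter> W"
    then have "t \<in> I \<inter> q -` fst c" unfolding W(2) .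
    then have t': "t \<in> I" "q t \<in> fst c" by simp_all
    have "((\<lambda>s. snd c (q s)) has_vector_derivative coords_in (tot P) c (q t) (Xt t)) (at t within I)"
      using smooth_curve_velocity[OF totA thick_I q_smooth c t'] Xt_velocity[OF t'(1)] by simp
    then have "((\<lambda>s. snd c (q s)) has_vector_derivative coords_in (tot P) c (q t) (Xt t)) (at t within (I \<inter> W))"
      by (rule has_vector_derivative_within_subset[OF _ Int_lower1])
    from thick_vector_derivative[OF th t this]
    show "vector_derivative (\<lambda>t. snd c (q t)) (at t within I \<inter> W) = coords_in (tot P) c (q t) (Xt t)" .
  qed
qed

abbreviation bcoords :: "('m, 'em) chart \<Rightarrow> real \<Rightarrow> 'em \<Rightarrow> 'em" where
  "bcoords d t \<equiv> coords_in (base P) d (proj P (q t))"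

lemma smooth_mder_proj:
  assumes cd: "c \<in> tot P" "d \<in> base P"
  shows "smooth_on (dom c d) (\<lambda>x. mder (proj P) c d (chart_inv c x) v)"
  using smooth_on_mder[OF proj_smooth open_UNIV okQ[OF cd(1)] okM[OF cd(2)] cd] by (simp add: dom_def)

lemma smooth_pushdown:
  assumes Yt: "smooth_tangent_curve (tot P) I q Yt" and cd: "c \<in> tot P" "d \<in> base P"
  shows "smooth_on (T c d) (\<lambda>t. bcoords d t (pd Yt t))"
proof (rule smooth_on_eqI)
  show "smooth_on (T c d) (\<lambda>t. mder (proj P) c d (chart_inv c (snd c (q t))) (coords_in (tot P) c (q t) (Yt t)))"
  proof (rule smooth_on_apply[where A = "\<lambda>t. mder (proj P) c d (chart_inv c (snd c (q t)))"])
    show "linear (mder (proj P) c d (chart_inv c (snd c (q t))))" if "t \<in> T c d" for t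
      using T_D[OF that] has_mder_linear[OF has_mder_proj[OF cd]] by (simp add: chart_inv_chart[OF okQ[OF cd(1)]])
    show "smooth_on (T c d) (\<lambda>t. mder (proj P) c d (chart_inv c (snd c (q t))) v)" for v
      by (rule smooth_along[OF cd smooth_mder_proj[OF cd]])
    show "smooth_on (T c d) (\<lambda>t. coords_in (tot P) c (q t) (Yt t))"
      by (rule smooth_tangent_curve_T[OF Yt cd(1)])
  qed
  fix t assume "t \<in> T c d"
  then show "mder (proj P) c d (chart_inv c (snd c (q t))) (coords_in (tot P) c (q t) (Yt t)) = bcoords d t (pd Yt t)"
    using coords_tangent_map[OF cd] T_D by (simp add: chart_inv_chart[OF okQ[OF cd(1)]])
qed

lemma smooth_hhat_along:
  assumes cd: "c \<in> tot P" "d \<in> base P" and u: "smooth_on (T c d) u"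
  shows "smooth_on (T c d) (\<lambda>t. hhat c d (snd c (q t)) (u t))"
  by (rule smooth_on_apply[where A = "\<lambda>t. hhat c d (snd c (q t))",
        OF _ smooth_along[OF cd smooth_hhat[OF cd, folded dom_def]] u])
    (use T_dom[OF cd] linear_hhat[OF cd, folded dom_def] in blast)

lemma smooth_vhat_along:
  assumes cd: "c \<in> tot P" "d \<in> base P" and u: "smooth_on (T c d) u"
  shows "smooth_on (T c d) (\<lambda>t. vhat c (snd c (q t)) (u t))"
  by (rule smooth_on_apply[where A = "\<lambda>t. vhat c (snd c (q t))",
        OF _ smooth_along[OF cd smooth_on_subset[OF smooth_vhat[OF cd(1)] dom_subset]] u])
    (use T_D linear_vhat[OF cd(1)] in blast)

lemma smooth_alpha_along:
  assumes cd: "c \<in> tot P" "d \<in> base P"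
  shows "smooth_on (T c d) (\<lambda>t. alpha c (q t) a)"
  by (rule smooth_on_eqI[OF smooth_along[OF cd smooth_on_subset[OF smooth_alpha[OF cd(1), of a] dom_subset]]])
    (use T_D in \<open>simp add: chart_inv_chart[OF okQ[OF cd(1)]]\<close>)

text \<open>Both the direction and the argument move along the path; linearity in each of them is
  used in turn.\<close>

lemma smooth_Dh_along:
  assumes cd: "c \<in> tot P" "d \<in> base P" and u: "smooth_on (T c d) u" and \<xi>: "smooth_on (T c d) \<xi>"
  shows "smooth_on (T c d) (\<lambda>t. Dh c d (snd c (q t)) (\<xi> t) (u t))"
proof (rule smooth_on_apply[where A = "\<lambda>t. Dh c d (snd c (q t)) (\<xi> t)", OF _ _ u])
  have dom: "snd c (q t) \<in> dom c d" if "t \<in> T c d" for t using T_dom[OF cd] that by blast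
  show "linear (Dh c d (snd c (q t)) (\<xi> t))" if "t \<in> T c d" for t
    by (rule linear_Dh_right[OF cd dom[OF that]])
  show "smooth_on (T c d) (\<lambda>t. Dh c d (snd c (q t)) (\<xi> t) e)" for e
    by (rule smooth_on_apply[where A = "\<lambda>t \<xi>. Dh c d (snd c (q t)) \<xi> e",
          OF linear_Dh_left[OF cd dom] smooth_along[OF cd smooth_Dh[OF cd]] \<xi>])
qed

lemma smooth_Dalpha_along:
  assumes cd: "c \<in> tot P" "d \<in> base P" and \<xi>: "smooth_on (T c d) \<xi>"
  shows "smooth_on (T c d) (\<lambda>t. Dalpha c (snd c (q t)) (\<xi> t) a)"
  by (rule smooth_on_apply[where A = "\<lambda>t \<xi>. Dalpha c (snd c (q t)) \<xi> a",
        OF linear_Dalpha_left[OF cd(1)] smooth_along[OF cd smooth_on_subset[OF smooth_Dalpha[OF cd(1)] dom_subset]] \<xi>])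
    (use T_D in blast)

definition curv :: "real \<Rightarrow> 'em \<Rightarrow> 'eg" where
  "curv t Y = curvature P H (q t) (pd Xt t) Y"

lemma smooth_curv:
  assumes cd: "c \<in> tot P" "d \<in> base P" and y: "smooth_on (T c d) (\<lambda>t. bcoords d t (y t))"
  shows "smooth_on (T c d) (\<lambda>t. curv t (y t))"
proof (rule smooth_on_eqI)
  let ?x = "\<lambda>t. snd c (q t)" and ?u = "\<lambda>t. bcoords d t (pd Xt t)" and ?w = "\<lambda>t. bcoords d t (y t)"
  have u: "smooth_on (T c d) ?u" by (rule smooth_pushdown[OF Xt_smooth cd])
  show "smooth_on (T c d) (\<lambda>t. vhat c (?x t)
      (Dh c d (?x t) (hhat c d (?x t) (?u t)) (?w t) - Dh c d (?x t) (hhat c d (?x t) (?w t)) (?u t)))"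
    by (intro smooth_vhat_along[OF cd] smooth_on_diff smooth_Dh_along[OF cd] smooth_hhat_along[OF cd] u y)
  fix t assume "t \<in> T c d"
  from T_D[OF this] show "vhat c (?x t)
      (Dh c d (?x t) (hhat c d (?x t) (?u t)) (?w t) - Dh c d (?x t) (hhat c d (?x t) (?w t)) (?u t)) = curv t (y t)"
    unfolding curv_def by (simp add: curvature_coords[OF cd])
qed

lemma linear_curv: "linear (curv t)"
proof -
  let ?c = "chart_at (tot P) (q t)" and ?d = "chart_at (base P) (proj P (q t))"
  have cd: "?c \<in> tot P" "?d \<in> base P" "q t \<in> fst ?c" "proj P (q t) \<in> fst ?d"
    using chart_at_in[OF totA] chart_at_in[OF baseA] by auto
  let ?x = "snd ?c (q t)" and ?u = "bcoords ?d t (pd Xt t)"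
  have x: "?x \<in> dom ?c ?d" "?x \<in> snd ?c ` fst ?c" using cd by (auto simp: dom_def)
  note lin = linear_coords_in[OF baseA cd(2,4)] linear_hhat[OF cd(1,2) x(1)[unfolded dom_def]]
    linear_Dh_right[OF cd(1,2) x(1)] linear_Dh_left[OF cd(1,2) x(1)] linear_vhat[OF cd(1) x(2)]
  have "linear (\<lambda>Y. vhat ?c ?x (Dh ?c ?d ?x (hhat ?c ?d ?x ?u) (bcoords ?d t Y)
      - Dh ?c ?d ?x (hhat ?c ?d ?x (bcoords ?d t Y)) ?u))"
    by (rule linearI)
      (simp_all add: lin[THEN linear_add] lin[THEN linear_scale] lin[THEN linear_diff] algebra_simps)
  then show ?thesis
    unfolding curv_def curvature_coords[OF cd] .
qed

definition Bop :: "real \<Rightarrow> 'eg \<Rightarrow>\<^sub>L 'eg" where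
  "Bop t = Blinfun (vert_bracket P H (q t) (pd Xt t))"

text \<open>Linearity of the vertical bracket in the Lie algebra element is read off from its
  coordinate formula; it is what makes \<open>Blinfun\<close> faithful here.\<close>

lemma Bop_apply: "blinfun_apply (Bop t) = vert_bracket P H (q t) (pd Xt t)"
proof -
  let ?c = "chart_at (tot P) (q t)" and ?d = "chart_at (base P) (proj P (q t))"
  have cd: "?c \<in> tot P" "?d \<in> base P" "q t \<in> fst ?c" "proj P (q t) \<in> fst ?d"
    using chart_at_in[OF totA] chart_at_in[OF baseA] by auto
  let ?x = "snd ?c (q t)" and ?u = "bcoords ?d t (pd Xt t)"
  have x: "?x \<in> dom ?c ?d" "?x \<in> snd ?c ` fst ?c" using cd by (auto simp: dom_def)
  note lin = linear_alpha[OF cd(1,3)] linear_Dalpha_right[OF cd(1) x(2)]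
    linear_Dh_left[OF cd(1,2) x(1)] linear_vhat[OF cd(1) x(2)]
  have "linear (\<lambda>a. vhat ?c ?x (Dalpha ?c ?x (hhat ?c ?d ?x ?u) a - Dh ?c ?d ?x (alpha ?c (q t) a) ?u))"
    by (rule linearI)
      (simp_all add: lin[THEN linear_add] lin[THEN linear_scale] lin[THEN linear_diff] algebra_simps)
  then have "linear (vert_bracket P H (q t) (pd Xt t))"
    unfolding vert_bracket_coords[OF cd, symmetric] by simp
  from linear_imp_bounded_linear[OF this] show ?thesis
    unfolding Bop_def by (rule bounded_linear_Blinfun_apply)
qed

lemma smooth_Bop: "smooth_on I Bop"
proof (rule smooth_on_I, rule smooth_on_blinfun)
  fix c d a assume cd: "c \<in> tot P" "d \<in> base P"
  let ?x = "\<lambda>t. snd c (q t)" and ?u = "\<lambda>t. bcoords d t (pd Xt t)"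
  have u: "smooth_on (T c d) ?u" by (rule smooth_pushdown[OF Xt_smooth cd])
  have "smooth_on (T c d) (\<lambda>t. vhat c (?x t)
      (Dalpha c (?x t) (hhat c d (?x t) (?u t)) a - Dh c d (?x t) (alpha c (q t) a) (?u t)))"
    by (intro smooth_vhat_along[OF cd] smooth_on_diff smooth_Dh_along[OF cd] smooth_Dalpha_along[OF cd]
        smooth_hhat_along[OF cd] smooth_alpha_along[OF cd] u)
  then show "smooth_on (T c d) (\<lambda>t. blinfun_apply (Bop t) a)"
  proof (rule smooth_on_eqI)
    fix t assume "t \<in> T c d"
    from T_D[OF this] show "vhat c (?x t)
      (Dalpha c (?x t) (hhat c d (?x t) (?u t)) a - Dh c d (?x t) (alpha c (q t) a) (?u t)) = blinfun_apply (Bop t) a"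
      unfolding Bop_apply by (simp add: vert_bracket_coords[OF cd])
  qed
qed

lemma smooth_DLhat_along:
  assumes cd: "c \<in> tot P" "d \<in> base P" and z: "smooth_on (T c d) z"
  shows "smooth_on (T c d)
    (\<lambda>t. frechet_derivative (Lhat L c) (at (snd c (q t), coords_in (tot P) c (q t) (Xt t))) (z t))"
proof (rule smooth_on_apply[where A = "\<lambda>t. frechet_derivative (Lhat L c) (at (snd c (q t), coords_in (tot P) c (q t) (Xt t)))",
      OF _ _ z])
  show "linear (frechet_derivative (Lhat L c) (at (snd c (q t), coords_in (tot P) c (q t) (Xt t))))" if "t \<in> T c d" for t
    using T_D[OF that] by (intro has_derivative_linear[OF Lhat_has_derivative[OF L cd(1)]]) auto
  fix e
  have op: "open ((snd c ` fst c) \<times> (UNIV :: 'eq set))" using okQ[OF cd(1)] by (simp add: chart_ok_def open_Times)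
  have "smooth_on ((snd c ` fst c) \<times> UNIV) (Lhat L c)"
    using L cd unfolding smooth_on_tangent_bundle_def Lhat_def by blast
  from smooth_on_frechet_derivative[OF op this]
  show "smooth_on (T c d) (\<lambda>t. frechet_derivative (Lhat L c) (at (snd c (q t), coords_in (tot P) c (q t) (Xt t))) e)"
    by (rule smooth_on_compose[OF smooth_on_Pair[OF smooth_position[OF cd(1)] smooth_tangent_curve_T[OF Xt_smooth cd(1)]]])
      (auto simp: T_def)
qed

lemma smooth_FL: "smooth_on I (\<lambda>t. FL P L (q t) (Xt t))"
proof (rule smooth_on_I, rule smooth_on_blinfun)
  fix c d b assume cd: "c \<in> tot P" "d \<in> base P"
  have "smooth_on (T c d) (\<lambda>t. frechet_derivative (Lhat L c) (at (snd c (q t), coords_in (tot P) c (q t) (Xt t)))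
      (0, alpha c (q t) b))"
    by (intro smooth_DLhat_along[OF cd] smooth_on_Pair smooth_on_const smooth_alpha_along[OF cd])
  then show "smooth_on (T c d) (\<lambda>t. blinfun_apply (FL P L (q t) (Xt t)) b)"
    by (rule smooth_on_eqI) (use T_D in \<open>simp add: FL_coords[OF L cd(1)]\<close>)
qed

lemma smooth_HL: "smooth_on I (\<lambda>t. HL P H L (q t) (Xt t))"
proof (rule smooth_on_I, rule smooth_on_blinfun)
  fix c d b assume cd: "c \<in> tot P" "d \<in> base P"
  have "smooth_on (T c d) (\<lambda>t. frechet_derivative (Lhat L c) (at (snd c (q t), coords_in (tot P) c (q t) (Xt t)))
      (alpha c (q t) b, Dh c d (snd c (q t)) (alpha c (q t) b) (bcoords d t (pd Xt t))))"
    by (intro smooth_DLhat_along[OF cd] smooth_on_Pair smooth_Dh_along[OF cd] smooth_alpha_along[OF cd]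
        smooth_pushdown[OF Xt_smooth cd])
  then show "smooth_on (T c d) (\<lambda>t. blinfun_apply (HL P H L (q t) (Xt t)) b)"
    by (rule smooth_on_eqI) (use T_D Xt_H in \<open>simp add: HL_coords[OF L cd]\<close>)
qed

section \<open>Necessity and sufficiency of the multiplier\<close>

lemma multiplier_imp_N:
  assumes lam: "smooth_on I lam" and M: "condition_M P H L t0 t1 q Xt lam" and V: "condition_V P H t0 t1 q Xt lam"
  shows "condition_N P H L t0 t1 q Xt"
  unfolding condition_N_def
proof (intro allI impI, elim conjE)
  fix Yt b
  assume b: "smooth_on I b" "b t0 = 0" "b t1 = 0"
    and ode: "\<forall>t\<in>I. vector_derivative b (at t within I)
        + vert_bracket P H (q t) (pd Xt t) (b t) + curvature P H (q t) (pd Xt t) (pd Yt t) = 0"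
  define p where "p t = FL P L (q t) (Xt t) - lam t" for t
  have p: "smooth_on I p" unfolding p_def by (rule smooth_on_diff[OF smooth_FL lam])
  show "integral I (\<lambda>t. blinfun_apply (HL P H L (q t) (Xt t)) (b t)) =
     integral I (\<lambda>t. blinfun_apply (FL P L (q t) (Xt t)) (curvature P H (q t) (pd Xt t) (pd Yt t)))"
  proof (rule integral_eq_of_multiplier[OF less_imp_le[OF t01] smooth_on_has_vector_derivative[OF p]
        smooth_on_has_vector_derivative[OF b(1)] b(2,3)])
    fix t assume t: "t \<in> I"
    let ?B = "vert_bracket P H (q t) (pd Xt t) (b t)" and ?R = "curvature P H (q t) (pd Xt t) (pd Yt t)"
    \<comment> \<open>The only place where (V) enters: on curvature terms \<open>p\<close> and
      \<open>FL\<close> coincide.\<close>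
    have "blinfun_apply (lam t) ?R = 0" using V t unfolding condition_V_def by blast
    then have pR: "blinfun_apply (p t) ?R = blinfun_apply (FL P L (q t) (Xt t)) ?R"
      by (simp add: p_def blinfun.diff_left)
    have "vector_derivative b (at t within I) = - ?B - ?R"
      using bspec[OF ode t] by (simp add: eq_neg_iff_add_eq_0 algebra_simps)
    then have pb: "blinfun_apply (p t) (vector_derivative b (at t within I)) =
        - blinfun_apply (p t) ?B - blinfun_apply (p t) ?R"
      by (simp add: blinfun.diff_right blinfun.minus_right)
    have "blinfun_apply (HL P H L (q t) (Xt t) - vector_derivative p (at t within I)) (b t) + blinfun_apply (p t) ?B = 0"
      using M t unfolding condition_M_def p_def by blast
    then show "blinfun_apply (HL P H L (q t) (Xt t)) (b t) = blinfun_apply (vector_derivative p (at t within I)) (b t) +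
        blinfun_apply (p t) (vector_derivative b (at t within I)) + blinfun_apply (FL P L (q t) (Xt t)) ?R"
      unfolding pb pR[symmetric] by (simp add: blinfun.diff_left)
  qed
qed

definition variation :: "(real \<Rightarrow> 'eq) \<Rightarrow> bool" where
  "variation Yt \<longleftrightarrow> smooth_tangent_curve (tot P) I q Yt \<and> (\<forall>t\<in>I. Yt t \<in> H (q t)) \<and> Yt t0 = 0 \<and> Yt t1 = 0"

lemma variation_lin:
  assumes "variation Y" "variation Y'"
  shows "variation (\<lambda>t. r *\<^sub>R Y t + Y' t)"
  unfolding variation_def smooth_tangent_curve_def
proof (intro conjI ballI q_smooth)
  fix c assume c: "c \<in> tot P"
  have "smooth_on (I \<inter> q -` fst c) (\<lambda>t. r *\<^sub>R coords_in (tot P) c (q t) (Y t) + coords_in (tot P) c (q t) (Y' t))"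
    using assms c unfolding variation_def smooth_tangent_curve_def
    by (intro smooth_on_add smooth_on_bounded_linear_comp[OF bounded_linear_scaleR_right]) auto
  then show "smooth_on (I \<inter> q -` fst c) (\<lambda>t. coords_in (tot P) c (q t) (r *\<^sub>R Y t + Y' t))"
    by (rule smooth_on_eqI) (simp add: linear_add[OF linear_coords_in[OF totA c]] linear_scale[OF linear_coords_in[OF totA c]])
next
  show "r *\<^sub>R Y t + Y' t \<in> H (q t)" if "t \<in> I" for t
    using assms that unfolding variation_def by (intro subspace_add[OF subspace_H] subspace_scale[OF subspace_H]) auto
qed (use assms in \<open>auto simp: variation_def\<close>)

lemma variation_0: "variation (\<lambda>t. 0)"
  unfolding variation_def smooth_tangent_curve_def
proof (intro conjI ballI q_smooth)
  fix c assume c: "c \<in> tot P"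
  show "smooth_on (I \<inter> q -` fst c) (\<lambda>t. coords_in (tot P) c (q t) 0)"
    by (rule smooth_on_eqI[OF smooth_on_const]) (simp add: linear_0[OF linear_coords_in[OF totA c]])
qed (auto simp: subspace_0[OF subspace_H])

text \<open>Outside \<open>W\<close> the path may leave the domain of \<open>d\<close> under the
  projection, where \<open>from_coords\<close> has no meaning, but there the bump is zero. Inside,
  the coordinates are the bump times \<open>hhat\<close> on a constant vector.\<close>

lemma variation_bump:
  fixes u :: 'em
  assumes d: "d \<in> base P" and W: "open W" "I \<inter> W \<subseteq> q -` (proj P -` fst d)"
    and s: "r > 0" "cball s r \<subseteq> {t0<..<t1} \<inter> W"
  defines "Y \<equiv> \<lambda>t. bump s r t *\<^sub>R horizontal_lift P H (q t) (from_coords (base P) d (proj P (q t)) u)"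
  shows "variation Y"
proof -
  have Y0: "Y t = 0" if "t \<notin> cball s r" for t
    using that s(1) by (simp add: Y_def bump_eq_0 dist_norm norm_minus_commute)
  have "smooth_on (I \<inter> q -` fst c) (\<lambda>t. coords_in (tot P) c (q t) (Y t))" if c: "c \<in> tot P" for c
  proof (rule smooth_on_local)
    have "open (fst c)" using okQ[OF c] by (simp add: chart_ok_def)
    then obtain W' where "open W'" "I \<inter> q -` fst c = I \<inter> W'" using relatively_open by blast
    then show "thick (I \<inter> q -` fst c)" using thick_Int_open[OF thick_I] by simp
    fix t assume t: "t \<in> I \<inter> q -` fst c"
    show "\<exists>W. open W \<and> t \<in> W \<and> smooth_on (I \<inter> q -` fst c \<inter> W) (\<lambda>t. coords_in (tot P) c (q t) (Y t))"
    proof (cases "t \<in> W")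
      case True
      have sub: "I \<inter> q -` fst c \<inter> W \<subseteq> T c d" using W(2) by (auto simp: T_def)
      have "smooth_on (T c d) (\<lambda>t. bump s r t *\<^sub>R hhat c d (snd c (q t)) u)"
        by (intro smooth_on_scaleR smooth_on_bump smooth_hhat_along c d smooth_on_const)
      then have "smooth_on (T c d) (\<lambda>t. coords_in (tot P) c (q t) (Y t))"
      proof (rule smooth_on_eqI)
        fix t assume "t \<in> T c d"
        from T_D[OF this] show "bump s r t *\<^sub>R hhat c d (snd c (q t)) u = coords_in (tot P) c (q t) (Y t)"
          by (simp add: Y_def hhat_def chart_inv_chart[OF okQ[OF c]] linear_scale[OF linear_coords_in[OF totA c]])
      qed
      then show ?thesis using True W(1) smooth_on_subset[OF _ sub] by blast
    next
      case False
      have "smooth_on (I \<inter> q -` fst c \<inter> - cball s r) (\<lambda>t. coords_in (tot P) c (q t) (Y t))"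
        by (rule smooth_on_eqI[OF smooth_on_const]) (simp add: Y0 linear_0[OF linear_coords_in[OF totA c]])
      moreover have "open (- cball s r)" "t \<in> - cball s r" using False s(2) by auto
      ultimately show ?thesis by blast
    qed
  qed
  moreover have "Y t \<in> H (q t)" for t
    unfolding Y_def by (rule subspace_scale[OF subspace_H horizontal_lift_in])
  moreover have "t0 \<notin> cball s r" "t1 \<notin> cball s r" using s(2) by force+
  then have "Y t0 = 0" "Y t1 = 0" using Y0 by blast+
  ultimately show ?thesis
    unfolding variation_def smooth_tangent_curve_def using q_smooth by blast
qed

lemma N_imp_multiplier:
  assumes N: "condition_N P H L t0 t1 q Xt"
  shows "\<exists>lam. smooth_on I lam \<and> condition_M P H L t0 t1 q Xt lam \<and> condition_V P H t0 t1 q Xt lam"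
proof -
  define F where "F t = FL P L (q t) (Xt t)" for t
  define h where "h t = HL P H L (q t) (Xt t)" for t
  \<comment> \<open>Variations enter the abstract statement only through their curvature terms,
    which depend linearly on them.\<close>
  define R where "R = {(\<lambda>t. curv t (pd Yt t)) | Yt. variation Yt}"
  have F: "smooth_on I F" and h: "smooth_on I h" 
    unfolding F_def[abs_def] h_def[abs_def] by (rule smooth_FL, rule smooth_HL)
  have "\<exists>p. smooth_on I p \<and> (\<forall>t\<in>I. (p has_vector_derivative h t + (p t o\<^sub>L Bop t)) (at t within I)) \<and>
      (\<forall>r\<in>R. integral I (\<lambda>t. blinfun_apply (F t - p t) (r t)) = 0)"
  proof (rule multiplier_exists[OF t01 smooth_Bop h F])
    show "smooth_on I r" if r: "r \<in> R" for r
    proof -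
      obtain Yt where Y: "r = (\<lambda>t. curv t (pd Yt t))" "variation Yt" using r unfolding R_def by blast
      show ?thesis unfolding Y(1)
        by (rule smooth_on_I, rule smooth_curv, assumption+, rule smooth_pushdown)
          (use Y(2) in \<open>auto simp: variation_def\<close>)
    qed
    show "\<exists>r\<in>R. \<forall>t\<in>I. r t = 0"
      using variation_0 unfolding R_def
      by (auto intro!: exI[of _ "\<lambda>t. 0"] simp: linear_0[OF linear_curv] linear_0[OF linear_tangent_proj])
    show "\<exists>s\<in>R. \<forall>t\<in>I. s t = c *\<^sub>R r t + r' t" if "r \<in> R" "r' \<in> R" for c r r'
    proof -
      obtain Y Y' where Y: "r = (\<lambda>t. curv t (pd Y t))" "variation Y" "r' = (\<lambda>t. curv t (pd Y' t))" "variation Y'"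
        using \<open>r \<in> R\<close> \<open>r' \<in> R\<close> unfolding R_def by blast
      define Z where "Z = (\<lambda>t. c *\<^sub>R Y t + Y' t)"
      have "(\<lambda>t. curv t (pd Z t)) \<in> R"
        unfolding R_def mem_Collect_eq
        by (rule exI[of _ Z], rule conjI[OF refl]) (simp add: Z_def variation_lin Y)
      moreover have "curv t (pd Z t) = c *\<^sub>R r t + r' t" for t
        by (simp add: Y Z_def linear_add[OF linear_curv] linear_scale[OF linear_curv]
            linear_add[OF linear_tangent_proj] linear_scale[OF linear_tangent_proj])
      ultimately show ?thesis by (intro bexI[of _ "\<lambda>t. curv t (pd Z t)"] ballI)
    qed
    fix r \<beta> assume r: "r \<in> R" and \<beta>: "smooth_on I \<beta>" "\<beta> t0 = 0" "\<beta> t1 = 0"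
      and ode: "\<And>t. t \<in> I \<Longrightarrow> (\<beta> has_vector_derivative - blinfun_apply (Bop t) (\<beta> t) - r t) (at t within I)"
    obtain Yt where Y: "r = (\<lambda>t. curv t (pd Yt t))" "variation Yt" using r unfolding R_def by blast
    have "vector_derivative \<beta> (at t within I) + vert_bracket P H (q t) (pd Xt t) (\<beta> t)
        + curvature P H (q t) (pd Xt t) (pd Yt t) = 0" if t: "t \<in> I" for t
      using thick_vector_derivative[OF thick_I t ode[OF t]] by (simp add: Y(1) curv_def Bop_apply)
    then show "integral I (\<lambda>t. blinfun_apply (h t) (\<beta> t)) = integral I (\<lambda>t. blinfun_apply (F t) (r t))"
      using N[unfolded condition_N_def, rule_format, of Yt \<beta>] Y(2) \<beta>
      unfolding variation_def F_def h_def Y(1) curv_def by blast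
  qed
  then obtain p where p: "smooth_on I p"
    "\<And>t. t \<in> I \<Longrightarrow> (p has_vector_derivative h t + (p t o\<^sub>L Bop t)) (at t within I)"
    "\<And>r. r \<in> R \<Longrightarrow> integral I (\<lambda>t. blinfun_apply (F t - p t) (r t)) = 0" by blast
  define lam where "lam t = F t - p t" for t
  have lam: "smooth_on I lam" unfolding lam_def by (rule smooth_on_diff[OF F p(1)])
  have Fl: "(\<lambda>s. FL P L (q s) (Xt s) - lam s) = p" by (simp add: lam_def F_def)
  have "condition_M P H L t0 t1 q Xt lam"
    unfolding condition_M_def Fl
  proof (intro ballI allI)
    fix t b assume t: "t \<in> I"
    have "FL P L (q t) (Xt t) - lam t = p t" by (simp add: lam_def F_def)
    then show "blinfun_apply (HL P H L (q t) (Xt t) - vector_derivative p (at t within I)) b +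
        blinfun_apply (FL P L (q t) (Xt t) - lam t) (vert_bracket P H (q t) (pd Xt t) b) = 0"
      using thick_vector_derivative[OF thick_I t p(2)[OF t]]
      by (simp add: h_def blinfun.diff_left blinfun.add_left blinfun.minus_left Bop_apply)
  qed
  moreover have "condition_V P H t0 t1 q Xt lam"
    unfolding condition_V_def
  proof (intro ballI allI)
    fix t Y assume t: "t \<in> I"
    let ?c = "chart_at (tot P) (q t)" and ?d = "chart_at (base P) (proj P (q t))"
    have cd: "?c \<in> tot P" "?d \<in> base P" "q t \<in> fst ?c" "proj P (q t) \<in> fst ?d"
      using chart_at_in[OF totA] chart_at_in[OF baseA] by auto
    obtain W where W: "open W" "T ?c ?d = I \<inter> W" using T_open[OF cd(1,2)] by blast
    \<comment> \<open>\<open>Y\<close> is extended along the path with constant coordinates in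
      \<open>?d\<close>; \<open>f\<close> is the pairing in (V) for this extension, so that (V) for
      \<open>Y\<close> at \<open>t\<close> reads \<open>f t = 0\<close>.\<close>
    define u where "u = bcoords ?d t Y"
    define y where "y s = from_coords (base P) ?d (proj P (q s)) u" for s
    define f where "f s = blinfun_apply (lam s) (curv s (y s))" for s
    have "smooth_on (T ?c ?d) (\<lambda>s. bcoords ?d s (y s))"
      by (rule smooth_on_eqI[OF smooth_on_const[of _ u]])
        (use T_D in \<open>simp add: y_def coords_in_from_coords[OF baseA cd(2)]\<close>)
    then have "smooth_on (T ?c ?d) f"
      unfolding f_def
      by (intro smooth_on_blinfun_apply smooth_on_subset[OF lam] smooth_curv[OF cd(1,2)]) (auto simp: T_def)
    then have cont: "continuous_on (I \<inter> W) f" using W by (simp add: smooth_on_imp_continuous_on)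
    have "f t = 0"
    proof (rule zero_of_bump_integrals[OF t01 W(1) cont])
      have "t \<in> T ?c ?d" using t cd by (simp add: T_def)
      then show "t \<in> I \<inter> W" using W by simp
      fix s r assume r: "r > 0" "cball s r \<subseteq> {t0<..<t1} \<inter> W"
      define Yt where "Yt = (\<lambda>t. bump s r t *\<^sub>R horizontal_lift P H (q t) (y t))"
      have "variation Yt"
        unfolding Yt_def y_def by (rule variation_bump[OF cd(2) W(1) _ r]) (use W(2) in \<open>auto simp: T_def\<close>)
      then have "integral I (\<lambda>t. blinfun_apply (F t - p t) (curv t (pd Yt t))) = 0"
        by (intro p(3)) (auto simp: R_def)
      \<comment> \<open>Linearity moves the bump out of the curvature, so testing with the variation
        \<open>Yt\<close> becomes testing \<open>f\<close> with the bump.\<close>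
      moreover have "blinfun_apply (F t - p t) (curv t (pd Yt t)) = bump s r t * f t" for t
        by (simp add: Yt_def f_def lam_def linear_scale[OF linear_tangent_proj] tangent_horizontal_lift
            linear_scale[OF linear_curv] blinfun.scaleR_right)
      ultimately show "integral I (\<lambda>t. bump s r t * f t) = 0" by simp
    qed
    moreover have "y t = Y"
      by (simp add: y_def u_def from_coords_coords_in[OF baseA cd(2,4)])
    ultimately show "blinfun_apply (lam t) (curvature P H (q t) (pd Xt t) Y) = 0"
      by (simp add: f_def curv_def)
  qed
  ultimately show ?thesis using lam by blast
qed

end

theorem lemma4p10:
  fixes P :: "('q::{t2_space,second_countable_topology}, 'eq::finite_euclidean,
      'm::{t2_space,second_countable_topology}, 'em::finite_euclidean,
      'g::{t2_space,second_countable_topology}, 'eg::finite_euclidean) bundle_data"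
    and H :: "'q \<Rightarrow> 'eq set" and L :: "'q \<times> 'eq \<Rightarrow> real"
    and t0 t1 :: real and q :: "real \<Rightarrow> 'q" and Xt :: "real \<Rightarrow> 'eq"
  assumes "principal_bundle P"
    and "horizontal_distribution P H"
    and "smooth_on_tangent_bundle (tot P) L"
    and "t0 < t1"
    and "horizontal_admissible_path P H {t0..t1} q Xt"
  shows "(\<forall>lam. smooth_on {t0..t1} lam \<and> condition_M P H L t0 t1 q Xt lam \<and>
            condition_V P H t0 t1 q Xt lam \<longrightarrow> condition_N P H L t0 t1 q Xt) \<and>
         (condition_N P H L t0 t1 q Xt \<longrightarrow>
            (\<exists>lam. smooth_on {t0..t1} lam \<and> condition_M P H L t0 t1 q Xt lam \<and>
               condition_V P H t0 t1 q Xt lam))"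
proof -
  interpret horizontal_path P H L t0 t1 q Xt
    using assms by unfold_locales
  show ?thesis using multiplier_imp_N N_imp_multiplier by blast
qed

end
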